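(* Consider the problem $\min_x\{f(x): Ax=b,\ x\in\mathcal{K}\}$ with $\mathcal{K}$ equipped with a $\vartheta$-LHSC barrier function $B$, and let Assumption A (stated in the context) hold. Let $\epsilon\in(0,1)$, $x^0\in\Omega^{\rm o}$, $\zeta\in(0,1)$, $\beta\in[\sqrt{\epsilon},1)$, $\theta\in(0,1)$, $\eta\in(0,1)$, $\delta\in(0,1)$ be the inputs of the NCGB method (described in the context). Define $$c_d=\frac{(1-\beta)^3}{(L_H+\zeta+4)[(1-\beta)^2+\sqrt{\vartheta}]+1-\beta},\qquad c_{\rm sol}=\eta\min\left\{c_d^2,\left[\frac{6(1-\beta)(1-\eta)\theta}{L_H(1-\beta)+1/2}\right]^2\right\},$$ $$c_{\rm nc}=\frac{\eta}{2}\min\left\{1,\left[\frac{3(1-\beta)(1-\eta)\theta}{L_H(1-\beta)+1/2}\right]^2\right\},\qquad \phi^0=f(x^0)+\bar\mu\max\{B(x^0),0\},$$ $$K_1=\left\lceil\frac{\phi^0-\underline{\phi}}{\min\{c_{\rm sol},c_{\rm nc}\}}\epsilon^{-3/2}\right\rceil+\left\lceil\frac{64(\phi^0-\underline{\phi})}{c_{\rm nc}}\epsilon^{-3/2}\right\rceil+1,\qquad K_2=\left\lceil\frac{64(\phi^0-\underline{\phi})}{c_{\rm nc}}\epsilon^{-3/2}\right\rceil+1,$$ and let $$\bar N=\widetilde{\mathcal{O}}\left(\min\{n,\epsilon^{-1/4}\}K_1+\min\left\{n,1+\left\lceil\epsilon^{-1/4}\ln\delta^{-1}\right\rceil\right\}K_2\right).$$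 Then the following statements hold. (i) When $\mathcal{K}$ is the nonnegative orthant, the total main operations of the NCGB method consist of $\bar N$ Hessian-vector products of $f$ and $\bar N$ products of an $m\times n$ matrix and its transpose. (ii) When $\mathcal{K}$ is a general cone, the total main operations of the NCGB method consist of $K_1+K_2$ Cholesky factorizations of the Hessian of $B$, $\bar N$ Hessian-vector products of $f$, and $(2m+6)\bar N$ backward or forward substitutions to a linear system with a lower or upper triangular coefficient matrix.
   Context: **Problem.** $A\in\mathbb{R}^{m\times n}$ has full row rank, $b\in\mathbb{R}^m$, $\mathcal{K}\subseteq\mathbb{R}^n$ is a closed pointed convex cone with nonempty interior $\mathrm{int}\,\mathcal{K}$. The problem $\min_x\{f(x):Ax=b,\ x\in\mathcal{K}\}$ has at least one optimal solution, $\Omega^{\rm o}=\{x:Ax=b,\ x\in\mathrm{int}\,\mathcal{K}\}\ne\emptyset$, and $f$ is twice continuously differentiable and nonconvex on $\Omega^{\rm o}$ (and all derivatives of $f$ appearing below are presumed to exist and be continuous where they are used). $\|\cdot\|$ is the Euclidean/spectral norm and $\lambda_{\min}$ the minimum eigenvalue. $\widetilde{\mathcal{O}}(\cdot)$ denotes $\mathcal{O}(\cdot)$ with logarithmic factors hidden. **Barrier.** $B:\mathrm{int}\,\mathcal{K}\to\mathbb{R}$ is a $\vartheta$-logarithmically homogeneous self-concordant ($\vartheta$-LHSC) barrier function for $\mathcal{K}$, $\vartheta\ge1$: (1) $B$ is convex and three times continuously differentiable, and $|\varphi'''(0)|\le2(\varphi''(0))^{3/2}$ for all $x\in\mathrm{int}\,\mathcal{K}$,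 $u\in\mathbb{R}^n$, where $\varphi(t)=B(x+tu)$; (2) $B(x)\to\infty$ as $x$ approaches the boundary of $\mathcal{K}$; (3) $B(tx)=B(x)-\vartheta\ln t$ for all $x\in\mathrm{int}\,\mathcal{K}$, $t>0$. (Since $\mathcal{K}$ is pointed, $\nabla^2B(x)$ is positive definite on $\mathrm{int}\,\mathcal{K}$.) When $\mathcal{K}$ is the nonnegative orthant, $B(x)=-\sum_{i=1}^n\ln x_i$. For $x\in\mathrm{int}\,\mathcal{K}$: $\|v\|_x=(v^T\nabla^2B(x)v)^{1/2}$, $\|v\|_x^*=(v^T[\nabla^2B(x)]^{-1}v)^{1/2}$ for $v\in\mathbb{R}^n$, and $\|M\|_x^*=\max_{\|v\|_x\le1}\|Mv\|_x^*$ for $M\in\mathbb{R}^{n\times n}$. For $\mu>0$, $\phi_\mu(x)=f(x)+\mu B(x)$. **Capped CG method.** Input: symmetric $H\in\mathbb{R}^{n\times n}$, $g\ne0$, $\varepsilon\in(0,1)$, $\zeta\in(0,1)$, scalar $U\ge0$. Output: a vector $\hat d$ and a flag d_type $\in\{\text{SOL},\text{NC}\}$. Set $\bar H=H+2\varepsilon I$, $\kappa=(U+2\varepsilon)/\varepsilon$, $\hat\zeta=\zeta/(3\kappa)$, $\tau=\sqrt\kappa/(\sqrt\kappa+1)$, $T=4\kappa^4/(1-\sqrt\tau)^2$ (whenever $U$ is updated these are recomputed). Set $y^0=0$, $r^0=g$, $p^0=-g$, $j=0$. If $(p^0)^T\bar Hp^0<\varepsilon\|p^0\|^2$, return $\hat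 d=p^0$, NC; else if $\|Hp^0\|>U\|p^0\|$, set $U\leftarrow\|Hp^0\|/\|p^0\|$. Then loop: - CG step: $\alpha_j=(r^j)^Tr^j/((p^j)^T\bar Hp^j)$, $y^{j+1}=y^j+\alpha_jp^j$, $r^{j+1}=r^j+\alpha_j\bar Hp^j$, $\beta_{j+1}=\|r^{j+1}\|^2/\|r^j\|^2$, $p^{j+1}=-r^{j+1}+\beta_{j+1}p^j$, $j\leftarrow j+1$. - For $w=p^j$, then $w=y^j$, then $w=r^j$: if $\|Hw\|>U\|w\|$, set $U\leftarrow\|Hw\|/\|w\|$. - If $(y^j)^T\bar Hy^j<\varepsilon\|y^j\|^2$, return $\hat d=y^j$, NC; else if $\|r^j\|\le\hat\zeta\|r^0\|$, return $\hat d=y^j$, SOL; else if $(p^j)^T\bar Hp^j<\varepsilon\|p^j\|^2$, return $\hat d=p^j$, NC; else if $\|r^j\|>\sqrt T\tau^{j/2}\|r^0\|$, compute $\alpha_j,y^{j+1}$ as in the CG step, find $i\in\{0,\dots,j-1\}$ with $(y^{j+1}-y^i)^T\bar H(y^{j+1}-y^i)<\varepsilon\|y^{j+1}-y^i\|^2$, and return $\hat d=y^{j+1}-y^i$, NC. **Minimum eigenvalue oracle.** Input: symmetric $H\in\mathbb{R}^{n\times n}$, $\varepsilon>0$, $\delta\in(0,1)$. Run the Lanczos method for estimating $\lambda_{\min}(H)$ from a random vector uniform on the unit sphere for at most $\min\{n,1+\lceil\varepsilon^{-1/2}\ln\delta^{-1}\rceil\}$ iterations. If a unit vector $v$ with $v^THv\le-\varepsilon/2$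 is found at some iteration, stop and return $v$; otherwise it certifies that $\lambda_{\min}(H)\ge-\varepsilon$ (which holds with probability at least $1-\sqrt{2.75n}\,\delta^{\|H\|^{-1/2}}$). **NCGB method** (Newton-CG based barrier method). At each iterate $x^k\in\mathrm{int}\,\mathcal{K}$ let $M_k\in\mathbb{R}^{n\times n}$ satisfy $M_kM_k^T=[\nabla^2B(x^k)]^{-1}$, and let $Q_k=I-M_k^TA^T(AM_kM_k^TA^T)^{-1}AM_k$, $P_k=M_kQ_k$, $R_k=-(AM_kM_k^TA^T)^{-1}AM_kM_k^T$. Let $\mathrm{sgn}(t)=1$ if $t\ge0$ and $-1$ otherwise; $c/0=\infty$ for $c>0$. Inputs: $\epsilon\in(0,1)$, $x^0\in\Omega^{\rm o}$, $\zeta\in(0,1)$, $\beta\in[\sqrt\epsilon,1)$, $\theta,\eta,\delta\in(0,1)$, $\vartheta$. Set $x^{-1}=x^0$, $d^{-1}=0$, $\mu=\frac{(1-\beta)\epsilon}{2((1-\beta)^2+\sqrt\vartheta)}$, d_type $=$ NC, $\alpha_{-1}=0$, $\lambda^{(2)}_{-1}=0$. For $k=0,1,2,\dots$: 1. Set $\lambda_k^{(1)}=R_k\nabla\phi_\mu(x^k)$. If d_type $=$ SOL and $\alpha_{k-1}=1$, set $\lambda_k^{(2)}=R_{k-1}(\nabla^2f(x^{k-1})P_{k-1}d^{k-1}+\nabla\phi_\mu(x^{k-1}))$; else $\lambda_k^{(2)}=\lambda_{k-1}^{(2)}$. 2. If $\min\{\|\nabla f(x^k)+A^T\lambda_k^{(1)}+\mu\nabla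 B(x^k)\|_{x^k}^*,\ \|\nabla f(x^k)+A^T\lambda_k^{(2)}+\mu\nabla B(x^{k-1})\|_{x^k}^*\}>(1-\beta)\mu$: call the capped CG method with $H=P_k^T\nabla^2\phi_\mu(x^k)P_k$, $\varepsilon=\sqrt\epsilon$, $g=P_k^T\nabla\phi_\mu(x^k)$, accuracy $\zeta$, $U=0$, obtaining $\hat d^k$ and d_type. If d_type $=$ NC, set $d^k=-\mathrm{sgn}(g^T\hat d^k)\min\Big\{\frac{|(\hat d^k)^TP_k^T\nabla^2\phi_\mu(x^k)P_k\hat d^k|}{\|\hat d^k\|^3},\frac{\beta}{\|Q_k\hat d^k\|}\Big\}\hat d^k$; if d_type $=$ SOL, set $d^k=\min\{1,\beta/\|Q_k\hat d^k\|\}\hat d^k$. 3. Otherwise: call the minimum eigenvalue oracle with $H=P_k^T\nabla^2f(x^k)P_k$, $\varepsilon=\sqrt\epsilon$, and $\delta$. If it certifies $\lambda_{\min}(H)\ge-\sqrt\epsilon$, output $x^k$ and terminate. Otherwise, with the returned $v$, set $d^k=-\mathrm{sgn}(v^TP_k^T\nabla\phi_\mu(x^k))\min\{|v^TP_k^T\nabla^2\phi_\mu(x^k)P_kv|,\ \beta/\|Q_kv\|\}v$ and d_type $=$ NC. 4. Line search: $\alpha_k=\theta^{j_k}$, where $j_k$ is the smallest nonnegative integer $j$ such that: if d_type $=$ SOL, $\phi_\mu(x^k+\theta^jP_kd^k)<\phi_\mu(x^k)-\eta\sqrt\epsilon\,\theta^{2j}\|d^k\|^2$; if d_type $=$ NC,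 $\phi_\mu(x^k+\theta^jP_kd^k)<\phi_\mu(x^k)-\eta\theta^{2j}\|d^k\|^3/2$. Set $x^{k+1}=x^k+\alpha_kP_kd^k$. **Assumption A.** (a) There exist $\bar\mu\ge\mu$ and $\underline\phi\in\mathbb{R}$ such that $\phi_{\tilde\mu}(x)\ge\underline\phi$ for all $\tilde\mu\in(0,\bar\mu]$, $x\in\Omega^{\rm o}$, and $\mathcal{S}=\bigcup_{\tilde\mu\in(0,\bar\mu]}\{x\in\Omega^{\rm o}:\phi_{\tilde\mu}(x)\le\phi_{\tilde\mu}(x^0)\}$ is bounded. (b) There exists $L_H>0$ such that $\|\nabla^2f(y)-\nabla^2f(x)\|_x^*\le L_H\|x-y\|_x$ for all $x\in\mathcal{S}$ and all $y$ with $\|y-x\|_x\le\beta$. (c) $U_g=\sup_{x\in\mathcal{S}}\|\nabla f(x)\|_x^*$ and $U_H=\sup_{x\in\mathcal{S}}\|\nabla^2f(x)\|_x^*$ are finite. **Main operations (counting convention).** The main operation of each iteration of the capped CG method and of the Lanczos method is a product $Hv$ of the matrix $H$ with a vector; all other work per NCGB iteration counted (computing $\lambda_k^{(1)},\lambda_k^{(2)}$ and the two local norms in step 2) costs no more than one such product, and a product with $P_k^T\nabla^2f(x^k)P_k$ costs no more than one with $P_k^T\nabla^2\phi_\mu(x^k)P_k$. With $H=P_k^T\nabla^2\phi_\mu(x^k)P_k$ one computes $Hv=v^5+\mu v^1$ via $v^1=Q_kv$, $v^2=M_kv^1$, $v^3=\nabla^2f(x^k)v^2$, $v^4=M_k^Tv^3$,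 $v^5=Q_kv^4$. Here $M_k^{-T}$ is the Cholesky factor of $\nabla^2B(x^k)=M_k^{-T}M_k^{-1}$, computed once per NCGB iteration; products of $M_k$ or $M_k^T$ with a vector are done by backward/forward substitution with the triangular matrices $M_k^{-1}$ or $M_k^{-T}$; and $AM_kM_k^TA^T$ is formed as $N^TN$ with $N=M_k^TA^T$. "Main operations" are the dominant operations of the resulting computation: for the nonnegative orthant ($\nabla^2B(x^k)$ diagonal) the $\mathcal{O}(n)$ Cholesky factorization and the $\mathcal{O}(mn)$ substitutions per product $Hv$ are not counted as dominant; for a general cone, the Cholesky factorization typically costs at least $\mathcal{O}(n^3)$, the $2m+6$ substitutions per product $Hv$ cost $\mathcal{O}(mn^2)$, and the product of an $m\times n$ matrix with its transpose costs $\mathcal{O}(m^2n)$ with $m\le n$. *)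

theory Defs
  imports "HOL-Analysis.Analysis" "HOL-Library.Multiset"
begin

primrec Ck_on :: "nat \<Rightarrow> ('a::real_normed_vector \<Rightarrow> 'b::real_normed_vector) \<Rightarrow> 'a set \<Rightarrow> bool" where
  "Ck_on 0 f S \<longleftrightarrow> continuous_on S f"
| "Ck_on (Suc k) f S \<longleftrightarrow>
     (\<forall>x\<in>S. f differentiable at x) \<and> (\<forall>v. Ck_on k (\<lambda>x. frechet_derivative f (at x) v) S)"

definition grad :: "(real^'n \<Rightarrow> real) \<Rightarrow> real^'n \<Rightarrow> real^'n" where
  "grad f x = (THE D. GDERIV f x :> D)"

definition hessian :: "(real^'n \<Rightarrow> real) \<Rightarrow> real^'n \<Rightarrow> real^'n^'n" where
  "hessian f x = jacobian (grad f) (at x)"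

definition pointed_cone :: "(real^'n) set \<Rightarrow> bool" where
  "pointed_cone K \<longleftrightarrow> closed K \<and> convex K \<and> cone K \<and> (\<forall>x. x \<in> K \<and> - x \<in> K \<longrightarrow> x = 0)
     \<and> interior K \<noteq> {}"

definition self_concordant_on :: "(real^'n) set \<Rightarrow> (real^'n \<Rightarrow> real) \<Rightarrow> bool" where
  "self_concordant_on S B \<longleftrightarrow> convex_on S B \<and> Ck_on 3 B S \<and>
     (\<forall>x\<in>S. \<forall>u. let \<phi> = (\<lambda>t::real. B (x + t *\<^sub>R u))
        in \<bar>(deriv ^^ 3) \<phi> 0\<bar> \<le> 2 * ((deriv ^^ 2) \<phi> 0) powr (3/2))"

definition lhsc_barrier :: "(real^'n) set \<Rightarrow> real \<Rightarrow> (real^'n \<Rightarrow> real) \<Rightarrow> bool" where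
  "lhsc_barrier K \<nu> B \<longleftrightarrow> \<nu> \<ge> 1 \<and> self_concordant_on (interior K) B \<and>
     (\<forall>z\<in>frontier K. filterlim B at_top (at z within interior K)) \<and>
     (\<forall>x\<in>interior K. \<forall>t>0. B (t *\<^sub>R x) = B x - \<nu> * ln t)"

definition local_norm :: "(real^'n \<Rightarrow> real) \<Rightarrow> real^'n \<Rightarrow> real^'n \<Rightarrow> real" where
  "local_norm B x v = sqrt (v \<bullet> (hessian B x *v v))"

definition dual_norm :: "(real^'n \<Rightarrow> real) \<Rightarrow> real^'n \<Rightarrow> real^'n \<Rightarrow> real" where
  "dual_norm B x v = sqrt (v \<bullet> (matrix_inv (hessian B x) *v v))"

definition dual_matrix_norm :: "(real^'n \<Rightarrow> real) \<Rightarrow> real^'n \<Rightarrow> real^'n^'n \<Rightarrow> real" where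
  "dual_matrix_norm B x M = (SUP v\<in>{v. local_norm B x v \<le> 1}. dual_norm B x (M *v v))"

definition nonneg_orthant :: "(real^'n) set" where
  "nonneg_orthant = {x. \<forall>i. 0 \<le> x $ i}"

definition log_barrier :: "real^'n \<Rightarrow> real" where
  "log_barrier x = - (\<Sum>i\<in>UNIV. ln (x $ i))"

definition strictly_feasible :: "real^'n^'m \<Rightarrow> real^'m \<Rightarrow> (real^'n) set \<Rightarrow> (real^'n) set" where
  "strictly_feasible A b K = {x. A *v x = b \<and> x \<in> interior K}"

definition barrier_obj :: "(real^'n \<Rightarrow> real) \<Rightarrow> (real^'n \<Rightarrow> real) \<Rightarrow> real \<Rightarrow> real^'n \<Rightarrow> real" where
  "barrier_obj f B \<mu> x = f x + \<mu> * B x"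

definition sublevel_union ::
  "(real^'n \<Rightarrow> real) \<Rightarrow> (real^'n \<Rightarrow> real) \<Rightarrow> (real^'n) set \<Rightarrow> real \<Rightarrow> real^'n \<Rightarrow> (real^'n) set" where
  "sublevel_union f B \<Omega> \<mu>bar x0 =
     (\<Union>\<mu>\<in>{0<..\<mu>bar}. {x\<in>\<Omega>. barrier_obj f B \<mu> x \<le> barrier_obj f B \<mu> x0})"

text \<open>The gradient and Hessian of \<open>f\<close> are evaluated on the strictly feasible set, which need not be
  open, and on the ellipsoids of radius \<open>\<beta>\<close> around points of the level set \<open>S\<close>; so \<open>f\<close> is twice
  continuously differentiable on some open set containing all of these.\<close>

definition conic_problem ::
  "real^'n^'m \<Rightarrow> real^'m \<Rightarrow> (real^'n) set \<Rightarrow> (real^'n \<Rightarrow> real) \<Rightarrow> (real^'n \<Rightarrow> real) \<Rightarrow> real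
   \<Rightarrow> (real^'n) set \<Rightarrow> bool" where
  "conic_problem A b K f B \<beta> S \<longleftrightarrow>
     rank A = CARD('m) \<and> pointed_cone K \<and>
     (\<exists>x. A *v x = b \<and> x \<in> K \<and> (\<forall>y. A *v y = b \<and> y \<in> K \<longrightarrow> f x \<le> f y)) \<and>
     strictly_feasible A b K \<noteq> {} \<and>
     \<not> convex_on (strictly_feasible A b K) f \<and>
     (\<exists>D. open D \<and> strictly_feasible A b K \<subseteq> D \<and>
          (\<forall>x\<in>S. {y. local_norm B x (y - x) \<le> \<beta>} \<subseteq> D) \<and> Ck_on 2 f D)"

definition assumption_A ::
  "(real^'n \<Rightarrow> real) \<Rightarrow> (real^'n \<Rightarrow> real) \<Rightarrow> (real^'n) set \<Rightarrow> real^'n \<Rightarrow> real \<Rightarrow> real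
   \<Rightarrow> real \<Rightarrow> real \<Rightarrow> real \<Rightarrow> real \<Rightarrow> real \<Rightarrow> bool" where
  "assumption_A f B \<Omega> x0 \<beta> \<mu> \<mu>bar \<phi>low L\<^sub>H U\<^sub>g U\<^sub>H \<longleftrightarrow>
     (let S = sublevel_union f B \<Omega> \<mu>bar x0 in
      (\<mu>bar \<ge> \<mu> \<and> (\<forall>\<mu>'\<in>{0<..\<mu>bar}. \<forall>x\<in>\<Omega>. \<phi>low \<le> barrier_obj f B \<mu>' x) \<and> bounded S) \<and>
      (L\<^sub>H > 0 \<and> (\<forall>x\<in>S. \<forall>y. local_norm B x (y - x) \<le> \<beta> \<longrightarrow>
          dual_matrix_norm B x (hessian f y - hessian f x) \<le> L\<^sub>H * local_norm B x (x - y))) \<and>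
      (bdd_above ((\<lambda>x. dual_norm B x (grad f x)) ` S) \<and>
       U\<^sub>g = (SUP x\<in>S. dual_norm B x (grad f x)) \<and>
       bdd_above ((\<lambda>x. dual_matrix_norm B x (hessian f x)) ` S) \<and>
       U\<^sub>H = (SUP x\<in>S. dual_matrix_norm B x (hessian f x))))"

datatype dir_type = SOL | NC

record ('n::finite) cg_state =
  cg_y :: "real^'n"
  cg_r :: "real^'n"
  cg_p :: "real^'n"
  cg_U :: real

definition shifted :: "real^'n^'n \<Rightarrow> real \<Rightarrow> real^'n^'n" where
  "shifted H e = H + mat (2 * e)"

definition low_curvature :: "real^'n^'n \<Rightarrow> real \<Rightarrow> real^'n \<Rightarrow> bool" where
  "low_curvature H e w \<longleftrightarrow> w \<bullet> (shifted H e *v w) < e * (norm w)\<^sup>2"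

definition upd_U :: "real^'n^'n \<Rightarrow> real^'n \<Rightarrow> real \<Rightarrow> real" where
  "upd_U H w U = (if norm (H *v w) > U * norm w then norm (H *v w) / norm w else U)"

definition cg_init :: "real^'n^'n \<Rightarrow> real^'n \<Rightarrow> real \<Rightarrow> 'n cg_state" where
  "cg_init H g U = \<lparr>cg_y = 0, cg_r = g, cg_p = - g, cg_U = upd_U H (- g) U\<rparr>"

definition cg_step :: "real^'n^'n \<Rightarrow> real \<Rightarrow> 'n cg_state \<Rightarrow> 'n cg_state" where
  "cg_step H e s =
    (let p = cg_p s; r = cg_r s; Hp = shifted H e *v p;
         \<alpha> = (r \<bullet> r) / (p \<bullet> Hp);
         y' = cg_y s + \<alpha> *\<^sub>R p;
         r' = r + \<alpha> *\<^sub>R Hp;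
         p' = - r' + ((norm r')\<^sup>2 / (norm r)\<^sup>2) *\<^sub>R p
     in \<lparr>cg_y = y', cg_r = r', cg_p = p', cg_U = upd_U H r' (upd_U H y' (upd_U H p' (cg_U s)))\<rparr>)"

primrec cg_iter :: "real^'n^'n \<Rightarrow> real^'n \<Rightarrow> real \<Rightarrow> real \<Rightarrow> nat \<Rightarrow> 'n cg_state" where
  "cg_iter H g e U 0 = cg_init H g U"
| "cg_iter H g e U (Suc j) = cg_step H e (cg_iter H g e U j)"

definition cg_kappa :: "real \<Rightarrow> real \<Rightarrow> real" where
  "cg_kappa e U = (U + 2 * e) / e"

definition cg_zeta_hat :: "real \<Rightarrow> real \<Rightarrow> real \<Rightarrow> real" where
  "cg_zeta_hat e \<zeta> U = \<zeta> / (3 * cg_kappa e U)"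

definition cg_tau :: "real \<Rightarrow> real \<Rightarrow> real" where
  "cg_tau e U = sqrt (cg_kappa e U) / (sqrt (cg_kappa e U) + 1)"

definition cg_T :: "real \<Rightarrow> real \<Rightarrow> real" where
  "cg_T e U = 4 * cg_kappa e U ^ 4 / (1 - sqrt (cg_tau e U))\<^sup>2"

definition cg_small_residual where
  "cg_small_residual H g e \<zeta> U j \<longleftrightarrow>
     (let s = cg_iter H g e U j in norm (cg_r s) \<le> cg_zeta_hat e \<zeta> (cg_U s) * norm g)"

definition cg_slow_decay where
  "cg_slow_decay H g e U j \<longleftrightarrow>
     (let s = cg_iter H g e U j
      in norm (cg_r s) > sqrt (cg_T e (cg_U s)) * cg_tau e (cg_U s) powr (real j / 2) * norm g)"

definition cg_stops :: "real^'n^'n \<Rightarrow> real^'n \<Rightarrow> real \<Rightarrow> real \<Rightarrow> real \<Rightarrow> nat \<Rightarrow> bool" where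
  "cg_stops H g e \<zeta> U j \<longleftrightarrow>
     (let s = cg_iter H g e U j in
      if j = 0 then low_curvature H e (cg_p s)
      else low_curvature H e (cg_y s) \<or> cg_small_residual H g e \<zeta> U j
           \<or> low_curvature H e (cg_p s) \<or> cg_slow_decay H g e U j)"

text \<open>Loop index \<open>j\<close> is reached, possibly without having returned there.\<close>

definition cg_reaches :: "real^'n^'n \<Rightarrow> real^'n \<Rightarrow> real \<Rightarrow> real \<Rightarrow> real \<Rightarrow> nat \<Rightarrow> bool" where
  "cg_reaches H g e \<zeta> U j \<longleftrightarrow> (\<forall>i<j. \<not> cg_stops H g e \<zeta> U i)"

text \<open>A relation rather than a function, since the search over \<open>i\<close> may pick any admissible index.\<close>

definition cg_returns ::
  "real^'n^'n \<Rightarrow> real^'n \<Rightarrow> real \<Rightarrow> real \<Rightarrow> real \<Rightarrow> nat \<Rightarrow> real^'n \<Rightarrow> dir_type \<Rightarrow> bool" where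
  "cg_returns H g e \<zeta> U j dhat t \<longleftrightarrow> cg_reaches H g e \<zeta> U j \<and>
     (let s = cg_iter H g e U j in
      if j = 0 then low_curvature H e (cg_p s) \<and> dhat = cg_p s \<and> t = NC
      else if low_curvature H e (cg_y s) then dhat = cg_y s \<and> t = NC
      else if cg_small_residual H g e \<zeta> U j then dhat = cg_y s \<and> t = SOL
      else if low_curvature H e (cg_p s) then dhat = cg_p s \<and> t = NC
      else cg_slow_decay H g e U j \<and> t = NC \<and>
        (\<exists>i<j. dhat = cg_y (cg_iter H g e U (Suc j)) - cg_y (cg_iter H g e U i)
               \<and> low_curvature H e dhat))"

definition krylov :: "real^'n^'n \<Rightarrow> real^'n \<Rightarrow> nat \<Rightarrow> (real^'n) set" where
  "krylov H q l = span ((\<lambda>i. (((*v) H) ^^ i) q) ` {..<l})"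

definition lanczos_limit :: "nat \<Rightarrow> real \<Rightarrow> real \<Rightarrow> nat" where
  "lanczos_limit n e \<delta> = min n (1 + nat \<lceil>e powr (-1/2) * ln (1 / \<delta>)\<rceil>)"

text \<open>A suitable vector exists in the Krylov space iff the Ritz vector for its smallest Ritz value
  is one.\<close>

definition lanczos_finds :: "real^'n^'n \<Rightarrow> real \<Rightarrow> real^'n \<Rightarrow> nat \<Rightarrow> real^'n \<Rightarrow> bool" where
  "lanczos_finds H e q l v \<longleftrightarrow> v \<in> krylov H q l \<and> norm v = 1 \<and> v \<bullet> (H *v v) \<le> - e / 2"

text \<open>The first \<open>l\<close> Lanczos iterations from the (randomly drawn) unit vector \<open>q\<close> are carried out. A
  certifying call is one that reaches the iteration limit, or exhausts the Krylov space, without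
  finding a vector.\<close>

definition meo_reaches :: "real^'n^'n \<Rightarrow> real \<Rightarrow> real \<Rightarrow> real^'n \<Rightarrow> nat \<Rightarrow> bool" where
  "meo_reaches H e \<delta> q l \<longleftrightarrow> l \<le> lanczos_limit CARD('n) e \<delta> \<and>
     (\<forall>i<l. \<nexists>v. lanczos_finds H e q i v)"

definition meo_returns :: "real^'n^'n \<Rightarrow> real \<Rightarrow> real \<Rightarrow> real^'n \<Rightarrow> nat \<Rightarrow> real^'n \<Rightarrow> bool" where
  "meo_returns H e \<delta> q l v \<longleftrightarrow> meo_reaches H e \<delta> q l \<and> lanczos_finds H e q l v"

text \<open>\<open>Gram_product\<close> is the product of an \<open>m\<times>n\<close> matrix with its transpose, and
  \<open>Triangular_solve\<close> a forward or backward substitution.\<close>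

datatype operation = Cholesky | Hess_vec | Gram_product | Triangular_solve

text \<open>For a product with \<open>Q = I - M\<^sup>T A\<^sup>T (A M M\<^sup>T A\<^sup>T)\<inverse> A M\<close>: \<open>m\<close> substitutions form
  \<open>N = M\<^sup>T A\<^sup>T\<close>, one product forms \<open>N\<^sup>T N\<close>, and one substitution each serves the outer
  products with \<open>M\<close> and \<open>M\<^sup>T\<close>.\<close>

definition Q_vec_ops :: "nat \<Rightarrow> operation multiset" where
  "Q_vec_ops m = replicate_mset (m + 2) Triangular_solve + {#Gram_product#}"

text \<open>One product with \<open>P\<^sup>T (\<nabla>\<^sup>2f + \<mu> \<nabla>\<^sup>2B) P\<close>, evaluated as \<open>Q M\<^sup>T \<nabla>\<^sup>2f M (Q v) + \<mu> (Q v)\<close>.\<close>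

definition Hv_ops :: "nat \<Rightarrow> operation multiset" where
  "Hv_ops m = Q_vec_ops m + {#Triangular_solve, Hess_vec, Triangular_solve#} + Q_vec_ops m"

definition orthant_main_operations :: "operation set" where
  "orthant_main_operations = {Hess_vec, Gram_product}"

definition general_main_operations :: "operation set" where
  "general_main_operations = {Cholesky, Hess_vec, Triangular_solve}"

definition sign_pm :: "real \<Rightarrow> real" where
  "sign_pm t = (if t \<ge> 0 then 1 else -1)"

text \<open>The minimum of \<open>s\<close> and \<open>c / t\<close> with \<open>c / 0 = \<infinity>\<close>.\<close>

definition min_ratio :: "real \<Rightarrow> real \<Rightarrow> real \<Rightarrow> real" where
  "min_ratio s c t = (if t = 0 then s else min s (c / t))"

locale ncgb =
  fixes A :: "real^'n^'m" and f B :: "real^'n \<Rightarrow> real" and \<nu> :: real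
    and x0 :: "real^'n" and \<epsilon> \<zeta> \<beta> \<theta> \<eta> \<delta> :: real
begin

definition \<mu> :: real where
  "\<mu> = (1 - \<beta>) * \<epsilon> / (2 * ((1 - \<beta>)\<^sup>2 + sqrt \<nu>))"

abbreviation \<phi> :: "real^'n \<Rightarrow> real" where
  "\<phi> \<equiv> barrier_obj f B \<mu>"

definition G :: "real^'n^'n \<Rightarrow> real^'m^'m" where
  "G M = A ** M ** transpose M ** transpose A"

definition Q :: "real^'n^'n \<Rightarrow> real^'n^'n" where
  "Q M = mat 1 - transpose M ** transpose A ** matrix_inv (G M) ** A ** M"

definition P :: "real^'n^'n \<Rightarrow> real^'n^'n" where
  "P M = M ** Q M"

definition R :: "real^'n^'n \<Rightarrow> real^'n^'m" where
  "R M = - (matrix_inv (G M) ** A ** M ** transpose M)"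

definition red_grad :: "real^'n \<Rightarrow> real^'n^'n \<Rightarrow> real^'n" where
  "red_grad x M = transpose (P M) *v grad \<phi> x"

definition red_hess_\<phi> :: "real^'n \<Rightarrow> real^'n^'n \<Rightarrow> real^'n^'n" where
  "red_hess_\<phi> x M = transpose (P M) ** hessian \<phi> x ** P M"

definition red_hess_f :: "real^'n \<Rightarrow> real^'n^'n \<Rightarrow> real^'n^'n" where
  "red_hess_f x M = transpose (P M) ** hessian f x ** P M"

definition multiplier1 :: "real^'n \<Rightarrow> real^'n^'n \<Rightarrow> real^'m" where
  "multiplier1 x M = R M *v grad \<phi> x"

primrec multiplier2 ::
  "(nat \<Rightarrow> real^'n) \<Rightarrow> (nat \<Rightarrow> real^'n^'n) \<Rightarrow> (nat \<Rightarrow> dir_type) \<Rightarrow> (nat \<Rightarrow> real^'n) \<Rightarrow> (nat \<Rightarrow> real)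
   \<Rightarrow> nat \<Rightarrow> real^'m" where
  "multiplier2 x M t d \<alpha> 0 = 0"
| "multiplier2 x M t d \<alpha> (Suc k) =
     (if t k = SOL \<and> \<alpha> k = 1
      then R (M k) *v (hessian f (x k) *v (P (M k) *v d k) + grad \<phi> (x k))
      else multiplier2 x M t d \<alpha> k)"

text \<open>Truncated subtraction yields the convention that the iterate before the first one is \<open>x 0\<close>.\<close>

definition calls_cg ::
  "(nat \<Rightarrow> real^'n) \<Rightarrow> (nat \<Rightarrow> real^'n^'n) \<Rightarrow> (nat \<Rightarrow> dir_type) \<Rightarrow> (nat \<Rightarrow> real^'n) \<Rightarrow> (nat \<Rightarrow> real)
   \<Rightarrow> nat \<Rightarrow> bool" where
  "calls_cg x M t d \<alpha> k \<longleftrightarrow>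
     min (dual_norm B (x k) (grad f (x k) + transpose A *v multiplier1 (x k) (M k)
                             + \<mu> *\<^sub>R grad B (x k)))
         (dual_norm B (x k) (grad f (x k) + transpose A *v multiplier2 x M t d \<alpha> k
                             + \<mu> *\<^sub>R grad B (x (k - 1))))
     > (1 - \<beta>) * \<mu>"

definition cg_direction :: "real^'n \<Rightarrow> real^'n^'n \<Rightarrow> real^'n \<Rightarrow> dir_type \<Rightarrow> real^'n" where
  "cg_direction x M dhat t =
     (case t of
        NC \<Rightarrow> (- sign_pm (red_grad x M \<bullet> dhat)
                * min_ratio (\<bar>dhat \<bullet> (red_hess_\<phi> x M *v dhat)\<bar> / norm dhat ^ 3)
                    \<beta> (norm (Q M *v dhat))) *\<^sub>R dhat
      | SOL \<Rightarrow> min_ratio 1 \<beta> (norm (Q M *v dhat)) *\<^sub>R dhat)"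

definition meo_direction :: "real^'n \<Rightarrow> real^'n^'n \<Rightarrow> real^'n \<Rightarrow> real^'n" where
  "meo_direction x M v =
     (- sign_pm (v \<bullet> red_grad x M)
      * min_ratio \<bar>v \<bullet> (red_hess_\<phi> x M *v v)\<bar> \<beta> (norm (Q M *v v))) *\<^sub>R v"

definition sufficient_decrease :: "real^'n \<Rightarrow> real^'n^'n \<Rightarrow> dir_type \<Rightarrow> real^'n \<Rightarrow> nat \<Rightarrow> bool" where
  "sufficient_decrease x M t d j \<longleftrightarrow>
     \<phi> (x + \<theta> ^ j *\<^sub>R (P M *v d)) <
     (case t of SOL \<Rightarrow> \<phi> x - \<eta> * sqrt \<epsilon> * \<theta> ^ (2 * j) * (norm d)\<^sup>2
              | NC \<Rightarrow> \<phi> x - \<eta> * \<theta> ^ (2 * j) * norm d ^ 3 / 2)"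

definition line_search :: "real^'n \<Rightarrow> real^'n^'n \<Rightarrow> dir_type \<Rightarrow> real^'n \<Rightarrow> real \<Rightarrow> bool" where
  "line_search x M t d a \<longleftrightarrow>
     (\<exists>j. sufficient_decrease x M t d j \<and> (\<forall>i<j. \<not> sufficient_decrease x M t d i) \<and> a = \<theta> ^ j)"

text \<open>An execution of the algorithm up to an arbitrary moment: iterations \<open>0, \<dots>, N - 1\<close> have been
  started, all but the last of them are complete, and \<open>w k\<close> is the number of inner iterations of
  capped CG or Lanczos that iteration \<open>k\<close> has carried out. Complete runs are those whose last
  iteration is a certifying oracle call. \<open>q k\<close> is the outcome of the random draw of the oracle, and
  \<open>M k\<close> an arbitrary factor, such as the inverse transpose of the Cholesky factor of the Hessian.\<close>

definition execution ::
  "nat \<Rightarrow> (nat \<Rightarrow> real^'n) \<Rightarrow> (nat \<Rightarrow> real^'n^'n) \<Rightarrow> (nat \<Rightarrow> real^'n) \<Rightarrow> (nat \<Rightarrow> nat)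
   \<Rightarrow> (nat \<Rightarrow> dir_type) \<Rightarrow> (nat \<Rightarrow> real^'n) \<Rightarrow> (nat \<Rightarrow> real) \<Rightarrow> bool" where
  "execution N x M q w t d \<alpha> \<longleftrightarrow>
     x 0 = x0 \<and>
     (\<forall>k<N. M k ** transpose (M k) = matrix_inv (hessian B (x k)) \<and> norm (q k) = 1 \<and>
        (if calls_cg x M t d \<alpha> k
         then cg_reaches (red_hess_\<phi> (x k) (M k)) (red_grad (x k) (M k)) (sqrt \<epsilon>) \<zeta> 0 (w k)
         else meo_reaches (red_hess_f (x k) (M k)) (sqrt \<epsilon>) \<delta> (q k) (w k))) \<and>
     (\<forall>k. Suc k < N \<longrightarrow>
        (if calls_cg x M t d \<alpha> k
         then \<exists>dhat. cg_returns (red_hess_\<phi> (x k) (M k)) (red_grad (x k) (M k)) (sqrt \<epsilon>) \<zeta> 0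
                       (w k) dhat (t k)
                     \<and> d k = cg_direction (x k) (M k) dhat (t k)
         else \<exists>v. meo_returns (red_hess_f (x k) (M k)) (sqrt \<epsilon>) \<delta> (q k) (w k) v
                  \<and> d k = meo_direction (x k) (M k) v \<and> t k = NC) \<and>
        line_search (x k) (M k) (t k) (d k) (\<alpha> k) \<and>
        x (Suc k) = x k + \<alpha> k *\<^sub>R (P (M k) *v d k))"

text \<open>Capped CG needs one product for its initial test and one in each pass through its loop, Lanczos
  one per iteration. The remaining work in an iteration (multipliers and stopping test) costs at most
  one more product and is charged as such; a product with the reduced Hessian of \<open>f\<close> is charged like
  one with that of \<open>\<phi>\<close>.\<close>

definition iteration_products ::
  "(nat \<Rightarrow> real^'n) \<Rightarrow> (nat \<Rightarrow> real^'n^'n) \<Rightarrow> (nat \<Rightarrow> nat)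
   \<Rightarrow> (nat \<Rightarrow> dir_type) \<Rightarrow> (nat \<Rightarrow> real^'n) \<Rightarrow> (nat \<Rightarrow> real) \<Rightarrow> nat \<Rightarrow> nat" where
  "iteration_products x M w t d \<alpha> k = (if calls_cg x M t d \<alpha> k then w k + 1 else w k) + 1"

definition total_ops ::
  "nat \<Rightarrow> (nat \<Rightarrow> real^'n) \<Rightarrow> (nat \<Rightarrow> real^'n^'n) \<Rightarrow> (nat \<Rightarrow> nat)
   \<Rightarrow> (nat \<Rightarrow> dir_type) \<Rightarrow> (nat \<Rightarrow> real^'n) \<Rightarrow> (nat \<Rightarrow> real) \<Rightarrow> operation multiset" where
  "total_ops N x M w t d \<alpha> =
     (\<Sum>k<N. {#Cholesky#} + repeat_mset (iteration_products x M w t d \<alpha> k) (Hv_ops CARD('m)))"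

end

definition c_d :: "real \<Rightarrow> real \<Rightarrow> real \<Rightarrow> real \<Rightarrow> real" where
  "c_d \<nu> \<zeta> \<beta> L = (1 - \<beta>) ^ 3 / ((L + \<zeta> + 4) * ((1 - \<beta>)\<^sup>2 + sqrt \<nu>) + 1 - \<beta>)"

definition c_sol :: "real \<Rightarrow> real \<Rightarrow> real \<Rightarrow> real \<Rightarrow> real \<Rightarrow> real \<Rightarrow> real" where
  "c_sol \<nu> \<zeta> \<beta> \<theta> \<eta> L =
     \<eta> * min ((c_d \<nu> \<zeta> \<beta> L)\<^sup>2) ((6 * (1 - \<beta>) * (1 - \<eta>) * \<theta> / (L * (1 - \<beta>) + 1/2))\<^sup>2)"

definition c_nc :: "real \<Rightarrow> real \<Rightarrow> real \<Rightarrow> real \<Rightarrow> real" where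
  "c_nc \<beta> \<theta> \<eta> L = \<eta> / 2 * min 1 ((3 * (1 - \<beta>) * (1 - \<eta>) * \<theta> / (L * (1 - \<beta>) + 1/2))\<^sup>2)"

text \<open>\<open>\<Delta>\<close> stands for the gap between \<open>f x0 + \<mu>bar * max (B x0) 0\<close> and the lower bound \<open>\<phi>low\<close>.\<close>

definition K2 :: "real \<Rightarrow> real \<Rightarrow> real \<Rightarrow> real \<Rightarrow> real \<Rightarrow> real \<Rightarrow> nat" where
  "K2 \<epsilon> \<beta> \<theta> \<eta> L \<Delta> = nat \<lceil>64 * \<Delta> / c_nc \<beta> \<theta> \<eta> L * \<epsilon> powr (-3/2)\<rceil> + 1"

definition K1 :: "real \<Rightarrow> real \<Rightarrow> real \<Rightarrow> real \<Rightarrow> real \<Rightarrow> real \<Rightarrow> real \<Rightarrow> real \<Rightarrow> nat" where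
  "K1 \<nu> \<epsilon> \<zeta> \<beta> \<theta> \<eta> L \<Delta> =
     nat \<lceil>\<Delta> / min (c_sol \<nu> \<zeta> \<beta> \<theta> \<eta> L) (c_nc \<beta> \<theta> \<eta> L) * \<epsilon> powr (-3/2)\<rceil>
     + nat \<lceil>64 * \<Delta> / c_nc \<beta> \<theta> \<eta> L * \<epsilon> powr (-3/2)\<rceil> + 1"

text \<open>The hidden factor of the soft-O bound: a constant depending on \<open>U\<^sub>H\<close> and \<open>\<zeta>\<close> only, times a
  logarithmic factor in \<open>1/\<epsilon>\<close>. The constant is written out because the dimensions are types: an
  existentially quantified one could depend on \<open>n\<close> and \<open>m\<close>, and would make the minima with \<open>n\<close>
  meaningless. The numeral is not optimized; the square root stems from the square root of the
  condition number in the capped CG iteration bound, the logarithms from its logarithm and from the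
  accuracy \<open>\<zeta>\<close>.\<close>

definition soft_const :: "real \<Rightarrow> real \<Rightarrow> real" where
  "soft_const U \<zeta> = 500 * sqrt (1 + U) * (1 + ln (1 + U) + ln (1 / \<zeta>))"

definition soft_O :: "real \<Rightarrow> real \<Rightarrow> real \<Rightarrow> real \<Rightarrow> real" where
  "soft_O U \<zeta> \<epsilon> X = soft_const U \<zeta> * (1 + ln (1 / \<epsilon>)) * X"

end

theory Submission
  imports Defs
begin

text \<open>
The cost of a run is the number of its iterations times the products with the reduced Hessian that
each of them spends, and the two factors are bounded separately.

Iterations are charged to decreases of \<open>\<phi> = f + \<mu> B\<close>, which add up to at most the gap \<open>\<Delta>\<close>. In the local
norm, \<open>\<phi>\<close> lies below a cubic model with constant \<open>L\<^sub>H + 1 / (2 (1 - \<beta>))\<close> on the ball of radius \<open>\<beta>\<close>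
(\<open>\<phi>_upper_bound\<close>). A direction of negative curvature therefore decreases \<open>\<phi>\<close> by a multiple of
\<open>\<epsilon> powr (3/2)\<close> (\<open>NC_step\<close>). The barrier term reduces the curvature found by the eigenvalue oracle to
\<open>- sqrt \<epsilon> / 4\<close>, which costs a factor \<open>4 ^ 3 = 64\<close>. A Newton direction achieves a decrease of the same
order unless it is a short unit step (\<open>SOL_step\<close>). After a short unit step the new gradient of \<open>f\<close>
nearly agrees with its linearization, so the second stopping measure is small and the next iteration
calls the oracle (\<open>short_unit_step_stationary\<close>). Each short unit step is charged to that oracle call,
and the counts \<open>K1\<close> and \<open>K2\<close> follow (\<open>count_calls\<close>).

The cubic model and the passage between the dual norms at consecutive iterates rest on the barrier.
Self-concordance controls its third derivative on the diagonal; a symmetric trilinear form is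
controlled by its diagonal (\<open>symmetric_trilinear_bound\<close>), and this makes the Hessians at neighbouring
points comparable (\<open>hessian_comparison\<close>). Steps of local norm below one stay in the cone
(\<open>Dikin_ellipsoid\<close>), and pointedness of the cone makes the Hessian positive definite (\<open>hessian_pos\<close>).

For the inner iterations, the residuals of conjugate gradients are nonzero and orthogonal until the
method stops, so there are at most \<open>n\<close> of them (\<open>regular_steps_le_dim\<close>). The bound of order
\<open>sqrt \<kappa> * ln \<kappa>\<close> comes from the stopping rules alone: an index that is passed has a residual above the
required accuracy but within the prescribed geometric decay, which is impossible for large indices
(\<open>cg_iterations\<close>). Here \<open>\<kappa>\<close> is of order \<open>(1 + U\<^sub>H) / sqrt \<epsilon>\<close>, whence the power \<open>\<epsilon> powr (-1/4)\<close>.\<close>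

section \<open>Second and third derivatives\<close>

lemma DERIV_line_shift:
  fixes h :: "'a::real_vector \<Rightarrow> real"
  assumes "((\<lambda>s. h ((z + a *\<^sub>R u) + s *\<^sub>R u)) has_real_derivative D) (at 0)"
  shows "((\<lambda>t. h (z + t *\<^sub>R u)) has_real_derivative D) (at a)"
proof -
  have "(\<lambda>s. h (z + (s + a) *\<^sub>R u)) = (\<lambda>s. h ((z + a *\<^sub>R u) + s *\<^sub>R u))"
    by (simp add: scaleR_left_distrib add.commute add.left_commute)
  then show ?thesis
    using DERIV_shift[of "\<lambda>t. h (z + t *\<^sub>R u)" D 0 a] assms by simp
qed

text \<open>Both mixed derivatives are limits of the second difference of \<open>f\<close> over small squares, divided by
the area: the mean value theorem can be applied first along \<open>v\<close> or first along \<open>w\<close>.\<close>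

lemma symmetric_mixed_derivatives:
  fixes f fv fw fvw fwv :: "'a::real_normed_vector \<Rightarrow> real"
  assumes "open S" "x \<in> S"
    and fv: "\<And>y. y \<in> S \<Longrightarrow> ((\<lambda>t. f (y + t *\<^sub>R v)) has_real_derivative fv y) (at 0)"
    and fw: "\<And>y. y \<in> S \<Longrightarrow> ((\<lambda>t. f (y + t *\<^sub>R w)) has_real_derivative fw y) (at 0)"
    and fvw: "\<And>y. y \<in> S \<Longrightarrow> ((\<lambda>t. fv (y + t *\<^sub>R w)) has_real_derivative fvw y) (at 0)"
    and fwv: "\<And>y. y \<in> S \<Longrightarrow> ((\<lambda>t. fw (y + t *\<^sub>R v)) has_real_derivative fwv y) (at 0)"
    and cvw: "continuous_on S fvw" and cwv: "continuous_on S fwv"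
  shows "fvw x = fwv x"
proof -
  define c where "c = norm v + norm w + 1"
  have c: "c > 0" by (auto simp: c_def intro: add_nonneg_pos)
  define sq where "sq s = {x + a *\<^sub>R v + b *\<^sub>R w |a b. 0 \<le> a \<and> a \<le> s \<and> 0 \<le> b \<and> b \<le> s}" for s :: real
  have sq_ball: "dist y x \<le> s * c" if "y \<in> sq s" "0 \<le> s" for y s
  proof -
    obtain a b where y: "y = x + a *\<^sub>R v + b *\<^sub>R w" "0 \<le> a" "a \<le> s" "0 \<le> b" "b \<le> s"
      using \<open>y \<in> sq s\<close> by (auto simp: sq_def)
    have "dist y x = norm (a *\<^sub>R v + b *\<^sub>R w)" by (simp add: y dist_norm add.assoc)
    also have "\<dots> \<le> a * norm v + b * norm w" using y norm_triangle_ineq[of "a *\<^sub>R v" "b *\<^sub>R w"] by simp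
    also have "\<dots> \<le> s * norm v + s * norm w" by (intro add_mono mult_right_mono) (use y in auto)
    also have "\<dots> \<le> s * c" using \<open>0 \<le> s\<close> by (simp add: c_def algebra_simps)
    finally show ?thesis .
  qed
  have line: "((\<lambda>t. h (z + t *\<^sub>R u)) has_real_derivative h' (z + a *\<^sub>R u)) (at a)"
    if "\<And>y. y \<in> S \<Longrightarrow> ((\<lambda>t. h (y + t *\<^sub>R u)) has_real_derivative h' y) (at 0)" "z + a *\<^sub>R u \<in> S"
    for h h' :: "'a \<Rightarrow> real" and z u a
  proof -
    show ?thesis by (rule DERIV_line_shift[OF that(1)[OF that(2)]])
  qed
  \<comment> \<open>The second difference over a square of side \<open>s\<close> is \<open>s\<^sup>2\<close> times a mixed derivative at a point of
    the square, whichever of the two directions is treated first.\<close>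
  have key: "\<exists>y \<in> sq s. f (x + s *\<^sub>R v + s *\<^sub>R w) - f (x + s *\<^sub>R v) - f (x + s *\<^sub>R w) + f x = s * s * h12 y"
    if s: "0 < s" "sq s \<subseteq> S" and vw: "{p, q} = {v, w}"
      and h1: "\<And>y. y \<in> S \<Longrightarrow> ((\<lambda>t. f (y + t *\<^sub>R p)) has_real_derivative h1 y) (at 0)"
      and h12: "\<And>y. y \<in> S \<Longrightarrow> ((\<lambda>t. h1 (y + t *\<^sub>R q)) has_real_derivative h12 y) (at 0)"
    for s p q h1 h12
  proof -
    have inS: "x + a *\<^sub>R p + b *\<^sub>R q \<in> sq s" if "0 \<le> a" "a \<le> s" "0 \<le> b" "b \<le> s" for a b
    proof -
      have "p = v \<and> q = w \<or> p = w \<and> q = v" using vw by (auto simp: doubleton_eq_iff)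
      then show ?thesis
      proof
        assume "p = w \<and> q = v"
        then have "x + a *\<^sub>R p + b *\<^sub>R q = x + b *\<^sub>R v + a *\<^sub>R w" by simp
        then show ?thesis using that unfolding sq_def by blast
      qed (use that in \<open>auto simp: sq_def\<close>)
    qed
    let ?g = "\<lambda>t. f (x + s *\<^sub>R q + t *\<^sub>R p) - f (x + t *\<^sub>R p)"
    have "(?g has_real_derivative h1 (x + s *\<^sub>R q + a *\<^sub>R p) - h1 (x + a *\<^sub>R p)) (at a)"
      if "0 \<le> a" "a \<le> s" for a
      by (rule DERIV_diff; rule line[OF h1])
        (use that s inS[of a s] inS[of a 0] in \<open>auto simp: algebra_simps\<close>)
    then obtain a where a: "0 < a" "a < s"
        "?g s - ?g 0 = (s - 0) * (h1 (x + s *\<^sub>R q + a *\<^sub>R p) - h1 (x + a *\<^sub>R p))"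
      using MVT2[of 0 s ?g "\<lambda>a. h1 (x + s *\<^sub>R q + a *\<^sub>R p) - h1 (x + a *\<^sub>R p)"] s by auto
    have "((\<lambda>t. h1 (x + a *\<^sub>R p + t *\<^sub>R q)) has_real_derivative h12 (x + a *\<^sub>R p + b *\<^sub>R q)) (at b)"
      if "0 \<le> b" "b \<le> s" for b
      by (rule line[OF h12]) (use that s a inS[of a b] in auto)
    then obtain b where b: "0 < b" "b < s"
        "h1 (x + a *\<^sub>R p + s *\<^sub>R q) - h1 (x + a *\<^sub>R p) = s * h12 (x + a *\<^sub>R p + b *\<^sub>R q)"
      using MVT2[of 0 s "\<lambda>t. h1 (x + a *\<^sub>R p + t *\<^sub>R q)" "\<lambda>b. h12 (x + a *\<^sub>R p + b *\<^sub>R q)"] s by auto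
    have "?g s - ?g 0 = s * s * h12 (x + a *\<^sub>R p + b *\<^sub>R q)"
      using a(3) b(3) by (simp add: algebra_simps)
    moreover have "?g s - ?g 0 = f (x + s *\<^sub>R v + s *\<^sub>R w) - f (x + s *\<^sub>R v) - f (x + s *\<^sub>R w) + f x"
      using vw by (auto simp: doubleton_eq_iff algebra_simps)
    ultimately have "f (x + s *\<^sub>R v + s *\<^sub>R w) - f (x + s *\<^sub>R v) - f (x + s *\<^sub>R w) + f x
        = s * s * h12 (x + a *\<^sub>R p + b *\<^sub>R q)" by linarith
    then show ?thesis using inS[of a b] a b by (intro bexI) auto
  qed
  have "\<bar>fvw x - fwv x\<bar> \<le> e" if "e > 0" for e
  proof -
    have "\<forall>\<^sub>F y in at x. dist (fvw y) (fvw x) < e/2 \<and> dist (fwv y) (fwv x) < e/2 \<and> y \<in> S"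
      using cvw cwv \<open>open S\<close> \<open>x \<in> S\<close> that
      by (intro eventually_conj tendstoD topological_tendstoD[OF tendsto_ident_at])
        (auto simp: continuous_on_eq_continuous_at isCont_def)
    then obtain r where r: "r > 0" "\<And>y. y \<noteq> x \<Longrightarrow> dist y x < r \<Longrightarrow>
        dist (fvw y) (fvw x) < e/2 \<and> dist (fwv y) (fwv x) < e/2 \<and> y \<in> S"
      by (auto simp: eventually_at)
    define s where "s = r / (2 * c)"
    have s: "s > 0" "s * c < r" using r c by (auto simp: s_def)
    have near: "dist (fvw y) (fvw x) < e/2 \<and> dist (fwv y) (fwv x) < e/2 \<and> y \<in> S" if "y \<in> sq s" for y
    proof (cases "y = x")
      case False
      then show ?thesis using r(2) sq_ball[OF that] s by force
    qed (use \<open>e > 0\<close> \<open>x \<in> S\<close> in auto)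
    have sub: "sq s \<subseteq> S" using near by blast
    obtain y where y: "y \<in> sq s"
        "f (x + s *\<^sub>R v + s *\<^sub>R w) - f (x + s *\<^sub>R v) - f (x + s *\<^sub>R w) + f x = s * s * fvw y"
      using key[OF s(1) sub, of v w fv fvw] fv fvw by auto
    obtain z where z: "z \<in> sq s"
        "f (x + s *\<^sub>R v + s *\<^sub>R w) - f (x + s *\<^sub>R v) - f (x + s *\<^sub>R w) + f x = s * s * fwv z"
      using key[OF s(1) sub, of w v fw fwv] fw fwv by auto
    have "fvw y = fwv z" using y z s by simp
    then show ?thesis using near[OF y(1)] near[OF z(1)] unfolding dist_real_def by linarith
  qed
  then show ?thesis using field_le_epsilon[of "\<bar>fvw x - fwv x\<bar>" 0] by auto
qed

lemma Ck_on_Suc_imp: "Ck_on (Suc k) f S \<Longrightarrow> Ck_on k f S"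
proof (induction k arbitrary: f)
  case 0
  then show ?case
    by (auto simp: continuous_at_imp_continuous_on differentiable_imp_continuous_within)
next
  case (Suc k)
  then show ?case unfolding Ck_on.simps(2)[of "Suc k"] Ck_on.simps(2)[of k] by blast
qed

lemma Ck_on_2D:
  assumes "Ck_on 2 f S"
  shows "x \<in> S \<Longrightarrow> f differentiable at x"
    and "x \<in> S \<Longrightarrow> (\<lambda>y. frechet_derivative f (at y) v) differentiable at x"
    and "continuous_on S (\<lambda>x. frechet_derivative (\<lambda>y. frechet_derivative f (at y) v) (at x) w)"
  using assms unfolding numeral_2_eq_2 Ck_on.simps by meson+

lemma differentiable_along_line:
  fixes f :: "'a::real_normed_vector \<Rightarrow> real"
  assumes "f differentiable at y"
  shows "((\<lambda>t. f (y + t *\<^sub>R v)) has_real_derivative frechet_derivative f (at y) v) (at 0)"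
proof -
  have "(f has_derivative frechet_derivative f (at y)) (at (y + 0 *\<^sub>R v))"
    using assms by (simp add: frechet_derivative_works[symmetric])
  moreover have "((\<lambda>t. y + t *\<^sub>R v) has_derivative (\<lambda>t. t *\<^sub>R v)) (at 0)"
    by (auto intro!: derivative_eq_intros)
  ultimately have "((\<lambda>t. f (y + t *\<^sub>R v)) has_derivative (\<lambda>t. frechet_derivative f (at y) (t *\<^sub>R v))) (at 0)"
    using has_derivative_compose[where f="\<lambda>t. y + t *\<^sub>R v" and x=0 and s=UNIV and g=f] by blast
  moreover have "frechet_derivative f (at y) (t *\<^sub>R v) = t * frechet_derivative f (at y) v" for t
    using linear_scale[OF linear_frechet_derivative[OF assms]] by simp
  ultimately show ?thesis
    by (simp add: has_field_derivative_def mult_commute_abs)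
qed

lemma frechet_derivative_eq_on_open:
  fixes f g :: "'a::real_normed_vector \<Rightarrow> 'b::real_normed_vector"
  assumes "open S" "x \<in> S" "\<And>y. y \<in> S \<Longrightarrow> f y = g y" "f differentiable at x"
  shows "frechet_derivative f (at x) = frechet_derivative g (at x)" "g differentiable at x"
proof -
  have "(g has_derivative frechet_derivative f (at x)) (at x)"
    by (rule has_derivative_transform_within_open[OF _ assms(1,2,3)])
      (use assms(4) in \<open>simp_all add: frechet_derivative_works[symmetric]\<close>)
  then show "frechet_derivative f (at x) = frechet_derivative g (at x)" "g differentiable at x"
    using frechet_derivative_at differentiableI by auto
qed

lemma frechet_derivative_commute:
  fixes f :: "'a::real_normed_vector \<Rightarrow> real"
  assumes "open S" "x \<in> S" "Ck_on 2 f S"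
  shows "frechet_derivative (\<lambda>y. frechet_derivative f (at y) v) (at x) w
       = frechet_derivative (\<lambda>y. frechet_derivative f (at y) w) (at x) v"
proof (rule symmetric_mixed_derivatives[OF assms(1,2), where f=f and v=v and w=w
      and fv="\<lambda>y. frechet_derivative f (at y) v" and fw="\<lambda>y. frechet_derivative f (at y) w"])
  fix y assume y: "y \<in> S"
  note d = Ck_on_2D[OF assms(3)]
  show "((\<lambda>t. f (y + t *\<^sub>R v)) has_real_derivative frechet_derivative f (at y) v) (at 0)"
    "((\<lambda>t. f (y + t *\<^sub>R w)) has_real_derivative frechet_derivative f (at y) w) (at 0)"
    by (rule differentiable_along_line[OF d(1)[OF y]])+
  show "((\<lambda>t. frechet_derivative f (at (y + t *\<^sub>R w)) v) has_real_derivative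
      frechet_derivative (\<lambda>y. frechet_derivative f (at y) v) (at y) w) (at 0)"
    by (rule differentiable_along_line[OF d(2)[OF y]])
  show "((\<lambda>t. frechet_derivative f (at (y + t *\<^sub>R v)) w) has_real_derivative
      frechet_derivative (\<lambda>y. frechet_derivative f (at y) w) (at y) v) (at 0)"
    by (rule differentiable_along_line[OF d(2)[OF y]])
qed (rule Ck_on_2D(3)[OF assms(3)])+

lemma GDERIV_unique:
  fixes f :: "real^'n \<Rightarrow> real"
  assumes "GDERIV f x :> D" "GDERIV f x :> E"
  shows "D = E"
proof -
  have "(\<lambda>h. h \<bullet> D) = (\<lambda>h. h \<bullet> E)"
    using assms unfolding gderiv_def by (rule has_derivative_unique)
  then have "(D - E) \<bullet> D = (D - E) \<bullet> E" by metis
  then have "(D - E) \<bullet> (D - E) = 0" by (simp add: inner_diff_right)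
  then show ?thesis by simp
qed

lemma GDERIV_grad:
  fixes f :: "real^'n \<Rightarrow> real"
  assumes "f differentiable at x"
  shows "GDERIV f x :> grad f x" "frechet_derivative f (at x) v = grad f x \<bullet> v"
proof -
  let ?L = "frechet_derivative f (at x)"
  have d: "(f has_derivative ?L) (at x)" using assms by (simp add: frechet_derivative_works[symmetric])
  define D where "D = adjoint ?L 1"
  have L: "?L = (\<lambda>h. h \<bullet> D)"
    using adjoint_works[OF linear_frechet_derivative[OF assms], of _ "1::real"] by (auto simp: D_def)
  have D: "GDERIV f x :> D" using d L by (simp add: gderiv_def)
  then have "grad f x = D" unfolding grad_def by (blast intro: GDERIV_unique)
  then show "GDERIV f x :> grad f x" "?L v = grad f x \<bullet> v" using D L by (auto simp: inner_commute)
qed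

lemma has_derivative_grad:
  fixes f :: "real^'n \<Rightarrow> real"
  assumes "open S" "Ck_on 2 f S" "x \<in> S"
  shows "(grad f has_derivative (\<lambda>h. hessian f x *v h)) (at x)"
proof -
  have df: "f differentiable at y" if "y \<in> S" for y
    using assms that by (blast intro: Ck_on_2D(1))
  have "(\<lambda>y. grad f y \<bullet> e) differentiable at x" for e
    by (rule frechet_derivative_eq_on_open(2)[OF assms(1,3), of "\<lambda>y. frechet_derivative f (at y) e"])
      (use GDERIV_grad(2)[OF df] Ck_on_2D(2)[OF assms(2,3)] in auto)
  then have "grad f differentiable at x"
    using differentiable_componentwise_within[of "grad f" x UNIV] by auto
  then show ?thesis unfolding hessian_def using jacobian_works by blast
qed

lemma hessian_eq_second_derivative:
  fixes f :: "real^'n \<Rightarrow> real"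
  assumes "open S" "Ck_on 2 f S" "x \<in> S"
  shows "v \<bullet> (hessian f x *v w) = frechet_derivative (\<lambda>y. frechet_derivative f (at y) v) (at x) w"
proof -
  have df: "f differentiable at y" if "y \<in> S" for y
    using assms that by (blast intro: Ck_on_2D(1))
  have "((\<lambda>y. v \<bullet> grad f y) has_derivative (\<lambda>h. v \<bullet> (hessian f x *v h))) (at x)"
    using has_derivative_grad[OF assms] by (rule has_derivative_inner_right)
  then have "((\<lambda>y. frechet_derivative f (at y) v) has_derivative (\<lambda>h. v \<bullet> (hessian f x *v h))) (at x)"
    by (rule has_derivative_transform_within_open[OF _ assms(1,3)])
      (use GDERIV_grad(2)[OF df] in \<open>auto simp: inner_commute\<close>)
  from fun_cong[OF frechet_derivative_at[OF this], of w] show ?thesis .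
qed

lemma hessian_symmetric:
  fixes f :: "real^'n \<Rightarrow> real"
  assumes "open S" "Ck_on 2 f S" "x \<in> S"
  shows "v \<bullet> (hessian f x *v w) = w \<bullet> (hessian f x *v v)"
  unfolding hessian_eq_second_derivative[OF assms] by (rule frechet_derivative_commute[OF assms(1,3,2)])

text \<open>The direction of differentiation comes first; the other two arguments are those of the Hessian form,
which is how the third derivative enters the comparison of Hessians along a segment.\<close>

definition third_derivative :: "(real^'n \<Rightarrow> real) \<Rightarrow> real^'n \<Rightarrow> real^'n \<Rightarrow> real^'n \<Rightarrow> real^'n \<Rightarrow> real" where
  "third_derivative f x u v w = frechet_derivative (\<lambda>y. v \<bullet> (hessian f y *v w)) (at x) u"

lemma Ck3D:
  assumes "Ck_on 3 f S"
  shows "Ck_on 2 f S" "\<And>v. Ck_on 2 (\<lambda>x. frechet_derivative f (at x) v) S"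
    "\<And>v w x. x \<in> S \<Longrightarrow> (\<lambda>x. frechet_derivative (\<lambda>x. frechet_derivative f (at x) v) (at x) w) differentiable at x"
proof -
  have 3: "Ck_on (Suc 2) f S" using assms by (simp only: numeral_3_eq_3 numeral_2_eq_2)
  show "Ck_on 2 f S" by (rule Ck_on_Suc_imp[OF 3])
  show *: "Ck_on 2 (\<lambda>x. frechet_derivative f (at x) v) S" for v using 3 unfolding Ck_on.simps by blast
  show "(\<lambda>x. frechet_derivative (\<lambda>x. frechet_derivative f (at x) v) (at x) w) differentiable at x"
    if "x \<in> S" for v w x
    by (rule Ck_on_2D(2)[OF * that])
qed

lemma hessian_form_differentiable:
  fixes f :: "real^'n \<Rightarrow> real"
  assumes "open S" "Ck_on 3 f S" "x \<in> S"
  shows "(\<lambda>y. v \<bullet> (hessian f y *v w)) differentiable at x"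
  by (rule frechet_derivative_eq_on_open(2)[OF assms(1,3) _ Ck3D(3)[OF assms(2,3)]])
    (rule hessian_eq_second_derivative[OF assms(1) Ck3D(1)[OF assms(2)], symmetric])

lemma third_derivative_eq:
  fixes f :: "real^'n \<Rightarrow> real"
  assumes "open S" "Ck_on 3 f S" "x \<in> S"
  shows "third_derivative f x u v w =
    frechet_derivative (\<lambda>x. frechet_derivative (\<lambda>x. frechet_derivative f (at x) v) (at x) w) (at x) u"
  unfolding third_derivative_def
  by (rule fun_cong[OF frechet_derivative_eq_on_open(1)[OF assms(1,3) _ hessian_form_differentiable[OF assms]]])
    (rule hessian_eq_second_derivative[OF assms(1) Ck3D(1)[OF assms(2)]])

lemma third_derivative_along_line:
  fixes f :: "real^'n \<Rightarrow> real"
  assumes "open S" "Ck_on 3 f S" "x + t *\<^sub>R u \<in> S"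
  shows "((\<lambda>t. v \<bullet> (hessian f (x + t *\<^sub>R u) *v w)) has_real_derivative
           third_derivative f (x + t *\<^sub>R u) u v w) (at t)"
  unfolding third_derivative_def
  by (rule DERIV_line_shift[OF differentiable_along_line[OF hessian_form_differentiable[OF assms]]])

lemma third_derivative_symmetric:
  fixes f :: "real^'n \<Rightarrow> real"
  assumes "open S" "Ck_on 3 f S" "x \<in> S"
  shows "third_derivative f x u v w = third_derivative f x u w v"
    and "third_derivative f x u v w = third_derivative f x w v u"
proof -
  show "third_derivative f x u v w = third_derivative f x u w v"
    unfolding third_derivative_def
    by (rule fun_cong[OF frechet_derivative_eq_on_open(1)[OF assms(1,3) _ hessian_form_differentiable[OF assms]]])
      (rule hessian_symmetric[OF assms(1) Ck3D(1)[OF assms(2)]])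
  show "third_derivative f x u v w = third_derivative f x w v u"
    unfolding third_derivative_eq[OF assms]
    by (rule frechet_derivative_commute[OF assms(1,3) Ck3D(2)[OF assms(2)]])
qed

lemma third_derivative_linear:
  fixes f :: "real^'n \<Rightarrow> real"
  assumes "open S" "Ck_on 3 f S" "x \<in> S"
  shows "linear (\<lambda>u. third_derivative f x u v w)"
  unfolding third_derivative_def
  by (rule linear_frechet_derivative[OF hessian_form_differentiable[OF assms]])

section \<open>Symmetric trilinear forms are bounded by their diagonal\<close>

text \<open>Otherwise the form would become negative when moving away from \<open>v\<close> along \<open>w\<close>, because there the
linear term dominates.\<close>

lemma semidefinite_form_null_vector:
  fixes q :: "'a::real_vector \<Rightarrow> 'a \<Rightarrow> real"
  assumes "bilinear q" "\<And>v w. q v w = q w v" "\<And>v. 0 \<le> q v v" "q v v = 0"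
  shows "q v w = 0"
proof -
  \<comment> \<open>The minimizer \<open>- a / d\<close> of the quadratic, with the denominator made positive.\<close>
  define a d t where "a = q v w" and "d = q w w" and "t = - (a / (d + 1))"
  have d: "d \<ge> 0" using assms(3) by (simp add: d_def)
  have "q (v + t *\<^sub>R w) (v + t *\<^sub>R w) = 2 * t * a + t\<^sup>2 * d"
    using assms(2)[of w v] assms(4)
    by (simp add: bilinear_ladd[OF assms(1)] bilinear_radd[OF assms(1)] bilinear_lmul[OF assms(1)]
        bilinear_rmul[OF assms(1)] a_def d_def power2_eq_square algebra_simps)
  then have "0 \<le> 2 * t * a + t\<^sup>2 * d" using assms(3) by metis
  also have "\<dots> = - (a\<^sup>2 * (d + 2)) / (d + 1)\<^sup>2"
    using d by (simp add: t_def power2_eq_square divide_simps) (simp add: algebra_simps)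
  finally have "a\<^sup>2 * (d + 2) \<le> 0" using d by (simp add: divide_simps split: if_splits)
  moreover have "0 \<le> a\<^sup>2 * (d + 2)" using d by simp
  ultimately have "a\<^sup>2 * (d + 2) = 0" by (rule antisym)
  then show ?thesis using d by (simp add: a_def)
qed

lemma definite_form_lower_bound:
  fixes b :: "'a::euclidean_space \<Rightarrow> 'a \<Rightarrow> real"
  assumes "bilinear b" "\<And>v. v \<noteq> 0 \<Longrightarrow> 0 < b v v"
  obtains m where "m > 0" "\<And>v. m * (norm v)\<^sup>2 \<le> b v v"
proof -
  interpret b: bounded_bilinear b using assms(1) bilinear_conv_bounded_bilinear by blast
  have "continuous_on (sphere 0 1) (\<lambda>v. b v v)" by (rule b.continuous_on) (rule continuous_on_id)+
  moreover have "sphere (0::'a) 1 \<noteq> {}" by simp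
  ultimately obtain u where u: "u \<in> sphere 0 1" "\<And>v. v \<in> sphere 0 1 \<Longrightarrow> b u u \<le> b v v"
    using continuous_attains_inf[of "sphere (0::'a) 1" "\<lambda>v. b v v"] compact_sphere by blast
  show thesis
  proof
    show "b u u > 0" using u(1) by (intro assms(2)) auto
    fix v
    show "b u u * (norm v)\<^sup>2 \<le> b v v"
    proof (cases "v = 0")
      case False
      have "b u u \<le> b (v /\<^sub>R norm v) (v /\<^sub>R norm v)" using False by (intro u(2)) auto
      then show ?thesis using False
        by (simp add: b.scaleR_left b.scaleR_right field_simps power2_eq_square)
    qed (simp add: b.zero_left)
  qed
qed

text \<open>Among the pairs that maximize \<open>T u v v\<close> over the unit sphere of \<open>b\<close>, take one with the largest
\<open>b u v\<close>. The first-order conditions show that \<open>v\<close> together with the normalized sum of \<open>u\<close> and \<open>v\<close> is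
another maximizing pair, and it encloses half the angle. So the angle is zero, the maximum is attained
on the diagonal, and there it is at most \<open>C\<close>.\<close>

lemma symmetric_trilinear_bound_unit:
  fixes T :: "'a::euclidean_space \<Rightarrow> 'a \<Rightarrow> 'a \<Rightarrow> real" and b :: "'a \<Rightarrow> 'a \<Rightarrow> real"
  assumes lin: "\<And>v w. linear (\<lambda>u. T u v w)"
    and sym: "\<And>u v w. T u v w = T u w v" "\<And>u v w. T u v w = T w v u"
    and b: "bilinear b" "\<And>v w. b v w = b w v" "\<And>v. v \<noteq> 0 \<Longrightarrow> 0 < b v v"
    and diag: "\<And>u. b u u = 1 \<Longrightarrow> T u u u \<le> C"
    and "b u0 u0 = 1" "b v0 v0 = 1"
  shows "T u0 v0 v0 \<le> C"
proof (rule ccontr)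
  assume neg: "\<not> T u0 v0 v0 \<le> C"
  note bs = bilinear_ladd[OF b(1)] bilinear_radd[OF b(1)] bilinear_lmul[OF b(1)]
    bilinear_rmul[OF b(1)] bilinear_lneg[OF b(1)] bilinear_rneg[OF b(1)]
    bilinear_lsub[OF b(1)] bilinear_rsub[OF b(1)]
  have T1: "T (u + u') v w = T u v w + T u' v w" "T (c *\<^sub>R u) v w = c * T u v w" for u u' v w c
    using linear_add[OF lin] linear_scale[OF lin] by auto
  have T3: "T u v (w + w') = T u v w + T u v w'" "T u v (c *\<^sub>R w) = c * T u v w" for u v w w' c
    using T1 sym(2) by metis+
  have T2: "T u (v + v') w = T u v w + T u v' w" "T u (c *\<^sub>R v) w = c * T u v w" for u v v' w c
    using T3 sym(1) by metis+
  have Tm: "T (- u) v w = - T u v w" "T u (- v) w = - T u v w" "T u v (- w) = - T u v w" for u v w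
    using T1(2)[of "-1"] T2(2)[of _ "-1"] T3(2)[of _ _ "-1"] by auto
  have bilT: "bilinear (T u)" for u
    unfolding bilinear_def by (auto intro!: linearI simp: T2 T3)
  interpret bb: bounded_bilinear b using b(1) bilinear_conv_bounded_bilinear by blast
  have bTi: "bounded_bilinear (T u)" for u using bilT bilinear_conv_bounded_bilinear by blast
  have expand: "T u v w = (\<Sum>i\<in>Basis. (u \<bullet> i) * T i v w)" for u v w
  proof -
    have "T u v w = T (\<Sum>i\<in>Basis. (u \<bullet> i) *\<^sub>R i) v w" by (simp add: euclidean_representation)
    also have "\<dots> = (\<Sum>i\<in>Basis. T ((u \<bullet> i) *\<^sub>R i) v w)"
      by (rule linear_sum[OF lin, unfolded comp_def])
    finally show ?thesis by (simp add: T1)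
  qed
  have contT: "continuous_on A (\<lambda>p. T (fst p) (snd p) (snd p))" for A
    unfolding expand[of "fst _"]
    by (intro continuous_intros bounded_bilinear.continuous_on[OF bTi])
  have contb: "continuous_on A (\<lambda>p. b (fst p) (snd p))" for A
    by (intro continuous_intros bb.continuous_on)
  define E where "E = {u. b u u = 1}"
  obtain m where m: "m > 0" "\<And>v. m * (norm v)\<^sup>2 \<le> b v v"
    using definite_form_lower_bound[OF b(1,3)] by metis
  have "norm u \<le> 1 / sqrt m" if "u \<in> E" for u
  proof -
    have "(norm u)\<^sup>2 \<le> 1 / m" using m(1) m(2)[of u] that by (simp add: E_def field_simps)
    then show ?thesis by (metis real_le_rsqrt real_sqrt_divide real_sqrt_one)
  qed
  then have "bounded E" unfolding bounded_iff by blast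
  moreover have "closed E"
    unfolding E_def by (intro closed_Collect_eq continuous_intros bb.continuous_on)
  ultimately have E: "compact E" using compact_eq_bounded_closed by blast
  have uv0: "(u0, v0) \<in> E \<times> E" using assms by (simp add: E_def)
  obtain p where p: "p \<in> E \<times> E"
      "\<And>q. q \<in> E \<times> E \<Longrightarrow> T (fst q) (snd q) (snd q) \<le> T (fst p) (snd p) (snd p)"
    using continuous_attains_sup[OF compact_Times[OF E E] _ contT] uv0 by blast
  define M where "M = T (fst p) (snd p) (snd p)"
  have max: "T u v v \<le> M" if "u \<in> E" "v \<in> E" for u v using p(2)[of "(u, v)"] that by (simp add: M_def)
  have MC: "M > C" using max uv0 neg by fastforce
  have "- u0 \<in> E" using uv0 by (simp add: E_def bs)
  then have "- T u0 u0 u0 \<le> C" "T u0 u0 u0 \<le> C" using diag[of "-u0"] diag[of u0] uv0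
    by (auto simp: E_def Tm)
  then have M0: "M > 0" using MC by linarith
  define Z where "Z = {p \<in> E \<times> E. T (fst p) (snd p) (snd p) = M}"
  have "compact Z"
    unfolding Z_def by (intro closed_Collect_eq continuous_intros contT compact_Int_closed compact_Times E
        | subst Collect_conj_eq Collect_mem_eq)+
  moreover have "p \<in> Z" using p(1) by (simp add: Z_def M_def)
  ultimately obtain z where z: "z \<in> Z" "\<And>q. q \<in> Z \<Longrightarrow> b (fst q) (snd q) \<le> b (fst z) (snd z)"
    using continuous_attains_sup[OF _ _ contb, of Z] by blast
  obtain u v where uv: "u \<in> E" "v \<in> E" "T u v v = M"
    and best: "\<And>u' v'. u' \<in> E \<Longrightarrow> v' \<in> E \<Longrightarrow> T u' v' v' = M \<Longrightarrow> b u' v' \<le> b u v"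
  proof (rule that[of "fst z" "snd z"])
    show "fst z \<in> E" "snd z \<in> E" "T (fst z) (snd z) (snd z) = M" using z(1) by (auto simp: Z_def)
    show "b u' v' \<le> b (fst z) (snd z)" if "u' \<in> E" "v' \<in> E" "T u' v' v' = M" for u' v'
      using z(2)[of "(u', v')"] that by (simp add: Z_def)
  qed
  define c where "c = b u v"
  have buv: "b u u = 1" "b v v = 1" "b v u = c" using uv b(2) by (auto simp: E_def c_def)
  have "- v \<in> E" using uv by (simp add: E_def bs)
  then have "b u (- v) \<le> c" unfolding c_def by (intro best) (use uv in \<open>auto simp: Tm\<close>)
  then have c0: "c \<ge> 0" by (simp add: bs c_def)
  have bnn: "0 \<le> b w w" for w using b(3)[of w] by (cases "w = 0") (auto simp: bb.zero_left)
  have norm1: "w /\<^sub>R sqrt (b w w) \<in> E" if "w \<noteq> 0" for w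
    using b(3)[OF that] by (simp add: E_def bs field_simps)
  \<comment> \<open>First-order conditions at the maximizer, in each of the two arguments.\<close>
  have opt1: "T u v w = M * b v w" for w
  proof -
    have "0 \<le> M * b w w - T u w w" for w
    proof (cases "w = 0")
      case False
      have "T u (w /\<^sub>R sqrt (b w w)) (w /\<^sub>R sqrt (b w w)) \<le> M" by (rule max[OF uv(1) norm1[OF False]])
      then show ?thesis using b(3)[OF False] by (simp add: T2 T3 field_simps)
    next
      case True
      then show ?thesis using T2(2)[of u 0 w] by (simp add: bb.zero_left)
    qed
    moreover have "bilinear (\<lambda>v w. M * b v w - T u v w)"
      unfolding bilinear_def by (auto intro!: linearI simp: T2 T3 bs algebra_simps)
    ultimately have "M * b v w - T u v w = 0"
      using semidefinite_form_null_vector[of "\<lambda>v w. M * b v w - T u v w" v w] uv buv sym(1) b(2) by simp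
    then show ?thesis by simp
  qed
  have opt2: "T w v v = M * b u w" for w
  proof -
    have "0 \<le> M * M * b w w - T w v v * T w v v" for w
    proof (cases "w = 0")
      case False
      let ?w = "w /\<^sub>R sqrt (b w w)"
      have "T ?w v v \<le> M" by (rule max[OF norm1[OF False] uv(2)])
      moreover have "- ?w \<in> E" using norm1[OF False] by (simp add: E_def bs)
      then have "T (- ?w) v v \<le> M" by (rule max[OF _ uv(2)])
      ultimately have "\<bar>T ?w v v\<bar> \<le> M" by (auto simp: Tm)
      then have "(T ?w v v)\<^sup>2 \<le> M\<^sup>2" by (rule abs_le_square_iff[THEN iffD1, OF order_trans]) simp
      then show ?thesis using b(3)[OF False]
        by (simp add: T1 field_simps power2_eq_square)
    next
      case True
      then show ?thesis using T1(2)[of 0 w] by (simp add: bb.zero_left)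
    qed
    moreover have "bilinear (\<lambda>w w'. M * M * b w w' - T w v v * T w' v v)"
      unfolding bilinear_def by (auto intro!: linearI simp: T1 bs algebra_simps)
    ultimately have "M * M * b u w - T u v v * T w v v = 0"
      using semidefinite_form_null_vector[of "\<lambda>w w'. M * M * b w w' - T w v v * T w' v v" u w]
        uv buv b(2) by (simp add: mult.commute)
    then show ?thesis using M0 uv(3) by (simp add: algebra_simps)
  qed
  \<comment> \<open>The normalized sum of the two maximizing vectors forms a maximizing pair with \<open>v\<close>.\<close>
  define w where "w = (u + v) /\<^sub>R sqrt (2 + 2 * c)"
  have "b (u + v) (u + v) = 2 + 2 * c" using buv by (simp add: bs c_def)
  moreover from this have "u + v \<noteq> 0" using c0 by (auto simp: bb.zero_left)
  ultimately have wE: "w \<in> E" using norm1[of "u + v"] by (simp add: w_def)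
  have "T v u u = M * c" using opt1[of u] sym(1)[of u v u] sym(2)[of u u v] buv by simp
  moreover have "T v v v = M * c" using opt2[of v] by (simp add: c_def)
  moreover have "T v u v = M" "T v v u = M" using uv(3) sym(1)[of v u v] sym(2)[of u v v] by auto
  ultimately have "T v (u + v) (u + v) = M * (2 + 2 * c)" by (simp add: T2 T3 algebra_simps)
  moreover have "T v w w = T v (u + v) (u + v) / (sqrt (2 + 2 * c) * sqrt (2 + 2 * c))"
    unfolding w_def T2(2) T3(2) by (simp only: divide_inverse inverse_mult_distrib mult_ac)
  ultimately have "T v w w = M" using c0 by simp
  then have "b v w \<le> c" unfolding c_def by (intro best uv wE)
  moreover have "b v w = (1 + c) / sqrt (2 + 2 * c)"
    using buv by (simp add: w_def bs divide_inverse algebra_simps)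
  ultimately have "1 + c \<le> c * sqrt (2 + 2 * c)" using c0 by (simp add: field_simps)
  then have "(1 + c)\<^sup>2 \<le> (c * sqrt (2 + 2 * c))\<^sup>2" using c0 by (intro power_mono) auto
  then have "(1 + c)\<^sup>2 \<le> c\<^sup>2 * (2 * (1 + c))" using c0 by (simp add: power_mult_distrib)
  then have "(1 + c) * (1 + c) \<le> (1 + c) * (2 * c\<^sup>2)" by (simp add: power2_eq_square algebra_simps)
  then have "1 + c \<le> 2 * c\<^sup>2" using c0 by (simp add: mult_le_cancel_left)
  then have "0 \<le> (2 * c + 1) * (c - 1)" by (simp add: power2_eq_square algebra_simps)
  then have "c \<ge> 1" using c0 by (simp add: zero_le_mult_iff)
  then have "b (u - v) (u - v) \<le> 0" using buv by (simp add: bs c_def)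
  then have "u = v" using b(3)[of "u - v"] by fastforce
  then show False using diag[of u] buv uv(3) MC by auto
qed

lemma symmetric_trilinear_bound:
  fixes T :: "'a::euclidean_space \<Rightarrow> 'a \<Rightarrow> 'a \<Rightarrow> real" and b :: "'a \<Rightarrow> 'a \<Rightarrow> real"
  assumes lin: "\<And>v w. linear (\<lambda>u. T u v w)"
    and sym: "\<And>u v w. T u v w = T u w v" "\<And>u v w. T u v w = T w v u"
    and b: "bilinear b" "\<And>v w. b v w = b w v" "\<And>v. v \<noteq> 0 \<Longrightarrow> 0 < b v v"
    and diag: "\<And>u. b u u = 1 \<Longrightarrow> T u u u \<le> C"
  shows "\<bar>T u v v\<bar> \<le> C * sqrt (b u u) * b v v"
proof -
  have T1: "T (c *\<^sub>R u) v w = c * T u v w" for u v w c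
    using linear_scale[OF lin] by auto
  have T2: "T u (c *\<^sub>R v) w = c * T u v w" "T u w (c *\<^sub>R v) = c * T u w v" for u v w c
    using T1 sym by metis+
  have nn: "0 \<le> b w w" for w
    using b(3)[of w] by (cases "w = 0") (auto simp: bilinear_lzero[OF b(1)])
  have le: "T u v v \<le> C * sqrt (b u u) * b v v" for u v
  proof (cases "u = 0 \<or> v = 0")
    case True
    then show ?thesis using T1[of 0 u v v] T2(1)[of u 0 v v] by (auto simp: bilinear_lzero[OF b(1)])
  next
    case False
    then have p: "b u u > 0" "b v v > 0" using b(3) by auto
    have "T (u /\<^sub>R sqrt (b u u)) (v /\<^sub>R sqrt (b v v)) (v /\<^sub>R sqrt (b v v)) \<le> C"
      by (rule symmetric_trilinear_bound_unit[OF lin sym b diag])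
        (use p in \<open>auto simp: bilinear_lmul[OF b(1)] bilinear_rmul[OF b(1)] field_simps\<close>)
    then show ?thesis using p by (simp add: T1 T2 field_simps)
  qed
  have "T (- u) v v = - T u v v" "b (- u) (- u) = b u u"
    using T1[of "-1" u v v] by (auto simp: bilinear_lneg[OF b(1)] bilinear_rneg[OF b(1)])
  then show ?thesis using le[of u v] le[of "-u" v] by auto
qed

section \<open>Self-concordant barriers\<close>

text \<open>The hypothesis says that \<open>h powr (-1/2)\<close> has derivative at least \<open>-1\<close>. As \<open>h\<close> may vanish, this is
applied to \<open>h + \<delta>\<close> in place of \<open>h\<close>, where \<open>\<delta>\<close> is chosen such that \<open>sqrt (h 0 + \<delta>)\<close> equals a given
number \<open>\<rho>\<close> above \<open>sqrt (h 0)\<close>; then \<open>\<rho>\<close> tends to \<open>sqrt (h 0)\<close>.\<close>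

lemma self_concordant_growth:
  fixes h h' :: "real \<Rightarrow> real"
  assumes "0 \<le> t"
    and der: "\<And>s. 0 \<le> s \<Longrightarrow> s \<le> t \<Longrightarrow> (h has_real_derivative h' s) (at s)"
    and nn: "\<And>s. 0 \<le> s \<Longrightarrow> s \<le> t \<Longrightarrow> 0 \<le> h s"
    and sc: "\<And>s. 0 \<le> s \<Longrightarrow> s \<le> t \<Longrightarrow> \<bar>h' s\<bar> \<le> 2 * h s powr (3/2)"
    and small: "sqrt (h 0) * t < 1"
  shows "sqrt (h t) \<le> sqrt (h 0) / (1 - sqrt (h 0) * t)"
proof -
  define r where "r = sqrt (h 0)"
  have r: "r \<ge> 0" "r\<^sup>2 = h 0" using nn[of 0] assms(1) by (auto simp: r_def)
  have *: "sqrt (h t) \<le> \<rho> / (1 - \<rho> * t)" if \<rho>: "r < \<rho>" "\<rho> * t < 1" for \<rho>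
  proof -
    define \<delta> where "\<delta> = \<rho>\<^sup>2 - r\<^sup>2"
    have "r\<^sup>2 < \<rho>\<^sup>2" using \<rho> r by (intro power_strict_mono) auto
    then have \<delta>: "\<delta> > 0" by (simp add: \<delta>_def)
    let ?k = "\<lambda>s. (h s + \<delta>) powr (-1/2) + s"
    have deriv_nonneg: "\<exists>y. (?k has_real_derivative y) (at s) \<and> 0 \<le> y" if s: "0 \<le> s" "s \<le> t" for s
    proof (intro exI conjI)
      have pos: "h s + \<delta> > 0" using nn[OF s] \<delta> by simp
      show "(?k has_real_derivative (-1/2) * (h s + \<delta>) powr (-3/2) * h' s + 1) (at s)"
        using pos by (auto intro!: derivative_eq_intros der s simp: powr_diff field_simps)
      have "\<bar>h' s\<bar> \<le> 2 * (h s + \<delta>) powr (3/2)"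
        using sc[OF s] powr_mono2[of "3/2" "h s" "h s + \<delta>"] nn[OF s] \<delta> by linarith
      then have "\<bar>h' s\<bar> * (h s + \<delta>) powr (-3/2) \<le> 2 * (h s + \<delta>) powr (3/2) * (h s + \<delta>) powr (-3/2)"
        by (intro mult_right_mono) auto
      also have "\<dots> = 2" using pos by (simp add: powr_add[symmetric])
      finally show "0 \<le> (-1/2) * (h s + \<delta>) powr (-3/2) * h' s + 1"
        using mult_right_mono[OF abs_ge_self[of "h' s"] powr_ge_zero[of "h s + \<delta>" "-3/2"]]
        by (simp add: mult.commute)
    qed
    have "?k 0 \<le> ?k t" by (rule DERIV_nonneg_imp_nondecreasing[OF assms(1) deriv_nonneg])
    moreover have half: "x powr (-1/2) = 1 / sqrt x" if "x > 0" for x :: real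
      using that powr_minus_divide[of x "1/2"] by (simp add: powr_half_sqrt)
    moreover have "h 0 + \<delta> = \<rho>\<^sup>2" using r by (simp add: \<delta>_def)
    moreover have "h t + \<delta> > 0" using nn[of t] assms(1) \<delta> by simp
    ultimately have "1 / \<rho> - t \<le> 1 / sqrt (h t + \<delta>)"
      using half[of "h t + \<delta>"] half[of "h 0 + \<delta>"] \<delta> \<rho> r by simp
    moreover have \<rho>0: "\<rho> > 0" using \<rho> r by linarith
    moreover have q: "0 < sqrt (h t + \<delta>)" using nn[of t] assms(1) \<delta> by simp
    ultimately have "sqrt (h t + \<delta>) * (1 - \<rho> * t) \<le> \<rho>" by (simp add: field_simps)
    then have "sqrt (h t + \<delta>) \<le> \<rho> / (1 - \<rho> * t)" using \<rho> by (simp add: pos_le_divide_eq)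
    moreover have "sqrt (h t) \<le> sqrt (h t + \<delta>)" using \<delta> by simp
    ultimately show ?thesis by linarith
  qed
  have lim: "((\<lambda>\<rho>. \<rho> / (1 - \<rho> * t)) \<longlongrightarrow> r / (1 - r * t)) (at_right r)"
    using small by (auto intro!: tendsto_intros simp: r_def)
  have "((\<lambda>\<rho>. \<rho> * t) \<longlongrightarrow> r * t) (at_right r)" by (intro tendsto_intros)
  then have "\<forall>\<^sub>F \<rho> in at_right r. \<rho> * t < 1" using small r_def order_tendstoD(2) by blast
  moreover have "\<forall>\<^sub>F \<rho> in at_right r. r < \<rho>" by (rule eventually_at_right_less)
  ultimately have "\<forall>\<^sub>F \<rho> in at_right r. sqrt (h t) \<le> \<rho> / (1 - \<rho> * t)"
    by eventually_elim (rule *)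
  then show ?thesis using tendsto_lowerbound[OF lim] unfolding r_def by simp
qed

lemma value_along_line:
  fixes f :: "real^'n \<Rightarrow> real"
  assumes "open S" "Ck_on 2 f S" "x + t *\<^sub>R u \<in> S"
  shows "((\<lambda>t. f (x + t *\<^sub>R u)) has_real_derivative grad f (x + t *\<^sub>R u) \<bullet> u) (at t)"
proof -
  have d: "f differentiable at (x + t *\<^sub>R u)" by (rule Ck_on_2D(1)[OF assms(2,3)])
  show ?thesis
    using DERIV_line_shift[OF differentiable_along_line[OF d]] unfolding GDERIV_grad(2)[OF d] .
qed

lemma slope_along_line:
  fixes f :: "real^'n \<Rightarrow> real"
  assumes "open S" "Ck_on 2 f S" "x + t *\<^sub>R u \<in> S"
  shows "((\<lambda>t. grad f (x + t *\<^sub>R u) \<bullet> v) has_real_derivative v \<bullet> (hessian f (x + t *\<^sub>R u) *v u)) (at t)"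
proof -
  let ?H = "hessian f (x + t *\<^sub>R u)"
  have line: "((\<lambda>t. x + t *\<^sub>R u) has_derivative (\<lambda>s. s *\<^sub>R u)) (at t)"
    by (auto intro!: derivative_eq_intros)
  have "((\<lambda>t. grad f (x + t *\<^sub>R u)) has_derivative (\<lambda>s. ?H *v (s *\<^sub>R u))) (at t)"
    by (rule has_derivative_compose[OF line has_derivative_grad[OF assms]])
  then have "((\<lambda>t. v \<bullet> grad f (x + t *\<^sub>R u)) has_derivative (\<lambda>s. v \<bullet> (?H *v (s *\<^sub>R u)))) (at t)"
    by (rule has_derivative_inner_right)
  then show ?thesis
    by (simp add: has_field_derivative_def matrix_vector_mult_scaleR inner_commute mult_commute_abs)
qed

lemma bilinear_matrix: "bilinear (\<lambda>v w. v \<bullet> (H *v w :: real^'n))"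
  unfolding bilinear_def
  by (auto intro!: linearI simp: inner_add_left inner_add_right matrix_vector_right_distrib
      matrix_vector_mult_scaleR)

locale barrier =
  fixes K :: "(real^'n) set" and B :: "real^'n \<Rightarrow> real" and \<nu> :: real
  assumes cone: "pointed_cone K" and lhsc: "lhsc_barrier K \<nu> B"
begin

abbreviation "S \<equiv> interior K"

lemma C3: "Ck_on 3 B S" and C2: "Ck_on 2 B S" and convex_B: "convex_on S B" and \<nu>_ge_1: "\<nu> \<ge> 1"
  using lhsc Ck3D(1)[of B S] unfolding lhsc_barrier_def self_concordant_on_def by blast+

lemmas hessian_B_symmetric = hessian_symmetric[OF open_interior C2]

lemma higher_derivatives_along_line:
  assumes "x \<in> S"
  shows "(deriv ^^ 2) (\<lambda>t. B (x + t *\<^sub>R u)) 0 = u \<bullet> (hessian B x *v u)"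
    and "(deriv ^^ 3) (\<lambda>t. B (x + t *\<^sub>R u)) 0 = third_derivative B x u u u"
proof -
  let ?\<phi> = "\<lambda>t. B (x + t *\<^sub>R u)" and ?O = "{t. x + t *\<^sub>R u \<in> S}"
  have op: "open ?O"
    using open_vimage[OF open_interior[of K], of "\<lambda>t. x + t *\<^sub>R u"] by (simp add: vimage_def continuous_intros)
  have 1: "deriv ?\<phi> t = grad B (x + t *\<^sub>R u) \<bullet> u" if "t \<in> ?O" for t
    by (rule DERIV_imp_deriv[OF value_along_line[OF open_interior C2]]) (use that in simp)
  have d2: "(deriv ?\<phi> has_real_derivative u \<bullet> (hessian B (x + t *\<^sub>R u) *v u)) (at t)" if "t \<in> ?O" for t
    by (rule DERIV_cong_ev[THEN iffD1, OF refl _ refl, OF _ slope_along_line[OF open_interior C2]])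
      (use that op 1 in \<open>auto simp: eventually_nhds intro!: exI[of _ ?O]\<close>)
  then have 2: "deriv (deriv ?\<phi>) t = u \<bullet> (hessian B (x + t *\<^sub>R u) *v u)" if "t \<in> ?O" for t
    using that by (blast intro: DERIV_imp_deriv)
  have "(deriv (deriv ?\<phi>) has_real_derivative third_derivative B (x + t *\<^sub>R u) u u u) (at t)" if "t \<in> ?O" for t
    by (rule DERIV_cong_ev[THEN iffD1, OF refl _ refl, OF _ third_derivative_along_line[OF open_interior C3]])
      (use that op 2 in \<open>auto simp: eventually_nhds intro!: exI[of _ ?O]\<close>)
  then have 3: "deriv (deriv (deriv ?\<phi>)) t = third_derivative B (x + t *\<^sub>R u) u u u" if "t \<in> ?O" for t
    using that by (blast intro: DERIV_imp_deriv)
  show "(deriv ^^ 2) ?\<phi> 0 = u \<bullet> (hessian B x *v u)" using 2[of 0] assms by (simp add: numeral_2_eq_2)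
  show "(deriv ^^ 3) ?\<phi> 0 = third_derivative B x u u u" using 3[of 0] assms by (simp add: numeral_3_eq_3)
qed

lemma self_concordance:
  assumes "x \<in> S"
  shows "\<bar>third_derivative B x u u u\<bar> \<le> 2 * (u \<bullet> (hessian B x *v u)) powr (3/2)"
proof -
  have "\<forall>x\<in>S. \<forall>u. \<bar>(deriv ^^ 3) (\<lambda>t. B (x + t *\<^sub>R u)) 0\<bar>
      \<le> 2 * ((deriv ^^ 2) (\<lambda>t. B (x + t *\<^sub>R u)) 0) powr (3/2)"
    using lhsc unfolding lhsc_barrier_def self_concordant_on_def Let_def by blast
  from this[rule_format, OF assms, of u] show ?thesis unfolding higher_derivatives_along_line[OF assms] .
qed

text \<open>Along a line, convexity makes the slopes increase, and the Hessian form is a limit of quotients of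
slope differences.\<close>

lemma hessian_nonneg:
  assumes "x \<in> S"
  shows "0 \<le> u \<bullet> (hessian B x *v u)"
proof -
  let ?\<phi> = "\<lambda>t. B (x + t *\<^sub>R u)" and ?g = "\<lambda>t. grad B (x + t *\<^sub>R u) \<bullet> u"
  have "open {t. x + t *\<^sub>R u \<in> S}"
    using open_vimage[OF open_interior[of K], of "\<lambda>t. x + t *\<^sub>R u"] by (simp add: vimage_def continuous_intros)
  then obtain e where e: "e > 0" "\<And>t. \<bar>t\<bar> < e \<Longrightarrow> x + t *\<^sub>R u \<in> S"
  proof -
    assume "open {t. x + t *\<^sub>R u \<in> S}"
    then obtain e where "e > 0" "ball 0 e \<subseteq> {t. x + t *\<^sub>R u \<in> S}"
      using openE[of "{t. x + t *\<^sub>R u \<in> S}" 0] assms by auto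
    then show thesis by (intro that[of e]) (auto simp: subset_iff dist_real_def)
  qed
  let ?I = "{-e<..<e}"
  have "convex_on ?I ?\<phi>"
  proof (rule convex_onI)
    fix t a b :: real assume t: "0 < t" "t < 1" "a \<in> ?I" "b \<in> ?I"
    have "B ((1 - t) *\<^sub>R (x + a *\<^sub>R u) + t *\<^sub>R (x + b *\<^sub>R u))
        \<le> (1 - t) * B (x + a *\<^sub>R u) + t * B (x + b *\<^sub>R u)"
      by (rule convex_onD[OF convex_B]) (use t e(2) in auto)
    then show "?\<phi> ((1 - t) *\<^sub>R a + t *\<^sub>R b) \<le> (1 - t) * ?\<phi> a + t * ?\<phi> b"
      by (simp add: algebra_simps)
  qed simp
  then have tangent: "?\<phi> b - ?\<phi> a \<ge> ?g a * (b - a)" if "a \<in> ?I" "b \<in> ?I" for a b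
    using that e(2)[of a]
    by (intro convex_on_imp_above_tangent[of ?I])
      (auto intro!: DERIV_subset[OF value_along_line[OF open_interior C2]])
  have mono: "?g 0 \<le> ?g t" if "0 < t" "t < e" for t
  proof -
    have "?g 0 * t \<le> ?\<phi> t - ?\<phi> 0" using tangent[of 0 t] that by simp
    also have "\<dots> \<le> ?g t * t" using tangent[of t 0] that by simp
    finally have "?g 0 * t \<le> ?g t * t" .
    then show ?thesis using that by simp
  qed
  have "(?g has_real_derivative u \<bullet> (hessian B x *v u)) (at 0)"
    using slope_along_line[OF open_interior C2, of x 0 u u] assms by simp
  then have lim: "((\<lambda>t. (?g t - ?g 0) / t) \<longlongrightarrow> u \<bullet> (hessian B x *v u)) (at_right 0)"
    by (auto simp: has_field_derivative_iff intro: tendsto_within_subset)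
  have "\<forall>\<^sub>F t in at_right 0. 0 \<le> (?g t - ?g 0) / t"
    using eventually_at_right_less[of "0::real"] eventually_at_right_real[OF e(1)]
    by eventually_elim (use mono in auto)
  then show ?thesis using tendsto_lowerbound[OF lim] by simp
qed

lemma local_norm_sq: "x \<in> S \<Longrightarrow> (local_norm B x u)\<^sup>2 = u \<bullet> (hessian B x *v u)"
  and local_norm_nonneg: "x \<in> S \<Longrightarrow> 0 \<le> local_norm B x u"
  using hessian_nonneg by (auto simp: local_norm_def)

lemma local_norm_scaleR: "local_norm B x (c *\<^sub>R u) = \<bar>c\<bar> * local_norm B x u"
  by (simp add: local_norm_def matrix_vector_mult_scaleR real_sqrt_mult flip: mult.assoc)

lemma local_norm_growth:
  assumes "0 \<le> t" "\<And>s. 0 \<le> s \<Longrightarrow> s \<le> t \<Longrightarrow> x + s *\<^sub>R u \<in> S" "local_norm B x u * t < 1"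
  shows "local_norm B (x + t *\<^sub>R u) u \<le> local_norm B x u / (1 - local_norm B x u * t)"
proof -
  let ?h = "\<lambda>t. u \<bullet> (hessian B (x + t *\<^sub>R u) *v u)"
  have "sqrt (?h t) \<le> sqrt (?h 0) / (1 - sqrt (?h 0) * t)"
    by (rule self_concordant_growth[OF assms(1) third_derivative_along_line[OF open_interior C3]])
      (use assms in \<open>simp_all add: hessian_nonneg self_concordance local_norm_def\<close>)
  then show ?thesis by (simp add: local_norm_def)
qed

text \<open>If the segment left the interior of the cone, the barrier would tend to infinity at the first exit
time; but until then the local norm of \<open>u\<close> cannot exceed \<open>r / (1 - r)\<close>, where \<open>r < 1\<close> is its initial
value.\<close>

lemma Dikin_ellipsoid:
  assumes x: "x \<in> S" and r: "local_norm B x u < 1"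
  shows "x + u \<in> S"
proof (rule ccontr)
  assume out: "x + u \<notin> S"
  define r where "r = local_norm B x u"
  have r01: "0 \<le> r" "r < 1" using local_norm_nonneg[OF x] assms(2) by (auto simp: r_def)
  let ?p = "\<lambda>t. x + t *\<^sub>R u"
  have "closed ({0..1} \<inter> ?p -` (- S))"
    by (intro continuous_closed_preimage continuous_intros closed_atLeastAtMost) auto
  then have "compact ({0..1} \<inter> ?p -` (- S))"
    by (metis bounded_Int bounded_closed_interval compact_eq_bounded_closed)
  moreover have "1 \<in> {0..1} \<inter> ?p -` (- S)" using out by simp
  ultimately obtain T where T: "T \<in> {0..1} \<inter> ?p -` (- S)"
      "\<And>t. t \<in> {0..1} \<inter> ?p -` (- S) \<Longrightarrow> T \<le> t"
    using compact_attains_inf by (metis empty_iff)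
  have T01: "0 < T" "T \<le> 1" using T(1) x by (auto simp: less_le)
  have inS: "?p t \<in> S" if "0 \<le> t" "t < T" for t using T(2)[of t] that T01 by force
  \<comment> \<open>Up to the exit time the second derivative along the ray stays bounded, hence so does the barrier.\<close>
  define C where "C = (r / (1 - r))\<^sup>2"
  let ?g = "\<lambda>t. grad B (?p t) \<bullet> u"
  have C: "u \<bullet> (hessian B (?p t) *v u) \<le> C" if "0 \<le> t" "t < T" for t
  proof -
    have rt: "r * t \<le> r" using r01 that T01 by (simp add: mult_left_le)
    have "local_norm B (?p t) u \<le> r / (1 - r * t)"
      unfolding r_def by (rule local_norm_growth) (use that inS r01 rt in \<open>auto simp: r_def\<close>)
    also have "\<dots> \<le> r / (1 - r)" using rt r01 by (intro divide_left_mono mult_pos_pos) auto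
    finally have "(local_norm B (?p t) u)\<^sup>2 \<le> C"
      unfolding C_def using local_norm_nonneg[OF inS[OF that]] by (intro power_mono)
    then show ?thesis using local_norm_sq[OF inS[OF that]] by simp
  qed
  have C0: "C \<ge> 0" by (simp add: C_def)
  have g: "?g t \<le> \<bar>?g 0\<bar> + C" if "0 \<le> t" "t < T" for t
  proof (cases "t = 0")
    case False
    then have "0 < t" using that by simp
    moreover have der: "(?g has_real_derivative u \<bullet> (hessian B (?p s) *v u)) (at s)" if "0 \<le> s" "s \<le> t" for s
      by (rule slope_along_line[OF open_interior C2 inS]) (use that \<open>t < T\<close> in auto)
    ultimately obtain z where z: "0 < z" "z < t" "?g t - ?g 0 = (t - 0) * (u \<bullet> (hessian B (?p z) *v u))"
      using MVT2[OF _ der] by blast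
    have "(t - 0) * (u \<bullet> (hessian B (?p z) *v u)) \<le> 1 * C"
      using z that T01 C[of z] hessian_nonneg[OF inS] by (intro mult_mono) auto
    then show ?thesis using z by linarith
  qed (use C0 in simp)
  have B: "B (?p t) \<le> B x + (\<bar>?g 0\<bar> + C)" if t: "0 < t" "t < T" for t
  proof -
    have der: "((\<lambda>t. B (?p t)) has_real_derivative ?g s) (at s)" if "0 \<le> s" "s \<le> t" for s
      by (rule value_along_line[OF open_interior C2 inS]) (use that \<open>t < T\<close> in auto)
    obtain z where z: "0 < z" "z < t" "B (?p t) - B (?p 0) = (t - 0) * ?g z"
      using MVT2[OF t(1) der] by blast
    have "(t - 0) * ?g z \<le> t * (\<bar>?g 0\<bar> + C)" unfolding diff_zero using g[of z] z t by (intro mult_left_mono) auto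
    also have "\<dots> \<le> 1 * (\<bar>?g 0\<bar> + C)" using t T01 C0 by (intro mult_right_mono) auto
    finally show ?thesis using z by simp
  qed
  have lim: "(?p \<longlongrightarrow> ?p T) (at_left T)" by (intro tendsto_intros)
  have ev: "\<forall>\<^sub>F t in at_left T. 0 < t \<and> t < T"
    by (rule eventually_mono[OF eventually_at_left_real[OF T01(1)]]) auto
  have evS: "\<forall>\<^sub>F t in at_left T. ?p t \<in> S \<and> ?p t \<noteq> ?p T"
    by (rule eventually_mono[OF ev]) (use inS T(1) in force)
  have "filterlim ?p (at (?p T) within S) (at_left T)"
    unfolding filterlim_at using lim evS by blast
  moreover have "?p T \<in> frontier K"
  proof -
    have "?p T \<in> closure S"
      by (rule Lim_in_closed_set[OF closed_closure _ _ lim], rule eventually_mono[OF evS])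
        (use closure_subset[of S] in auto)
    then show ?thesis using T(1) closure_mono[OF interior_subset[of K]] by (auto simp: frontier_def)
  qed
  ultimately have "filterlim (\<lambda>t. B (?p t)) at_top (at_left T)"
    using lhsc filterlim_compose[of B at_top "at (?p T) within S" ?p "at_left T"]
    unfolding lhsc_barrier_def by blast
  then have "\<forall>\<^sub>F t in at_left T. B x + (\<bar>?g 0\<bar> + C) < B (?p t)"
    unfolding filterlim_at_top_dense by blast
  then have "\<forall>\<^sub>F t in at_left T. False"
    using ev by eventually_elim (use B in force)
  then show False by simp
qed

lemma local_norm_ray:
  assumes x: "x \<in> S" and r: "local_norm B x u < 1" and t: "0 \<le> t" "t \<le> 1"
  shows "x + t *\<^sub>R u \<in> S"
proof (rule Dikin_ellipsoid[OF x])
  have "local_norm B x (t *\<^sub>R u) \<le> local_norm B x u"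
    using t local_norm_nonneg[OF x, of u] by (simp add: local_norm_scaleR mult_left_le_one_le)
  then show "local_norm B x (t *\<^sub>R u) < 1" using r by linarith
qed

text \<open>Scaling the ray by \<open>1 / t\<close> keeps it in the cone and moves its point at time \<open>t\<close> towards \<open>u\<close>.\<close>

lemma cone_absorbs_ray:
  assumes "x \<in> K" "\<And>t. t > 0 \<Longrightarrow> x + t *\<^sub>R u \<in> K"
  shows "u \<in> K"
proof -
  have K: "closed K" "cone K" using cone by (auto simp: pointed_cone_def)
  have "((\<lambda>t. (1 / t) *\<^sub>R x + u) \<longlongrightarrow> 0 *\<^sub>R x + u) at_top"
    by (intro tendsto_intros tendsto_divide_0[OF tendsto_const] filterlim_at_top_imp_at_infinity filterlim_ident)
  moreover have "\<forall>\<^sub>F t in at_top. (1 / t) *\<^sub>R x + u \<in> K"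
    using eventually_gt_at_top[of "0::real"]
  proof eventually_elim
    case (elim t)
    have "(1 / t) *\<^sub>R (x + t *\<^sub>R u) \<in> K" using mem_cone[OF K(2) assms(2)[OF elim]] elim by simp
    then show ?case using elim by (simp add: scaleR_add_right)
  qed
  ultimately show ?thesis using Lim_in_closed_set[OF K(1)] by fastforce
qed

text \<open>In a null direction of the Hessian all steps have local norm zero, so the whole line stays in the
cone, which pointedness forbids.\<close>

lemma hessian_pos:
  assumes x: "x \<in> S" and "u \<noteq> 0"
  shows "0 < u \<bullet> (hessian B x *v u)"
proof (rule ccontr)
  assume "\<not> 0 < u \<bullet> (hessian B x *v u)"
  then have "local_norm B x u = 0" using hessian_nonneg[OF x, of u] by (simp add: local_norm_def)
  then have "x + t *\<^sub>R u \<in> K" for t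
    using Dikin_ellipsoid[OF x, of "t *\<^sub>R u"] interior_subset by (auto simp: local_norm_scaleR)
  then have line: "x + t *\<^sub>R u \<in> K" "x + t *\<^sub>R (- u) \<in> K" for t
    by (auto simp: scaleR_minus_left[symmetric] simp del: scaleR_minus_left)
  have "x \<in> K" using x interior_subset by blast
  from cone_absorbs_ray[OF this line(1)] cone_absorbs_ray[OF this line(2)]
  have "u \<in> K" "- u \<in> K" .
  then show False using cone \<open>u \<noteq> 0\<close> by (auto simp: pointed_cone_def)
qed

lemma third_derivative_bound:
  assumes x: "x \<in> S"
  shows "\<bar>third_derivative B x u v v\<bar> \<le> 2 * local_norm B x u * (v \<bullet> (hessian B x *v v))"
  unfolding local_norm_def
proof (rule symmetric_trilinear_bound[where T="third_derivative B x" and b="\<lambda>v w. v \<bullet> (hessian B x *v w)"])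
  show "third_derivative B x u u u \<le> 2" if "u \<bullet> (hessian B x *v u) = 1" for u
    using self_concordance[OF x, of u] that by simp
qed (rule third_derivative_linear[OF open_interior C3 x] third_derivative_symmetric[OF open_interior C3 x]
    bilinear_matrix hessian_B_symmetric[OF x] hessian_pos[OF x] | assumption)+

text \<open>Along the segment the logarithm of the Hessian form at \<open>v\<close> has derivative at least
\<open>- 2 r / (1 - r t)\<close>, which is the derivative of \<open>2 ln (1 - r t)\<close>.\<close>

lemma hessian_comparison:
  assumes x: "x \<in> S" and r: "local_norm B x u < 1"
  shows "(1 - local_norm B x u)\<^sup>2 * (v \<bullet> (hessian B x *v v)) \<le> v \<bullet> (hessian B (x + u) *v v)"
proof -
  define r where "r = local_norm B x u"
  have r01: "0 \<le> r" "r < 1" using local_norm_nonneg[OF x] assms(2) by (auto simp: r_def)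
  let ?p = "\<lambda>t. x + t *\<^sub>R u" and ?h = "\<lambda>t. v \<bullet> (hessian B (x + t *\<^sub>R u) *v v)"
  have inS: "?p t \<in> S" if "0 \<le> t" "t \<le> 1" for t by (rule local_norm_ray[OF assms that])
  let ?k = "\<lambda>t. ?h t / (1 - r * t)\<^sup>2"
  have ex: "\<exists>y. (?k has_real_derivative y) (at t) \<and> 0 \<le> y" if t: "0 \<le> t" "t \<le> 1" for t
  proof (intro exI conjI)
    have rt: "r * t \<le> r" using r01 that by (simp add: mult_left_le)
    then have q: "1 - r * t > 0" using r01 by linarith
    let ?D = "third_derivative B (?p t) u v v"
    have "((\<lambda>t. (1 - r * t)\<^sup>2) has_real_derivative - 2 * r * (1 - r * t)) (at t)"
      by (auto intro!: derivative_eq_intros)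
    then show "(?k has_real_derivative
        (?D * (1 - r * t)\<^sup>2 - ?h t * (- 2 * r * (1 - r * t))) / ((1 - r * t)\<^sup>2 * (1 - r * t)\<^sup>2)) (at t)"
      using q by (intro DERIV_divide third_derivative_along_line[OF open_interior C3] inS t) auto
    have "local_norm B (?p t) u \<le> r / (1 - r * t)"
      unfolding r_def by (rule local_norm_growth) (use that inS r01 rt in \<open>auto simp: r_def\<close>)
    then have "2 * local_norm B (?p t) u * ?h t \<le> 2 * (r / (1 - r * t)) * ?h t"
      using hessian_nonneg[OF inS[OF t]] by (intro mult_right_mono) auto
    then have "- ?D \<le> 2 * (r / (1 - r * t)) * ?h t"
      using third_derivative_bound[OF inS[OF t], of u v] by linarith
    then have "- ?D * (1 - r * t) \<le> 2 * r * ?h t" using q by (simp add: field_simps)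
    then have "0 \<le> (?D * (1 - r * t) + 2 * r * ?h t) * (1 - r * t)" using q by (intro mult_nonneg_nonneg) auto
    then show "0 \<le> (?D * (1 - r * t)\<^sup>2 - ?h t * (- 2 * r * (1 - r * t))) / ((1 - r * t)\<^sup>2 * (1 - r * t)\<^sup>2)"
      by (intro divide_nonneg_nonneg) (simp add: power2_eq_square algebra_simps, simp)
  qed
  have "?k 0 \<le> ?k 1" by (rule DERIV_nonneg_imp_nondecreasing[OF _ ex]) auto
  then show ?thesis using r01 by (simp add: r_def[symmetric] field_simps)
qed

end

section \<open>Local norms and Taylor bounds\<close>

text \<open>Matrices are moved across inner products below, which requires transposes to stay visible.\<close>

declare transpose_matrix_vector [simp del]

lemma inner_matrix_left: "(transpose N *v v) \<bullet> w = v \<bullet> (N *v (w :: real^'n))"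
  by (simp add: transpose_matrix_vector dot_lmul_matrix)

lemma inner_matrix_right: "(N *v w) \<bullet> v = w \<bullet> (transpose N *v (v :: real^'m))"
  by (metis inner_commute inner_matrix_left)

lemma matrix_inv_cancel:
  fixes H :: "real^'n^'n"
  assumes "invertible H"
  shows "H ** matrix_inv H = mat 1" "matrix_inv H ** H = mat 1"
proof -
  have "\<exists>H'. H ** H' = mat 1 \<and> H' ** H = mat 1" using assms by (simp add: invertible_def)
  then have "H ** matrix_inv H = mat 1 \<and> matrix_inv H ** H = mat 1"
    unfolding matrix_inv_def by (rule someI_ex)
  then show "H ** matrix_inv H = mat 1" "matrix_inv H ** H = mat 1" by auto
qed

lemma invertible_if_positive_definite:
  fixes H :: "real^'n^'n"
  assumes "\<And>v. v \<noteq> 0 \<Longrightarrow> 0 < v \<bullet> (H *v v)"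
  shows "invertible H"
proof -
  have "\<forall>v. H *v v = 0 \<longrightarrow> v = 0" using assms by force
  then show ?thesis unfolding invertible_left_inverse matrix_left_invertible_ker .
qed

text \<open>The matrix norm is a supremum of reals, so bounds can only be read off from it once the set is known
to be bounded; the unit ball of the local norm is compact.\<close>

lemma (in barrier)
  assumes x: "x \<in> S"
  shows dual_matrix_norm_bdd_above: "bdd_above ((\<lambda>v. dual_norm B x (F *v v)) ` {v. local_norm B x v \<le> 1})"
    and dual_matrix_norm_nonneg: "0 \<le> dual_matrix_norm B x F"
proof -
  let ?V = "{v. local_norm B x v \<le> 1}" and ?q = "\<lambda>v. v \<bullet> (hessian B x *v v)"
  obtain m where m: "m > 0" "\<And>v. m * (norm v)\<^sup>2 \<le> ?q v"
    using definite_form_lower_bound[OF bilinear_matrix hessian_pos[OF x]] by metis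
  have "norm v \<le> 1 / sqrt m" if "v \<in> ?V" for v
  proof -
    have "?q v \<le> 1" using that hessian_nonneg[OF x] by (simp add: local_norm_def)
    then have "(norm v)\<^sup>2 \<le> 1 / m" using m(1) m(2)[of v] by (simp add: field_simps)
    then show ?thesis by (metis real_le_rsqrt real_sqrt_divide real_sqrt_one)
  qed
  then have "bounded ?V" unfolding bounded_iff by blast
  moreover have "closed ?V"
    unfolding local_norm_def by (intro closed_Collect_le continuous_intros linear_continuous_on
        linear_linear[THEN iffD2] matrix_vector_mul_linear)
  ultimately have "compact ?V" using compact_eq_bounded_closed by blast
  moreover have "continuous_on ?V (\<lambda>v. dual_norm B x (F *v v))"
    unfolding dual_norm_def matrix_vector_mul_assoc
    by (intro continuous_intros linear_continuous_on linear_linear[THEN iffD2] matrix_vector_mul_linear)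
  ultimately have "compact ((\<lambda>v. dual_norm B x (F *v v)) ` ?V)"
    by (intro compact_continuous_image)
  then show bdd: "bdd_above ((\<lambda>v. dual_norm B x (F *v v)) ` ?V)"
    by (intro bounded_imp_bdd_above compact_imp_bounded)
  have "dual_norm B x (F *v 0) \<le> dual_matrix_norm B x F"
    unfolding dual_matrix_norm_def by (rule cSUP_upper[OF _ bdd]) (simp add: local_norm_def)
  then show "0 \<le> dual_matrix_norm B x F" by (simp add: dual_norm_def)
qed

text \<open>The factor \<open>M\<close> turns the local geometry into the Euclidean one: \<open>u \<mapsto> M u\<close> is an isometry onto the
local norm at \<open>x\<close>, and the dual norm of \<open>w\<close> is the length of \<open>M\<^sup>T w\<close>.\<close>

locale barrier_point = barrier K B \<nu> for K :: "(real^'n) set" and B \<nu> +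
  fixes x :: "real^'n" and M :: "real^'n^'n"
  assumes x: "x \<in> S" and factor: "M ** transpose M = matrix_inv (hessian B x)"
begin

abbreviation "H \<equiv> hessian B x"

lemma invertible_H: "invertible H"
  by (rule invertible_if_positive_definite[OF hessian_pos[OF x]])

lemma MMt_H: "M ** transpose M ** H = mat 1"
  using matrix_inv_cancel[OF invertible_H] by (simp add: factor)

lemma M_inverse: "transpose M ** H ** M = mat 1" "invertible M"
proof -
  have 1: "M ** (transpose M ** H) = mat 1" using MMt_H by (simp add: matrix_mul_assoc)
  then show "transpose M ** H ** M = mat 1" by (subst (asm) matrix_left_right_inverse)
  with 1 show "invertible M" unfolding invertible_def by metis
qed

lemma Mt_H_M: "transpose M *v (H *v (M *v u)) = u"
  using M_inverse(1) by (simp add: matrix_vector_mul_assoc matrix_mul_assoc)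

lemma surj_M: "M *v (transpose M *v (H *v v)) = v"
  using MMt_H by (simp add: matrix_vector_mul_assoc matrix_mul_assoc)

lemma local_norm_M: "local_norm B x (M *v u) = norm u"
  by (simp add: local_norm_def inner_matrix_right Mt_H_M norm_eq_sqrt_inner)

lemma dual_norm_Mt: "dual_norm B x w = norm (transpose M *v w)"
  unfolding dual_norm_def factor[symmetric]
  by (simp add: norm_eq_sqrt_inner inner_matrix_left matrix_vector_mul_assoc)

lemma dual_norm_nonneg: "0 \<le> dual_norm B x w" by (simp add: dual_norm_Mt)

lemma dual_norm_triangle: "dual_norm B x (v + w) \<le> dual_norm B x v + dual_norm B x w"
  by (simp add: dual_norm_Mt matrix_vector_right_distrib norm_triangle_ineq)

lemma dual_Cauchy_Schwarz: "w \<bullet> v \<le> dual_norm B x w * local_norm B x v"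
proof -
  define u where "u = transpose M *v (H *v v)"
  have v: "v = M *v u" by (simp add: u_def surj_M)
  have "w \<bullet> v = (transpose M *v w) \<bullet> u" by (simp add: v inner_matrix_left)
  also have "\<dots> \<le> norm (transpose M *v w) * norm u" by (rule norm_cauchy_schwarz)
  finally show ?thesis by (simp add: v dual_norm_Mt local_norm_M)
qed

text \<open>The dual norm is attained at \<open>[\<nabla>\<^sup>2B(x)]\<inverse> w\<close>, so testing against one vector suffices.\<close>

lemma dual_norm_leI:
  assumes "\<And>v. w \<bullet> v \<le> c * local_norm B x v" "0 \<le> c"
  shows "dual_norm B x w \<le> c"
proof -
  have "w \<bullet> (M *v (transpose M *v w)) \<le> c * norm (transpose M *v w)"
    using assms(1)[of "M *v (transpose M *v w)"] by (simp add: local_norm_M)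
  then have "norm (transpose M *v w) * norm (transpose M *v w) \<le> c * norm (transpose M *v w)"
    by (simp add: inner_matrix_left[symmetric] power2_norm_eq_inner[symmetric] power2_eq_square)
  then show ?thesis using assms(2) by (cases "transpose M *v w = 0") (auto simp: dual_norm_Mt)
qed

lemma dual_matrix_norm: "dual_norm B x (F *v v) \<le> dual_matrix_norm B x F * local_norm B x v"
proof (cases "v = 0")
  case False
  define c where "c = local_norm B x v"
  have c: "c > 0" using hessian_pos[OF x False] by (simp add: c_def local_norm_def)
  have "dual_norm B x (F *v (v /\<^sub>R c)) \<le> dual_matrix_norm B x F"
    unfolding dual_matrix_norm_def
    by (rule cSUP_upper[OF _ dual_matrix_norm_bdd_above[OF x]])
      (use c in \<open>simp add: local_norm_scaleR c_def[symmetric]\<close>)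
  moreover have "dual_norm B x (F *v (v /\<^sub>R c)) = dual_norm B x (F *v v) / c"
    using c by (simp add: dual_norm_Mt matrix_vector_mult_scaleR divide_inverse mult.commute)
  ultimately have "dual_norm B x (F *v v) / c \<le> dual_matrix_norm B x F" by (simp only:)
  then show ?thesis using c by (simp add: c_def[symmetric] pos_divide_le_eq)
qed (simp add: dual_norm_def local_norm_def)

lemma local_ball_in_S: "local_norm B x h < 1 \<Longrightarrow> 0 \<le> t \<Longrightarrow> t \<le> 1 \<Longrightarrow> x + t *\<^sub>R h \<in> S"
  by (rule local_norm_ray[OF x])

text \<open>Integrating the growth bound on the second derivative twice leaves the term \<open>- ln (1 - r) - r\<close>, whose
Taylor expansion starts with \<open>r\<^sup>2 / 2 + r ^ 3 / 3\<close>.\<close>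

lemma barrier_upper_bound:
  assumes "local_norm B x h \<le> b" "b < 1"
  shows "B (x + h) \<le> B x + grad B x \<bullet> h + (local_norm B x h)\<^sup>2 / 2 + (local_norm B x h) ^ 3 / (3 * (1 - b))"
proof -
  define r where "r = local_norm B x h"
  have r: "0 \<le> r" "r \<le> b" "r < 1" using assms local_norm_nonneg[OF x] by (auto simp: r_def)
  let ?p = "\<lambda>t. x + t *\<^sub>R h"
  have inS: "?p t \<in> S" if "0 \<le> t" "t \<le> 1" for t
    using local_ball_in_S[OF _ that, of h] r by (simp add: r_def)
  have rt: "1 - r * t > 0" if "0 \<le> t" "t \<le> 1" for t
    using that r mult_left_le[of t r] by linarith
  have slope: "grad B (?p t) \<bullet> h - grad B x \<bullet> h \<le> r / (1 - r * t) - r" if t: "0 \<le> t" "t \<le> 1" for t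
  proof -
    have "(\<lambda>t. r / (1 - r * t) - grad B (?p t) \<bullet> h) 0 \<le> (\<lambda>t. r / (1 - r * t) - grad B (?p t) \<bullet> h) t"
    proof (rule DERIV_nonneg_imp_nondecreasing[OF t(1)], intro exI conjI)
      fix s assume s: "0 \<le> s" "s \<le> t"
      have s1: "s \<le> 1" using s t by linarith
      have "((\<lambda>t. r / (1 - r * t)) has_real_derivative (r / (1 - r * s))\<^sup>2) (at s)"
        using rt[OF s(1) s1] by (auto intro!: derivative_eq_intros simp: power2_eq_square)
      then show "((\<lambda>t. r / (1 - r * t) - grad B (?p t) \<bullet> h) has_real_derivative
          (r / (1 - r * s))\<^sup>2 - h \<bullet> (hessian B (?p s) *v h)) (at s)"
        by (rule DERIV_diff[OF _ slope_along_line[OF open_interior C2 inS[OF s(1) s1]]])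
      have "local_norm B (?p s) h \<le> r / (1 - r * s)"
        unfolding r_def by (rule local_norm_growth) (use s s1 inS rt[OF s(1) s1] in \<open>auto simp: r_def\<close>)
      then have "(local_norm B (?p s) h)\<^sup>2 \<le> (r / (1 - r * s))\<^sup>2"
        using local_norm_nonneg[OF inS[OF s(1) s1]] by (intro power_mono)
      then show "0 \<le> (r / (1 - r * s))\<^sup>2 - h \<bullet> (hessian B (?p s) *v h)"
        using local_norm_sq[OF inS[OF s(1) s1]] by simp
    qed
    then show ?thesis by simp
  qed
  have "(\<lambda>t. - ln (1 - r * t) - r * t + grad B x \<bullet> h * t - B (?p t)) 0
      \<le> (\<lambda>t. - ln (1 - r * t) - r * t + grad B x \<bullet> h * t - B (?p t)) 1"
  proof (rule DERIV_nonneg_imp_nondecreasing, simp, intro exI conjI)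
    fix s :: real assume s: "0 \<le> s" "s \<le> 1"
    have "((\<lambda>t. - ln (1 - r * t) - r * t + grad B x \<bullet> h * t) has_real_derivative
        r / (1 - r * s) - r + grad B x \<bullet> h) (at s)"
      using rt[OF s] by (auto intro!: derivative_eq_intros)
    then show "((\<lambda>t. - ln (1 - r * t) - r * t + grad B x \<bullet> h * t - B (?p t)) has_real_derivative
        r / (1 - r * s) - r + grad B x \<bullet> h - grad B (?p s) \<bullet> h) (at s)"
      by (rule DERIV_diff[OF _ value_along_line[OF open_interior C2 inS[OF s]]])
    show "0 \<le> r / (1 - r * s) - r + grad B x \<bullet> h - grad B (?p s) \<bullet> h"
      using slope[OF s] by simp
  qed
  then have "B (x + h) \<le> B x + grad B x \<bullet> h + (- ln (1 - r) - r)" by simp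
  also have "- ln (1 - r) - r \<le> r\<^sup>2 / 2 + r ^ 3 / (3 * (1 - r))"
  proof -
    have "(\<lambda>r. r + r\<^sup>2 / 2 + r ^ 3 / (3 * (1 - r)) + ln (1 - r)) 0
        \<le> (\<lambda>r. r + r\<^sup>2 / 2 + r ^ 3 / (3 * (1 - r)) + ln (1 - r)) r"
    proof (rule DERIV_nonneg_imp_nondecreasing[OF r(1)], intro exI conjI)
      fix s assume s: "0 \<le> s" "s \<le> r"
      have s1: "1 - s > 0" using s r by linarith
      have "1 + s + (3 * s\<^sup>2 * (3 * (1 - s)) + s ^ 3 * 3) / (3 * (1 - s) * (3 * (1 - s))) - 1 / (1 - s)
          = s ^ 3 / (3 * (1 - s)\<^sup>2)"
      proof -
        define q where "q = 1 - s"
        have "s = 1 - q" "q \<noteq> 0" using s1 by (auto simp: q_def)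
        then show ?thesis by (simp add: divide_simps) (simp add: power2_eq_square power3_eq_cube algebra_simps)
      qed
      then show "((\<lambda>r. r + r\<^sup>2 / 2 + r ^ 3 / (3 * (1 - r)) + ln (1 - r)) has_real_derivative
          s ^ 3 / (3 * (1 - s)\<^sup>2)) (at s)"
        using s1 by (auto intro!: derivative_eq_intros)
      show "0 \<le> s ^ 3 / (3 * (1 - s)\<^sup>2)" using s by simp
    qed
    then show ?thesis by simp
  qed
  also have "r ^ 3 / (3 * (1 - r)) \<le> r ^ 3 / (3 * (1 - b))"
    using r assms by (intro divide_left_mono mult_pos_pos) auto
  finally show ?thesis by (simp add: r_def)
qed

text \<open>The Lipschitz condition on the Hessian is centred at \<open>x\<close>: it compares the Hessian at \<open>x\<close> with
those at points of the local ball, in the norms at \<open>x\<close>. This suffices for Taylor bounds at \<open>x\<close>.\<close>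

context
  fixes f :: "real^'n \<Rightarrow> real" and D :: "(real^'n) set" and b L :: real
  assumes D: "open D" "Ck_on 2 f D" "\<And>y. local_norm B x (y - x) \<le> b \<Longrightarrow> y \<in> D"
    and lip: "\<And>y. local_norm B x (y - x) \<le> b \<Longrightarrow>
      dual_matrix_norm B x (hessian f y - hessian f x) \<le> L * local_norm B x (x - y)"
    and L: "0 \<le> L"
begin

context
  fixes h :: "real^'n" assumes hb: "local_norm B x h \<le> b"
begin

lemma ray_small: "0 \<le> t \<Longrightarrow> t \<le> 1 \<Longrightarrow> local_norm B x ((x + t *\<^sub>R h) - x) \<le> b"
  using hb local_norm_nonneg[OF x, of h] mult_left_le_one_le[of "local_norm B x h" t]
  by (simp add: local_norm_scaleR)

lemma ray_in_D: "0 \<le> t \<Longrightarrow> t \<le> 1 \<Longrightarrow> x + t *\<^sub>R h \<in> D"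
  using ray_small D(3) by blast

lemma hessian_change:
  assumes t: "0 \<le> t" "t \<le> 1"
  shows "v \<bullet> (hessian f (x + t *\<^sub>R h) *v h) - v \<bullet> (hessian f x *v h)
    \<le> L * t * (local_norm B x h)\<^sup>2 * local_norm B x v"
proof -
  let ?F = "hessian f (x + t *\<^sub>R h) - hessian f x"
  have "v \<bullet> (?F *v h) \<le> dual_norm B x (?F *v h) * local_norm B x v"
    using dual_Cauchy_Schwarz[of "?F *v h" v] by (simp add: inner_commute)
  also have "\<dots> \<le> (dual_matrix_norm B x ?F * local_norm B x h) * local_norm B x v"
    by (intro mult_right_mono dual_matrix_norm local_norm_nonneg[OF x])
  also have "\<dots> \<le> (L * (t * local_norm B x h) * local_norm B x h) * local_norm B x v"
    using lip[OF ray_small[OF t]] local_norm_scaleR[of x "-t" h] t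
    by (intro mult_right_mono local_norm_nonneg[OF x]) auto
  finally show ?thesis by (simp add: matrix_vector_mult_diff_rdistrib inner_diff_right power2_eq_square mult_ac)
qed

lemma slope_bound:
  assumes t: "0 \<le> t" "t \<le> 1"
  shows "grad f (x + t *\<^sub>R h) \<bullet> v \<le> grad f x \<bullet> v + t * (v \<bullet> (hessian f x *v h))
    + L * (local_norm B x h)\<^sup>2 * local_norm B x v * t\<^sup>2 / 2"
proof -
  let ?c = "L * (local_norm B x h)\<^sup>2 * local_norm B x v" and ?d = "v \<bullet> (hessian f x *v h)"
  let ?k = "\<lambda>t. t * ?d + ?c * t\<^sup>2 / 2 - grad f (x + t *\<^sub>R h) \<bullet> v"
  have "?k 0 \<le> ?k t"
  proof (rule DERIV_nonneg_imp_nondecreasing[OF t(1)], intro exI conjI)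
    fix s assume s: "0 \<le> s" "s \<le> t"
    then have s1: "s \<le> 1" using t by simp
    have "((\<lambda>t. t * ?d + ?c * t\<^sup>2 / 2) has_real_derivative ?d + ?c * s) (at s)"
      by (auto intro!: derivative_eq_intros)
    then show "(?k has_real_derivative ?d + ?c * s - v \<bullet> (hessian f (x + s *\<^sub>R h) *v h)) (at s)"
      by (rule DERIV_diff[OF _ slope_along_line[OF D(1,2) ray_in_D[OF s(1) s1]]])
    show "0 \<le> ?d + ?c * s - v \<bullet> (hessian f (x + s *\<^sub>R h) *v h)"
      using hessian_change[OF s(1) s1, of v] by (simp add: mult_ac)
  qed
  then show ?thesis by simp
qed

lemma gradient_linearization_error:
  "dual_norm B x (grad f (x + h) - grad f x - hessian f x *v h) \<le> L / 2 * (local_norm B x h)\<^sup>2"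
proof (rule dual_norm_leI)
  fix v
  show "(grad f (x + h) - grad f x - hessian f x *v h) \<bullet> v
      \<le> L / 2 * (local_norm B x h)\<^sup>2 * local_norm B x v"
    using slope_bound[of 1 v] by (simp add: inner_diff_left inner_commute[of v])
qed (use L in simp)

lemma value_upper_bound:
  "f (x + h) \<le> f x + grad f x \<bullet> h + h \<bullet> (hessian f x *v h) / 2 + L / 6 * (local_norm B x h) ^ 3"
proof -
  let ?c = "L * (local_norm B x h) ^ 3" and ?d = "h \<bullet> (hessian f x *v h)" and ?g = "grad f x \<bullet> h"
  let ?k = "\<lambda>t. ?g * t + ?d * t\<^sup>2 / 2 + ?c * t ^ 3 / 6 - f (x + t *\<^sub>R h)"
  have "?k 0 \<le> ?k 1"
  proof (rule DERIV_nonneg_imp_nondecreasing, simp, intro exI conjI)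
    fix s :: real assume s: "0 \<le> s" "s \<le> 1"
    have "((\<lambda>t. ?g * t + ?d * t\<^sup>2 / 2 + ?c * t ^ 3 / 6) has_real_derivative ?g + ?d * s + ?c * s\<^sup>2 / 2) (at s)"
      by (auto intro!: derivative_eq_intros)
    then show "(?k has_real_derivative ?g + ?d * s + ?c * s\<^sup>2 / 2 - grad f (x + s *\<^sub>R h) \<bullet> h) (at s)"
      by (rule DERIV_diff[OF _ value_along_line[OF D(1,2) ray_in_D[OF s]]])
    show "0 \<le> ?g + ?d * s + ?c * s\<^sup>2 / 2 - grad f (x + s *\<^sub>R h) \<bullet> h"
      using slope_bound[OF s, of h] by (simp add: power2_eq_square power3_eq_cube mult_ac)
  qed
  then show ?thesis by simp
qed

end
end
end

text \<open>Dual norms compare in the opposite way to the norms, for which the comparison of Hessians gives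
\<open>(1 - b) * local_norm B x v \<le> local_norm B (x + u) v\<close>.\<close>

lemma (in barrier) dual_norm_comparison:
  assumes "barrier_point K B \<nu> x M" "barrier_point K B \<nu> (x + u) M'"
    and r: "local_norm B x u \<le> b" "b < 1"
  shows "dual_norm B (x + u) w \<le> dual_norm B x w / (1 - b)"
proof -
  interpret p: barrier_point K B \<nu> x M by fact
  interpret q: barrier_point K B \<nu> "x + u" M' by fact
  have b: "1 - b > 0" using r by simp
  show ?thesis
  proof (rule q.dual_norm_leI)
    fix v
    have "(1 - b)\<^sup>2 * (local_norm B x v)\<^sup>2 \<le> (1 - local_norm B x u)\<^sup>2 * (local_norm B x v)\<^sup>2"
      using r by (intro mult_right_mono power_mono) auto
    also have "\<dots> \<le> (local_norm B (x + u) v)\<^sup>2"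
      using hessian_comparison[OF p.x, of u v] r local_norm_sq[OF p.x] local_norm_sq[OF q.x] by simp
    finally have "((1 - b) * local_norm B x v)\<^sup>2 \<le> (local_norm B (x + u) v)\<^sup>2"
      by (simp add: power_mult_distrib)
    then have "(1 - b) * local_norm B x v \<le> local_norm B (x + u) v"
      using local_norm_nonneg[OF q.x] by (rule power2_le_imp_le)
    then have le: "local_norm B x v \<le> local_norm B (x + u) v / (1 - b)"
      using b by (simp add: pos_le_divide_eq mult.commute)
    have "w \<bullet> v \<le> dual_norm B x w * local_norm B x v" by (rule p.dual_Cauchy_Schwarz)
    also have "\<dots> \<le> dual_norm B x w * (local_norm B (x + u) v / (1 - b))"
      by (intro mult_left_mono le p.dual_norm_nonneg)
    finally show "w \<bullet> v \<le> dual_norm B x w / (1 - b) * local_norm B (x + u) v" by simp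
  qed (use b p.dual_norm_nonneg in simp)
qed

section \<open>Iterations of the capped conjugate gradient method\<close>

lemma shifted_mult: "shifted H e *v w = H *v w + (2 * e) *\<^sub>R w"
proof -
  have "mat (2 * e) = (2 * e) *\<^sub>R (mat 1 :: real^'a^'a)" by (vector mat_def)
  then have "mat (2 * e) *v w = (2 * e) *\<^sub>R (mat 1 *v w)" by (metis scaleR_matrix_vector_assoc)
  then show ?thesis by (simp add: shifted_def matrix_vector_mult_add_rdistrib)
qed

lemma shifted_form: "v \<bullet> (shifted H e *v v) = v \<bullet> (H *v v) + 2 * e * (norm v)\<^sup>2"
  by (simp add: shifted_mult inner_add_right power2_norm_eq_inner)

lemma upd_U_ge: "0 \<le> U \<Longrightarrow> U \<le> upd_U H w U"
  by (cases "w = 0") (auto simp: upd_U_def field_simps)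

lemma upd_U_nonneg: "0 \<le> U \<Longrightarrow> 0 \<le> upd_U H w U"
  using upd_U_ge[of U H w] by linarith

lemma upd_U_bounds_image: "0 \<le> U \<Longrightarrow> norm (H *v w) \<le> upd_U H w U * norm w"
  by (cases "w = 0") (auto simp: upd_U_def)

lemma upd_U_le: "(\<And>v. norm (H *v v) \<le> C * norm v) \<Longrightarrow> U \<le> C \<Longrightarrow> 0 \<le> C \<Longrightarrow> upd_U H w U \<le> C"
  by (cases "w = 0") (auto simp: upd_U_def field_simps)

text \<open>The cap \<open>U\<close> starts at zero, as in every call made by the outer method.\<close>

locale capped_cg =
  fixes H :: "real^'n^'n" and g :: "real^'n" and e \<zeta> :: real
  assumes symH: "\<And>v w. v \<bullet> (H *v w) = w \<bullet> (H *v v)"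
    and e: "0 < e" and \<zeta>: "0 < \<zeta>" "\<zeta> < 1" and g: "g \<noteq> 0"
begin

abbreviation "Hb \<equiv> shifted H e"
abbreviation "st j \<equiv> cg_iter H g e 0 j"
abbreviation "y j \<equiv> cg_y (st j)"
abbreviation "r j \<equiv> cg_r (st j)"
abbreviation "p j \<equiv> cg_p (st j)"
abbreviation "U j \<equiv> cg_U (st j)"
definition "\<alpha> j = (r j \<bullet> r j) / (p j \<bullet> (Hb *v p j))"

lemma symHb: "v \<bullet> (Hb *v w) = w \<bullet> (Hb *v v)"
  by (simp add: shifted_mult inner_add_right symH[of v w] inner_commute[of v w])

lemma cg_0: "y 0 = 0" "r 0 = g" "p 0 = - g" "U 0 = upd_U H (- g) 0"
  by (simp_all add: cg_init_def)

lemma cg_Suc: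
  "y (Suc j) = y j + \<alpha> j *\<^sub>R p j"
  "r (Suc j) = r j + \<alpha> j *\<^sub>R (Hb *v p j)"
  "p (Suc j) = - r (Suc j) + ((norm (r (Suc j)))\<^sup>2 / (norm (r j))\<^sup>2) *\<^sub>R p j"
  "U (Suc j) = upd_U H (r (Suc j)) (upd_U H (y (Suc j)) (upd_U H (p (Suc j)) (U j)))"
  by (simp_all add: cg_step_def Let_def \<alpha>_def)

declare cg_iter.simps [simp del]

lemma residual: "r j = g + Hb *v y j"
  by (induction j)
    (simp_all add: cg_0 cg_Suc matrix_vector_right_distrib matrix_vector_mult_scaleR)

text \<open>The conditions under which a step from index \<open>j\<close> is well defined and not the zero step.\<close>

definition "regular j \<longleftrightarrow> r j \<noteq> 0 \<and> 0 < p j \<bullet> (Hb *v p j)"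

text \<open>The relations are proved together because each feeds the others: a residual is a combination of two
search directions, and the image of a search direction is a combination of two residuals.\<close>

lemma conjugacy:
  assumes "\<forall>i<j. regular i"
  shows "(\<forall>i<j. r j \<bullet> p i = 0) \<and> (\<forall>i<j. r j \<bullet> r i = 0) \<and> (\<forall>i<j. p j \<bullet> (Hb *v p i) = 0)
    \<and> r j \<bullet> p j = - (norm (r j))\<^sup>2"
  using assms
proof (induction j)
  case 0
  then show ?case by (simp add: cg_0 power2_norm_eq_inner)
next
  case (Suc j)
  then have IH: "\<And>i. i < j \<Longrightarrow> r j \<bullet> p i = 0" "\<And>i. i < j \<Longrightarrow> r j \<bullet> r i = 0"
      "\<And>i. i < j \<Longrightarrow> p j \<bullet> (Hb *v p i) = 0" "r j \<bullet> p j = - (norm (r j))\<^sup>2"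
    by auto
  have reg: "r i \<noteq> 0" "0 < p i \<bullet> (Hb *v p i)" if "i \<le> j" for i
    using Suc.prems that by (auto simp: regular_def)
  have \<alpha>: "\<alpha> i \<noteq> 0" if "i \<le> j" for i using reg[OF that] by (simp add: \<alpha>_def)
  have a: "r (Suc j) \<bullet> p i = 0" if "i \<le> j" for i
  proof (cases "i = j")
    case True
    have "r (Suc j) \<bullet> p j = r j \<bullet> p j + \<alpha> j * (p j \<bullet> (Hb *v p j))"
      unfolding cg_Suc(2) inner_add_left inner_scaleR_left inner_commute[of "Hb *v p j"] ..
    also have "\<alpha> j * (p j \<bullet> (Hb *v p j)) = (norm (r j))\<^sup>2"
      using reg[of j] by (simp add: \<alpha>_def power2_norm_eq_inner)
    finally show ?thesis using IH(4) True by simp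
  next
    case False
    then have "i < j" using that by simp
    then show ?thesis using IH(1,3)[of i] symHb[of "p j" "p i"]
      unfolding cg_Suc(2) inner_add_left inner_scaleR_left inner_commute[of "Hb *v p j"] by simp
  qed
  have b: "r (Suc j) \<bullet> r i = 0" if "i \<le> j" for i
  proof (cases i)
    case 0
    then show ?thesis using a[of 0] by (simp add: cg_0)
  next
    case (Suc k)
    have "r i = - p i + ((norm (r i))\<^sup>2 / (norm (r k))\<^sup>2) *\<^sub>R p k"
      unfolding Suc cg_Suc(3) by simp
    then have "r (Suc j) \<bullet> r i = r (Suc j) \<bullet> (- p i + ((norm (r i))\<^sup>2 / (norm (r k))\<^sup>2) *\<^sub>R p k)"
      by simp
    also have "\<dots> = 0" using a[of i] a[of k] that Suc by (simp only: inner_add_right inner_minus_right inner_scaleR_right)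
    finally show ?thesis .
  qed
  have d: "r (Suc j) \<bullet> p (Suc j) = - (norm (r (Suc j)))\<^sup>2"
    unfolding cg_Suc(3) using a[of j] by (simp add: inner_add_right inner_diff_right power2_norm_eq_inner)
  have c: "p (Suc j) \<bullet> (Hb *v p i) = 0" if i: "i \<le> j" for i
  proof -
    have Hp: "Hb *v p i = (1 / \<alpha> i) *\<^sub>R (r (Suc i) - r i)" using \<alpha>[OF i] by (simp add: cg_Suc(2))
    have r: "r (Suc j) \<bullet> (Hb *v p i) = (if i = j then (norm (r (Suc j)))\<^sup>2 / \<alpha> j else 0)"
      using b[of i] b[of "Suc i"] i by (auto simp: Hp inner_diff_right power2_norm_eq_inner)
    have "p (Suc j) \<bullet> (Hb *v p i) = - (r (Suc j) \<bullet> (Hb *v p i))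
        + ((norm (r (Suc j)))\<^sup>2 / (norm (r j))\<^sup>2) * (p j \<bullet> (Hb *v p i))"
      unfolding cg_Suc(3) inner_add_left inner_minus_left inner_scaleR_left ..
    also have "\<dots> = 0"
    proof (cases "i = j")
      case True
      then show ?thesis using reg[of j] unfolding r \<alpha>_def by (simp add: power2_norm_eq_inner)
    next
      case False
      then show ?thesis using IH(3)[of i] i unfolding r by simp
    qed
    finally show ?thesis .
  qed
  show ?case using a b c d by (simp add: less_Suc_eq_le)
qed

lemma iterate_orthogonal_residual:
  assumes "\<forall>i<j. regular i"
  shows "y j \<bullet> r j = 0"
proof -
  have "y k \<bullet> r j = 0" if "k \<le> j" for k
    using that
  proof (induction k)
    case (Suc k)
    have "r j \<bullet> p k = 0" using conjugacy[OF assms] Suc.prems by simp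
    then show ?case using Suc 
      unfolding cg_Suc(1) inner_add_left inner_scaleR_left inner_commute[of "p k"] by simp
  qed (simp add: cg_0)
  then show ?thesis by simp
qed

lemma regular_steps_le_dim:
  assumes "\<forall>i<w. regular i"
  shows "w \<le> CARD('n)"
proof -
  have ne: "r i \<noteq> 0" if "i < w" for i using assms that by (simp add: regular_def)
  have orth: "r i \<bullet> r k = 0" if "i < w" "k < w" "i \<noteq> k" for i k
  proof -
    have "r i \<bullet> r k = 0" if "k < i" "i < w" for i k using conjugacy[of i] assms that by auto
    then show ?thesis using that by (metis inner_commute linorder_neqE_nat)
  qed
  have inj: "inj_on r {..<w}"
  proof (rule inj_onI)
    fix i k assume "i \<in> {..<w}" "k \<in> {..<w}" "r i = r k"
    then show "i = k" using orth[of i k] ne[of i] by auto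
  qed
  have "independent (r ` {..<w})"
    by (rule pairwise_orthogonal_independent)
      (use orth ne in \<open>auto simp: pairwise_def orthogonal_def\<close>)
  then have "card (r ` {..<w}) \<le> DIM(real^'n)" by (rule independent_bound[THEN conjunct2])
  then show ?thesis by (simp add: card_image[OF inj])
qed

lemma U_nonneg: "0 \<le> U j"
proof (induction j)
  case 0
  show ?case unfolding cg_0 by (intro upd_U_nonneg) simp
next
  case (Suc j)
  show ?case unfolding cg_Suc by (intro upd_U_nonneg Suc)
qed

lemma U_le:
  assumes "\<And>v. norm (H *v v) \<le> C * norm v" "0 \<le> C"
  shows "U j \<le> C"
proof (induction j)
  case (Suc j)
  show ?case unfolding cg_Suc by (intro upd_U_le assms Suc)
qed (auto simp: cg_0 intro!: upd_U_le assms)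

text \<open>The cap is raised for \<open>y\<close> before it is raised for \<open>r\<close>, and it never drops again.\<close>

lemma norm_H_y:
  assumes "0 < j"
  shows "norm (H *v y j) \<le> U j * norm (y j)"
proof -
  obtain k where k: "j = Suc k" using assms by (cases j) auto
  let ?U1 = "upd_U H (p j) (U k)"
  have "0 \<le> ?U1" by (rule order_trans[OF U_nonneg[of k] upd_U_ge[OF U_nonneg[of k]]])
  moreover from order_trans[OF this upd_U_ge[OF this]] have U2: "0 \<le> upd_U H (y j) ?U1" .
  ultimately have "norm (H *v y j) \<le> upd_U H (y j) ?U1 * norm (y j)" by (intro upd_U_bounds_image)
  also have "\<dots> \<le> U j * norm (y j)"
    unfolding k cg_Suc(4) using upd_U_ge[OF U2] by (intro mult_right_mono) (auto simp: k)
  finally show ?thesis .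
qed

lemma kappa_ge_2: "2 \<le> cg_kappa e (U j)"
  using U_nonneg[of j] e by (simp add: cg_kappa_def field_simps)

lemma cg_zeta_hat_pos: "0 < cg_zeta_hat e \<zeta> (U j)"
  using kappa_ge_2[of j] \<zeta> by (simp add: cg_zeta_hat_def)

lemma not_stopped:
  assumes "\<not> cg_stops H g e \<zeta> 0 j"
  shows "\<not> low_curvature H e (p j)" "r j \<noteq> 0"
proof -
  show "\<not> low_curvature H e (p j)" using assms by (auto simp: cg_stops_def Let_def split: if_splits)
  show "r j \<noteq> 0"
  proof (cases "j = 0")
    case False
    then have "norm (r j) > cg_zeta_hat e \<zeta> (U j) * norm g"
      using assms by (auto simp: cg_stops_def cg_small_residual_def Let_def)
    moreover have "cg_zeta_hat e \<zeta> (U j) * norm g \<ge> 0" using cg_zeta_hat_pos[of j] by simp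
    ultimately show ?thesis by auto
  qed (simp add: cg_0 g)
qed

lemma reaches_regular:
  assumes "cg_reaches H g e \<zeta> 0 w"
  shows "\<forall>i<w. regular i"
proof -
  have "i < w \<longrightarrow> regular i" for i
  proof (induction i rule: less_induct)
    case (less i)
    show ?case
    proof
      assume i: "i < w"
      then have "\<not> cg_stops H g e \<zeta> 0 i" using assms by (simp add: cg_reaches_def)
      note ns = not_stopped[OF this]
      have "r i \<bullet> p i = - (norm (r i))\<^sup>2" using conjugacy[of i] less i by auto
      then have "p i \<noteq> 0" using ns(2) by auto
      then have "0 < e * (norm (p i))\<^sup>2" using e by simp
      also have "\<dots> \<le> p i \<bullet> (Hb *v p i)" using ns(1) by (simp add: low_curvature_def)
      finally show "regular i" using ns(2) by (simp add: regular_def)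
    qed
  qed
  then show ?thesis by simp
qed

lemma returns_NC: "cg_returns H g e \<zeta> 0 j d NC \<Longrightarrow> low_curvature H e d"
  by (auto simp: cg_returns_def Let_def split: if_splits)

text \<open>The residual test is relative to \<open>g\<close>, but the outer method needs it relative to \<open>d\<close>. The cap
dominates the stretching of \<open>d\<close>, so \<open>norm g\<close> is at most \<open>\<kappa> * e * norm d\<close> plus the residual, and the
product of \<open>\<kappa>\<close> with the accuracy is \<open>\<zeta> / 3\<close>.\<close>

lemma returns_SOL:
  assumes "cg_returns H g e \<zeta> 0 j d SOL"
  shows "e * (norm d)\<^sup>2 \<le> d \<bullet> (Hb *v d)" "d \<bullet> (Hb *v d) = - (g \<bullet> d)"
    "norm (g + Hb *v d) \<le> \<zeta> * e / 2 * norm d"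
proof -
  have j: "j \<noteq> 0" and low: "\<not> low_curvature H e (y j)" and d: "d = y j"
    and small: "norm (r j) \<le> cg_zeta_hat e \<zeta> (U j) * norm g"
    and reach: "cg_reaches H g e \<zeta> 0 j"
    using assms by (auto simp: cg_returns_def cg_small_residual_def Let_def split: if_splits)
  show "e * (norm d)\<^sup>2 \<le> d \<bullet> (Hb *v d)" using low by (simp add: low_curvature_def d)
  show "d \<bullet> (Hb *v d) = - (g \<bullet> d)"
    using iterate_orthogonal_residual[OF reaches_regular[OF reach]]
    by (simp add: residual[of j] inner_add_right d inner_commute)
  let ?\<kappa> = "cg_kappa e (U j)" and ?z = "cg_zeta_hat e \<zeta> (U j)"
  have \<kappa>e: "?\<kappa> * e = U j + 2 * e" using e by (simp add: cg_kappa_def)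
  have "norm (Hb *v d) \<le> norm (H *v d) + norm ((2 * e) *\<^sub>R d)"
    unfolding shifted_mult by (rule norm_triangle_ineq)
  also have "\<dots> \<le> U j * norm d + 2 * e * norm d" using norm_H_y[of j] j d e by simp
  also have "\<dots> = ?\<kappa> * e * norm d" unfolding \<kappa>e by (simp add: algebra_simps)
  finally have Hd: "norm (Hb *v d) \<le> ?\<kappa> * e * norm d" .
  have "norm g \<le> norm (Hb *v d) + norm (r j)"
    using norm_triangle_ineq4[of "r j" "Hb *v d"] by (simp add: residual[of j] d)
  then have "norm g \<le> ?\<kappa> * e * norm d + norm (r j)" using Hd by linarith
  then have "?z * norm g \<le> ?z * (?\<kappa> * e * norm d + norm (r j))"
    using cg_zeta_hat_pos[of j] by (intro mult_left_mono) auto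
  then have "norm (r j) \<le> (?z * ?\<kappa>) * e * norm d + ?z * norm (r j)"
    using small by (simp add: algebra_simps)
  moreover have "?z * ?\<kappa> = \<zeta> / 3" using kappa_ge_2[of j] by (simp add: cg_zeta_hat_def)
  moreover have "?z \<le> 1 / 6"
  proof -
    have "\<zeta> / (3 * ?\<kappa>) \<le> 1 / (3 * 2)" using \<zeta> kappa_ge_2[of j] by (intro frac_le) auto
    then show ?thesis by (simp add: cg_zeta_hat_def)
  qed
  moreover from this have "?z * norm (r j) \<le> 1 / 6 * norm (r j)" by (intro mult_right_mono) auto
  ultimately have "norm (r j) * (5 / 6) \<le> \<zeta> / 3 * e * norm d" by simp
  moreover have "0 \<le> \<zeta> * e * norm d" using \<zeta> e by simp
  ultimately have "norm (r j) \<le> \<zeta> * e / 2 * norm d" by simp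
  then show "norm (g + Hb *v d) \<le> \<zeta> * e / 2 * norm d" by (simp add: residual[of j] d)
qed

text \<open>The numeral \<open>24\<close> is the product of \<open>8\<close> from \<open>sqrt T \<le> 8 \<kappa>\<^sup>2 sqrt \<kappa>\<close> and \<open>3\<close> from the accuracy
\<open>\<zeta> / (3 \<kappa>)\<close>.\<close>

lemma sqrt_T_le: "sqrt (cg_T e (U j)) / cg_zeta_hat e \<zeta> (U j) \<le> 24 * cg_kappa e (U j) powr (7/2) / \<zeta>"
proof -
  define \<kappa> where "\<kappa> = cg_kappa e (U j)"
  define s where "s = sqrt \<kappa>"
  have \<kappa>: "\<kappa> \<ge> 2" using kappa_ge_2 by (simp add: \<kappa>_def)
  have s: "s \<ge> 1" "s\<^sup>2 = \<kappa>" using \<kappa> by (auto simp: s_def)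
  define \<tau> where "\<tau> = s / (s + 1)"
  have \<tau>: "0 < \<tau>" "\<tau> < 1" "1 - \<tau> = 1 / (s + 1)" using s by (auto simp: \<tau>_def field_simps)
  have st: "0 < sqrt \<tau>" "sqrt \<tau> < 1" using \<tau> by auto
  have "1 - \<tau> = (1 - sqrt \<tau>) * (1 + sqrt \<tau>)" using \<tau> by (simp add: algebra_simps)
  also have "\<dots> \<le> (1 - sqrt \<tau>) * 2" using st by (intro mult_left_mono) auto
  finally have "1 \<le> (1 - sqrt \<tau>) * (2 * (s + 1))" using \<tau> s by (simp add: field_simps)
  also have "\<dots> \<le> (1 - sqrt \<tau>) * (4 * s)" using st s by (intro mult_left_mono) auto
  finally have inv: "1 / (1 - sqrt \<tau>) \<le> 4 * s" using st by (simp add: field_simps)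
  have "sqrt (cg_T e (U j)) = 2 * \<kappa>\<^sup>2 * (1 / (1 - sqrt \<tau>))"
  proof -
    have "cg_T e (U j) = (2 * \<kappa>\<^sup>2 / (1 - sqrt \<tau>))\<^sup>2"
      by (simp add: cg_T_def cg_tau_def \<kappa>_def s_def \<tau>_def power_divide power_mult_distrib flip: power_mult)
    then show ?thesis using st by simp
  qed
  also have "\<dots> \<le> 2 * \<kappa>\<^sup>2 * (4 * s)" using inv by (intro mult_left_mono) auto
  finally have T: "sqrt (cg_T e (U j)) \<le> 8 * (\<kappa>\<^sup>2 * s)" by simp
  have "sqrt (cg_T e (U j)) / cg_zeta_hat e \<zeta> (U j) = sqrt (cg_T e (U j)) * (3 * \<kappa> / \<zeta>)"
    by (simp add: cg_zeta_hat_def \<kappa>_def)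
  also have "\<dots> \<le> 8 * (\<kappa>\<^sup>2 * s) * (3 * \<kappa> / \<zeta>)" using T \<kappa> \<zeta> by (intro mult_right_mono) auto
  also have "\<dots> = 24 * (\<kappa> ^ 3 * s) / \<zeta>" by (simp add: power2_eq_square power3_eq_cube)
  also have "\<kappa> ^ 3 * s = \<kappa> powr (7/2)"
  proof -
    have "\<kappa> powr (7/2) = \<kappa> powr 3 * \<kappa> powr (1/2)" unfolding powr_add[symmetric] by simp
    then show ?thesis using \<kappa> by (simp add: s_def powr_half_sqrt)
  qed
  finally show ?thesis by (simp add: \<kappa>_def)
qed

text \<open>The index before the last one was passed without stopping. Its residual is thus larger than the
accuracy times \<open>norm g\<close> and at most \<open>sqrt T * \<tau> powr (j/2) * norm g\<close>; comparing the two and using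
\<open>- ln \<tau> \<ge> 1 / (sqrt \<kappa> + 1)\<close> bounds \<open>j\<close>.\<close>

lemma cg_iterations:
  assumes reach: "cg_reaches H g e \<zeta> 0 w"
    and C: "\<And>v. norm (H *v v) \<le> C * norm v" "0 \<le> C"
  shows "w \<le> CARD('n)"
    and "real w \<le> 2 + 4 * sqrt (cg_kappa e C) * (ln 24 + 7/2 * ln (cg_kappa e C) + ln (1 / \<zeta>))"
proof -
  show "w \<le> CARD('n)" by (rule regular_steps_le_dim[OF reaches_regular[OF reach]])
  have \<kappa>C: "cg_kappa e C \<ge> 2" using C(2) e by (simp add: cg_kappa_def field_simps)
  have ln\<zeta>: "0 \<le> ln (1 / \<zeta>)" using \<zeta> by simp
  have L0: "0 \<le> ln 24 + 7/2 * ln (cg_kappa e C) + ln (1 / \<zeta>)" using \<kappa>C ln\<zeta> by (intro add_nonneg_nonneg) auto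
  show "real w \<le> 2 + 4 * sqrt (cg_kappa e C) * (ln 24 + 7/2 * ln (cg_kappa e C) + ln (1 / \<zeta>))"
  proof (cases "w \<le> 1")
    case True
    then have "real w \<le> 2" by simp
    moreover have "0 \<le> 4 * sqrt (cg_kappa e C) * (ln 24 + 7/2 * ln (cg_kappa e C) + ln (1 / \<zeta>))"
      using L0 \<kappa>C by (intro mult_nonneg_nonneg) auto
    ultimately show ?thesis by linarith
  next
    case False
    define i where "i = w - 1"
    have i: "0 < i" "i < w" "w = i + 1" using False by (auto simp: i_def)
    define \<kappa> where "\<kappa> = cg_kappa e (U i)"
    define s where "s = sqrt \<kappa>"
    define \<tau> where "\<tau> = s / (s + 1)"
    define X where "X = sqrt (cg_T e (U i)) / cg_zeta_hat e \<zeta> (U i)"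
    have \<kappa>: "2 \<le> \<kappa>" "\<kappa> \<le> cg_kappa e C"
      using kappa_ge_2[of i] U_le[OF C, of i] e by (auto simp: \<kappa>_def cg_kappa_def divide_right_mono)
    have s: "s \<ge> 1" using \<kappa> by (simp add: s_def)
    have \<tau>: "0 < \<tau>" using s by (simp add: \<tau>_def)
    have "\<not> cg_stops H g e \<zeta> 0 i" using reach i by (simp add: cg_reaches_def)
    then have "norm (r i) > cg_zeta_hat e \<zeta> (U i) * norm g"
        "norm (r i) \<le> sqrt (cg_T e (U i)) * \<tau> powr (real i / 2) * norm g"
      using i by (auto simp: cg_stops_def cg_small_residual_def cg_slow_decay_def Let_def cg_tau_def
          \<kappa>_def s_def \<tau>_def)
    then have "cg_zeta_hat e \<zeta> (U i) * norm g < sqrt (cg_T e (U i)) * \<tau> powr (real i / 2) * norm g"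
      by linarith
    then have "cg_zeta_hat e \<zeta> (U i) < sqrt (cg_T e (U i)) * \<tau> powr (real i / 2)"
      using g by simp
    then have X1: "1 < X * \<tau> powr (real i / 2)"
      using cg_zeta_hat_pos[of i] by (simp add: X_def field_simps)
    then have X0: "0 < X" using \<tau> zero_less_mult_pos2[of X "\<tau> powr (real i / 2)"] by simp
    have "0 < ln (X * \<tau> powr (real i / 2))" using X1 by simp
    then have "0 < ln X + real i / 2 * ln \<tau>" using X0 \<tau> by (simp add: ln_mult ln_powr)
    moreover have "ln \<tau> \<le> - (1 / (s + 1))"
      using ln_le_minus_one[OF \<tau>] s by (simp add: \<tau>_def field_simps)
    then have "real i / 2 * ln \<tau> \<le> real i / 2 * - (1 / (s + 1))" by (intro mult_left_mono) auto
    ultimately have "real i / 2 * (1 / (s + 1)) < ln X" by simp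
    then have iX: "real i \<le> 2 * (s + 1) * ln X" using s by (simp add: field_simps)
    have "ln X \<le> ln (24 * \<kappa> powr (7/2) / \<zeta>)"
      using sqrt_T_le[of i] X0 \<kappa> \<zeta> by (subst ln_le_cancel_iff) (auto simp: X_def \<kappa>_def)
    also have "\<dots> = ln 24 + 7/2 * ln \<kappa> + ln (1 / \<zeta>)"
      using \<kappa> \<zeta> by (simp add: ln_mult ln_div ln_powr)
    also have "\<dots> \<le> ln 24 + 7/2 * ln (cg_kappa e C) + ln (1 / \<zeta>)" using \<kappa> by simp
    finally have "2 * (s + 1) * ln X \<le> 2 * (s + 1) * (ln 24 + 7/2 * ln (cg_kappa e C) + ln (1 / \<zeta>))"
      using s by (intro mult_left_mono) auto
    also have "2 * (s + 1) * (ln 24 + 7/2 * ln (cg_kappa e C) + ln (1 / \<zeta>))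
        \<le> 4 * sqrt (cg_kappa e C) * (ln 24 + 7/2 * ln (cg_kappa e C) + ln (1 / \<zeta>))"
    proof (rule mult_right_mono[OF _ L0])
      have "s \<le> sqrt (cg_kappa e C)" using \<kappa> by (simp add: s_def)
      then show "2 * (s + 1) \<le> 4 * sqrt (cg_kappa e C)" using s by simp
    qed
    finally show ?thesis using iX i by simp
  qed
qed

end

section \<open>The reduced problem at an iterate\<close>

lemma barrier_obj_derivatives:
  fixes f B :: "real^'n \<Rightarrow> real"
  assumes "open D" "Ck_on 2 f D" "open E" "Ck_on 2 B E" "x \<in> D" "x \<in> E"
  shows "grad (barrier_obj f B m) x = grad f x + m *\<^sub>R grad B x"
    and "hessian (barrier_obj f B m) x *v v = hessian f x *v v + m *\<^sub>R (hessian B x *v v)"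
proof -
  let ?\<phi> = "barrier_obj f B m"
  have g: "grad ?\<phi> y = grad f y + m *\<^sub>R grad B y" if "y \<in> D" "y \<in> E" for y
  proof -
    have "GDERIV f y :> grad f y" "GDERIV B y :> grad B y"
      using that assms by (auto intro: GDERIV_grad(1) Ck_on_2D(1))
    then have "(?\<phi> has_derivative (\<lambda>h. h \<bullet> grad f y + m * (h \<bullet> grad B y))) (at y)"
      unfolding gderiv_def barrier_obj_def by (intro has_derivative_add has_derivative_mult_right)
    then have d: "GDERIV ?\<phi> y :> grad f y + m *\<^sub>R grad B y"
      by (simp add: gderiv_def inner_add_right)
    then have "?\<phi> differentiable at y" unfolding gderiv_def by (rule differentiableI)
    from GDERIV_unique[OF GDERIV_grad(1)[OF this] d] show ?thesis .
  qed
  show "grad ?\<phi> x = grad f x + m *\<^sub>R grad B x" using g assms by blast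
  have "((\<lambda>y. grad f y + m *\<^sub>R grad B y) has_derivative
      (\<lambda>h. hessian f x *v h + m *\<^sub>R (hessian B x *v h))) (at x)"
    by (intro has_derivative_add has_derivative_scaleR_right has_derivative_grad[OF assms(1,2,5)]
        has_derivative_grad[OF assms(3,4,6)])
  then have d: "(grad ?\<phi> has_derivative (\<lambda>h. hessian f x *v h + m *\<^sub>R (hessian B x *v h))) (at x)"
    by (rule has_derivative_transform_within_open[OF _ open_Int[OF assms(1,3)]])
      (use assms(5,6) g in auto)
  then have "grad ?\<phi> differentiable at x" by (rule differentiableI)
  then have "(grad ?\<phi> has_derivative (\<lambda>h. hessian ?\<phi> x *v h)) (at x)"
    unfolding hessian_def using jacobian_works by blast
  from fun_cong[OF has_derivative_unique[OF this d], of v]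
  show "hessian ?\<phi> x *v v = hessian f x *v v + m *\<^sub>R (hessian B x *v v)" .
qed

text \<open>The data of the method together with the hypotheses in the form in which they are applied: suprema
appear as bounds, and \<open>D\<close> is an open set on which \<open>f\<close> is twice continuously differentiable and which
contains all points where the derivatives of \<open>f\<close> are evaluated.\<close>

locale ncgb_analysis = ncgb A f B \<nu> x0 \<epsilon> \<zeta> \<beta> \<theta> \<eta> \<delta> + barrier K B \<nu>
  for A :: "real^'n^'m" and f B :: "real^'n \<Rightarrow> real" and \<nu> :: real
    and x0 :: "real^'n" and \<epsilon> \<zeta> \<beta> \<theta> \<eta> \<delta> :: real and K :: "(real^'n) set" +
  fixes b :: "real^'m" and \<mu>bar \<phi>low L U\<^sub>H :: real and D :: "(real^'n) set"
  assumes rank: "rank A = CARD('m)"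
    and params: "0 < \<epsilon>" "\<epsilon> < 1" "0 < \<zeta>" "\<zeta> < 1" "sqrt \<epsilon> \<le> \<beta>" "\<beta> < 1" "0 < \<theta>" "\<theta> < 1" "0 < \<eta>" "\<eta> < 1"
      "0 < \<delta>" "\<delta> < 1"
    and x0: "x0 \<in> strictly_feasible A b K"
    and D: "open D" "Ck_on 2 f D" "strictly_feasible A b K \<subseteq> D"
      "\<And>x y. x \<in> sublevel_union f B (strictly_feasible A b K) \<mu>bar x0 \<Longrightarrow> local_norm B x (y - x) \<le> \<beta> \<Longrightarrow> y \<in> D"
    and lipschitz: "\<And>x y. x \<in> sublevel_union f B (strictly_feasible A b K) \<mu>bar x0 \<Longrightarrow>
      local_norm B x (y - x) \<le> \<beta> \<Longrightarrow>
      dual_matrix_norm B x (hessian f y - hessian f x) \<le> L * local_norm B x (x - y)"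
    and L: "0 < L"
    and UH: "\<And>x. x \<in> sublevel_union f B (strictly_feasible A b K) \<mu>bar x0 \<Longrightarrow>
      dual_matrix_norm B x (hessian f x) \<le> U\<^sub>H"
    and low: "\<And>x. x \<in> strictly_feasible A b K \<Longrightarrow> \<phi>low \<le> \<phi> x"
    and \<mu>bar: "\<mu> \<le> \<mu>bar"
begin

abbreviation "\<Omega> \<equiv> strictly_feasible A b K"
abbreviation "level \<equiv> sublevel_union f B \<Omega> \<mu>bar x0"

text \<open>Since \<open>\<nu> \<ge> 1\<close>, the denominator of \<open>\<mu>\<close> is at least \<open>2 * (2 * (1 - \<beta>))\<close>. The bound by \<open>\<epsilon> / 4\<close> controls
the curvature that the barrier adds to a direction found by the oracle, the bound by \<open>1 / 4\<close> its
share in the cubic model.\<close>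

lemma \<mu>_bounds: "0 < \<mu>" "\<mu> \<le> \<epsilon> / 4" "\<mu> \<le> 1 / 4"
proof -
  have s: "1 \<le> sqrt \<nu>" using \<nu>_ge_1 by simp
  have den: "(1 - \<beta>)\<^sup>2 + sqrt \<nu> > 0" using s by (simp add: add_nonneg_pos)
  show "0 < \<mu>" unfolding \<mu>_def using params den by simp
  have "(1 - \<beta>)\<^sup>2 = 1 + \<beta>\<^sup>2 - 2 * \<beta>" by (simp add: power2_diff)
  then have "2 * (1 - \<beta>) \<le> (1 - \<beta>)\<^sup>2 + sqrt \<nu>" using add_increasing[OF zero_le_power2[of \<beta>] s] by simp
  then have "2 * (1 - \<beta>) * \<epsilon> \<le> ((1 - \<beta>)\<^sup>2 + sqrt \<nu>) * \<epsilon>" using params by (intro mult_right_mono) auto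
  moreover have "(1 - \<beta>) * \<epsilon> / (2 * X) \<le> \<epsilon> / 4" if "0 < X" "2 * (1 - \<beta>) * \<epsilon> \<le> X * \<epsilon>" for X
    using that by (simp add: field_simps)
  ultimately show "\<mu> \<le> \<epsilon> / 4" unfolding \<mu>_def using den by blast
  then show "\<mu> \<le> 1 / 4" using params by simp
qed

lemma level_I: "x \<in> \<Omega> \<Longrightarrow> \<phi> x \<le> \<phi> x0 \<Longrightarrow> x \<in> level"
  unfolding sublevel_union_def using \<mu>_bounds(1) \<mu>bar by (intro UN_I[of \<mu>]) auto

lemma level_D: "x \<in> level \<Longrightarrow> x \<in> \<Omega>" "x \<in> level \<Longrightarrow> x \<in> S" "x \<in> level \<Longrightarrow> x \<in> D"
  using D(3) by (auto simp: sublevel_union_def strictly_feasible_def)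

lemma x0_level: "x0 \<in> level" using x0 by (rule level_I) simp

lemma UH_nonneg: "0 \<le> U\<^sub>H"
  using dual_matrix_norm_nonneg[OF level_D(2)[OF x0_level], of "hessian f x0"] UH[OF x0_level] by linarith

text \<open>The constant of the cubic model of \<open>\<phi>\<close>: to the Lipschitz constant of the Hessian of \<open>f\<close> the barrier adds
\<open>2 * \<mu> / (1 - \<beta>)\<close>, and \<open>\<mu> \<le> 1 / 4\<close>.\<close>

definition "L\<phi> = (L * (1 - \<beta>) + 1/2) / (1 - \<beta>)"

lemma L\<phi>_pos: "0 < L\<phi>" unfolding L\<phi>_def using L params by (intro divide_pos_pos add_pos_pos mult_pos_pos) auto

end

locale ncgb_point = ncgb_analysis A f B \<nu> x0 \<epsilon> \<zeta> \<beta> \<theta> \<eta> \<delta> K b \<mu>bar \<phi>low L U\<^sub>H D + barrier_point K B \<nu> x M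
  for A :: "real^'n^'m" and f B :: "real^'n \<Rightarrow> real" and \<nu> :: real
    and x0 :: "real^'n" and \<epsilon> \<zeta> \<beta> \<theta> \<eta> \<delta> :: real and K :: "(real^'n) set"
    and b :: "real^'m" and \<mu>bar \<phi>low L U\<^sub>H :: real and D :: "(real^'n) set"
    and x :: "real^'n" and M :: "real^'n^'n" +
  assumes level: "x \<in> level"
begin

abbreviation "N \<equiv> A ** M"

lemma G_eq: "G M = N ** transpose N"
  by (simp add: G_def matrix_transpose_mul matrix_mul_assoc)

lemma G_mult: "G M *v v = N *v (transpose N *v v)"
  by (simp add: G_eq matrix_vector_mul_assoc)

lemma G_inverse: "G M ** matrix_inv (G M) = mat 1"
proof (rule matrix_inv_cancel(1)[OF invertible_if_positive_definite])
  fix z :: "real^'m" assume z: "z \<noteq> 0"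
  have "rank (transpose A) = CARD('m)" using rank by (simp add: rank_transpose)
  then have "inj ((*v) (transpose A))" by (simp add: full_rank_injective)
  then have "transpose A *v z \<noteq> transpose A *v 0" using z by (metis injD)
  moreover have "inj ((*v) (transpose M))"
    by (rule inj_matrix_vector_mult[OF transpose_invertible[OF M_inverse(2)]])
  ultimately have "transpose M *v (transpose A *v z) \<noteq> transpose M *v 0" by (metis injD matrix_vector_mult_0_right)
  then have "transpose N *v z \<noteq> 0" by (simp add: matrix_transpose_mul matrix_vector_mul_assoc)
  then have "0 < (transpose N *v z) \<bullet> (transpose N *v z)" by simp
  then show "0 < z \<bullet> (G M *v z)"
    by (simp add: G_eq inner_matrix_left matrix_vector_mul_assoc)
qed

lemma G_sym: "u \<bullet> (G M *v v) = v \<bullet> (G M *v u)"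
  unfolding G_mult inner_matrix_left[of N, symmetric] by (rule inner_commute)

lemma G_inv_cancel: "G M *v (matrix_inv (G M) *v w) = w"
  by (simp add: matrix_vector_mul_assoc G_inverse)

lemma G_inv_sym: "u \<bullet> (matrix_inv (G M) *v v) = v \<bullet> (matrix_inv (G M) *v u)"
  using G_sym[of "matrix_inv (G M) *v v" "matrix_inv (G M) *v u"]
  by (simp add: G_inv_cancel inner_commute)

text \<open>\<open>Q\<close> is the orthogonal projector onto the kernel of \<open>A M\<close>.\<close>

lemma Q_mult: "Q M *v d = d - transpose N *v (matrix_inv (G M) *v (N *v d))"
  by (simp add: Q_def matrix_vector_mult_diff_rdistrib matrix_vector_mul_assoc matrix_transpose_mul matrix_mul_assoc)

lemma N_Q: "N *v (Q M *v d) = 0"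
  by (simp only: Q_mult matrix_vector_mult_diff_distrib G_mult[symmetric] G_inv_cancel diff_self)

lemma Q_sym: "u \<bullet> (Q M *v v) = (Q M *v u) \<bullet> v"
  unfolding Q_mult inner_diff_left inner_diff_right inner_matrix_left inner_matrix_right[symmetric]
  using G_inv_sym[of "N *v u" "N *v v"] by (simp add: inner_commute)

lemma transpose_Q: "transpose (Q M) *v w = Q M *v w"
proof -
  have "\<forall>u. u \<bullet> (transpose (Q M) *v w) = u \<bullet> (Q M *v w)"
    using Q_sym by (simp add: inner_matrix_right[symmetric])
  then show ?thesis using vector_eq_ldot by blast
qed

lemma Q_idem: "Q M *v (Q M *v d) = Q M *v d"
  by (subst Q_mult) (simp add: N_Q)

lemma Q_norm: "norm (Q M *v d) \<le> norm d"
proof -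
  have "norm (Q M *v d) * norm (Q M *v d) = d \<bullet> (Q M *v d)"
    using Q_sym[of d "Q M *v d"] by (simp add: Q_idem power2_norm_eq_inner[symmetric] power2_eq_square)
  also have "\<dots> \<le> norm d * norm (Q M *v d)" by (rule norm_cauchy_schwarz)
  finally show ?thesis by (cases "norm (Q M *v d) = 0") (auto simp: mult_le_cancel_right)
qed

lemma P_mult: "P M *v d = M *v (Q M *v d)"
  by (simp add: P_def matrix_vector_mul_assoc)

lemma transpose_P_mult: "transpose (P M) *v w = Q M *v (transpose M *v w)"
  by (simp add: P_def matrix_transpose_mul matrix_vector_mul_assoc[symmetric] transpose_Q)

lemma A_P: "A *v (P M *v d) = 0"
  using N_Q[of d] by (simp only: P_mult matrix_vector_mul_assoc[of A M, symmetric])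

lemma local_norm_P: "local_norm B x (P M *v d) = norm (Q M *v d)"
  by (simp add: P_mult local_norm_M)

lemma red_grad_inner: "red_grad x M \<bullet> d = grad \<phi> x \<bullet> (P M *v d)"
  by (simp add: red_grad_def inner_matrix_left)

lemma red_hess_inner: "d \<bullet> (red_hess_\<phi> x M *v e) = (P M *v d) \<bullet> (hessian \<phi> x *v (P M *v e))"
  by (simp add: red_hess_\<phi>_def matrix_vector_mul_assoc[symmetric] inner_matrix_right)

lemmas in_S = level_D(2)[OF level] and in_D = level_D(3)[OF level]

lemmas \<phi>_derivatives = barrier_obj_derivatives[OF D(1,2) open_interior C2 in_D in_S]

lemma red_hess_sym: "v \<bullet> (red_hess_\<phi> x M *v w) = w \<bullet> (red_hess_\<phi> x M *v v)"
  using hessian_symmetric[OF D(1,2) in_D, of "P M *v v" "P M *v w"] hessian_B_symmetric[OF in_S, of "P M *v v" "P M *v w"]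
  by (simp add: red_hess_inner \<phi>_derivatives inner_add_right)

text \<open>The Hessian of the barrier becomes the identity under \<open>M\<close> and hence \<open>Q\<close> under the projection.\<close>

lemma red_hess_split: "red_hess_\<phi> x M *v d = red_hess_f x M *v d + \<mu> *\<^sub>R (Q M *v d)"
proof -
  have "transpose (P M) *v (hessian B x *v (P M *v d)) = Q M *v d"
    by (simp add: transpose_P_mult P_mult Mt_H_M Q_idem)
  then show ?thesis
    by (simp add: red_hess_\<phi>_def red_hess_f_def matrix_vector_mul_assoc[symmetric] \<phi>_derivatives
        matrix_vector_right_distrib matrix_vector_mult_scaleR)
qed

lemma red_hess_bound: "norm (red_hess_\<phi> x M *v d) \<le> (U\<^sub>H + \<mu>) * norm d"
proof -
  have "norm (red_hess_f x M *v d) = norm (Q M *v (transpose M *v (hessian f x *v (P M *v d))))"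
    by (simp add: red_hess_f_def matrix_vector_mul_assoc[symmetric] transpose_P_mult)
  also have "\<dots> \<le> dual_norm B x (hessian f x *v (P M *v d))"
    unfolding dual_norm_Mt by (rule Q_norm)
  also have "\<dots> \<le> dual_matrix_norm B x (hessian f x) * norm (Q M *v d)"
    using dual_matrix_norm by (simp add: local_norm_P[symmetric])
  also have "\<dots> \<le> U\<^sub>H * norm d"
    by (intro mult_mono UH[OF level] Q_norm UH_nonneg) auto
  finally have 1: "norm (red_hess_f x M *v d) \<le> U\<^sub>H * norm d" .
  have "norm (\<mu> *\<^sub>R (Q M *v d)) \<le> \<mu> * norm d" using \<mu>_bounds(1) Q_norm[of d] by simp
  then show ?thesis unfolding red_hess_split
    using 1 norm_triangle_ineq[of "red_hess_f x M *v d" "\<mu> *\<^sub>R (Q M *v d)"] by (simp add: distrib_right)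
qed

text \<open>The multiplier \<open>R\<close> is the least-squares one, so adding \<open>A\<^sup>T R w\<close> to \<open>w\<close> amounts to projecting.\<close>

lemma multiplier_residual:
  "dual_norm B x (w + transpose A *v (R M *v w)) = norm (transpose (P M) *v w)"
proof -
  have R: "R M *v w = - (matrix_inv (G M) *v (N *v (transpose M *v w)))"
  proof -
    have "(- Z) *v w = - (Z *v w)" for Z :: "real^'n^'m"
      using matrix_vector_mult_diff_rdistrib[of 0 Z w] by simp
    then show ?thesis by (simp add: R_def matrix_vector_mul_assoc matrix_mul_assoc)
  qed
  have "transpose M *v (w + transpose A *v (R M *v w))
      = transpose M *v w + transpose N *v (R M *v w)"
    by (simp add: matrix_vector_right_distrib matrix_transpose_mul matrix_vector_mul_assoc matrix_mul_assoc)
  also have "\<dots> = Q M *v (transpose M *v w)"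
    using matrix_vector_mult_diff_distrib[of "transpose N" 0 "matrix_inv (G M) *v (N *v (transpose M *v w))"]
    by (simp add: Q_mult R)
  finally show ?thesis by (simp add: dual_norm_Mt transpose_P_mult)
qed

lemma \<phi>_upper_bound:
  assumes h: "local_norm B x h \<le> \<beta>"
  shows "\<phi> (x + h) \<le> \<phi> x + grad \<phi> x \<bullet> h + h \<bullet> (hessian \<phi> x *v h) / 2 + L\<phi> / 6 * (local_norm B x h) ^ 3"
proof -
  let ?r = "local_norm B x h"
  have r: "0 \<le> ?r" by (rule local_norm_nonneg[OF in_S])
  have \<beta>: "0 < 1 - \<beta>" using params by simp
  have f: "f (x + h) \<le> f x + grad f x \<bullet> h + h \<bullet> (hessian f x *v h) / 2 + L / 6 * ?r ^ 3"
    by (rule value_upper_bound[OF D(1,2) D(4)[OF level] lipschitz[OF level] less_imp_le[OF L] h])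
  have "\<mu> * B (x + h) \<le> \<mu> * (B x + grad B x \<bullet> h + ?r\<^sup>2 / 2 + ?r ^ 3 / (3 * (1 - \<beta>)))"
    using \<mu>_bounds(1) params by (intro mult_left_mono barrier_upper_bound h) auto
  also have "\<dots> = \<mu> * (B x + grad B x \<bullet> h + h \<bullet> (hessian B x *v h) / 2) + \<mu> * (?r ^ 3 / (3 * (1 - \<beta>)))"
    using local_norm_sq[OF in_S] by (simp add: algebra_simps)
  also have "\<mu> * (?r ^ 3 / (3 * (1 - \<beta>))) \<le> (1/4) * (?r ^ 3 / (3 * (1 - \<beta>)))"
    using \<mu>_bounds r \<beta> by (intro mult_right_mono) auto
  also have "\<dots> = (L\<phi> - L) / 6 * ?r ^ 3" using \<beta> by (simp add: L\<phi>_def field_simps)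
  finally show ?thesis using f
    by (simp add: barrier_obj_def \<phi>_derivatives inner_add_left inner_add_right algebra_simps add_divide_distrib
        diff_divide_distrib)
qed

end

section \<open>Decrease of the objective in one iteration\<close>

lemma min_ratio_cases:
  assumes "0 < s" "0 < b" "0 \<le> q"
  shows "0 < min_ratio s b q" "min_ratio s b q \<le> s" "min_ratio s b q * q \<le> b"
    "min_ratio s b q = s \<or> (0 < q \<and> min_ratio s b q = b / q)"
proof -
  have "min_ratio s b q * q \<le> b / q * q" if "q \<noteq> 0"
    using that assms by (intro mult_right_mono) (auto simp: min_ratio_def)
  then show "min_ratio s b q * q \<le> b" using assms by (cases "q = 0") auto
qed (use assms in \<open>auto simp: min_ratio_def min_def\<close>)

context ncgb_analysis
begin

definition "s\<epsilon> = sqrt \<epsilon>"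

lemma s\<epsilon>: "0 < s\<epsilon>" "s\<epsilon> < 1" "s\<epsilon>\<^sup>2 = \<epsilon>" "s\<epsilon> \<le> \<beta>" "0 < \<beta>"
proof -
  show 1: "0 < s\<epsilon>" "s\<epsilon> < 1" "s\<epsilon>\<^sup>2 = \<epsilon>" "s\<epsilon> \<le> \<beta>" using params by (auto simp: s\<epsilon>_def)
  then show "0 < \<beta>" by linarith
qed

abbreviation "cnc \<equiv> c_nc \<beta> \<theta> \<eta> L"
abbreviation "csol \<equiv> c_sol \<nu> \<zeta> \<beta> \<theta> \<eta> L"
abbreviation "cd \<equiv> c_d \<nu> \<zeta> \<beta> L"

text \<open>When the unit step is rejected, backtracking ends with a step length of at least \<open>3 * step\<close> for
negative curvature, and with \<open>a * norm d \<ge> 6 * step * s\<epsilon>\<close> for a Newton direction \<open>d\<close> and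
step length \<open>a\<close>.\<close>

definition "step = (1 - \<beta>) * (1 - \<eta>) * \<theta> / (L * (1 - \<beta>) + 1/2)"

lemma step: "0 < step" "step = (1 - \<eta>) * \<theta> / L\<phi>"
proof -
  have "0 < L * (1 - \<beta>) + 1/2" using L params by (intro add_pos_pos mult_pos_pos) auto
  then show "0 < step" unfolding step_def using params by (intro divide_pos_pos mult_pos_pos) auto
  show "step = (1 - \<eta>) * \<theta> / L\<phi>" by (simp add: step_def L\<phi>_def)
qed

lemma cnc_eq: "cnc = \<eta> / 2 * min 1 ((3 * step)\<^sup>2)"
  by (simp only: c_nc_def step_def times_divide_eq_right mult.assoc)

lemma csol_eq: "csol = \<eta> * min (cd\<^sup>2) ((6 * step)\<^sup>2)"
  by (simp only: c_sol_def step_def times_divide_eq_right mult.assoc)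

lemma cd_bounds: "0 < cd" "cd \<le> 1"
proof -
  define X where "X = (1 - \<beta>)\<^sup>2 + sqrt \<nu>"
  have "1 \<le> sqrt \<nu>" using \<nu>_ge_1 by simp
  then have X: "1 \<le> X" using zero_le_power2[of "1 - \<beta>"] unfolding X_def by linarith
  have LX: "4 * X \<le> (L + \<zeta> + 4) * X" using L params X by (intro mult_right_mono) auto
  have den: "1 \<le> (L + \<zeta> + 4) * X + 1 - \<beta>" using LX X params by linarith
  have num: "0 < (1 - \<beta>) ^ 3" "(1 - \<beta>) ^ 3 \<le> 1"
    using params s\<epsilon> by (auto intro!: power_le_one)
  have cd: "cd = (1 - \<beta>) ^ 3 / ((L + \<zeta> + 4) * X + 1 - \<beta>)" by (simp add: c_d_def X_def)
  show "0 < cd" unfolding cd using num den by (intro divide_pos_pos) auto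
  have "(1 - \<beta>) ^ 3 \<le> (L + \<zeta> + 4) * X + 1 - \<beta>" using num den by linarith
  then show "cd \<le> 1" unfolding cd using den by (subst divide_le_eq_1_pos) auto
qed

lemma cnc_pos: "0 < cnc" and csol_pos: "0 < csol"
  unfolding cnc_eq csol_eq using step(1) cd_bounds(1) params by (auto intro!: mult_pos_pos)

end

context ncgb_point
begin

lemma ray_bound:
  assumes "norm (Q M *v d) \<le> \<beta>" "0 \<le> t" "t \<le> 1"
  shows "\<phi> (x + t *\<^sub>R (P M *v d)) \<le> \<phi> x + t * (red_grad x M \<bullet> d) + t\<^sup>2 / 2 * (d \<bullet> (red_hess_\<phi> x M *v d))
    + L\<phi> / 6 * (t * norm d) ^ 3"
proof -
  let ?h = "t *\<^sub>R (P M *v d)"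
  have loc: "local_norm B x ?h = t * norm (Q M *v d)" using assms by (simp add: local_norm_scaleR local_norm_P)
  have "local_norm B x ?h \<le> \<beta>"
    unfolding loc using assms mult_left_le_one_le[of "norm (Q M *v d)" t] by simp
  from \<phi>_upper_bound[OF this] have "\<phi> (x + ?h) \<le> \<phi> x + grad \<phi> x \<bullet> ?h + ?h \<bullet> (hessian \<phi> x *v ?h) / 2
      + L\<phi> / 6 * (t * norm (Q M *v d)) ^ 3" unfolding loc .
  also have "L\<phi> / 6 * (t * norm (Q M *v d)) ^ 3 \<le> L\<phi> / 6 * (t * norm d) ^ 3"
    using assms L\<phi>_pos Q_norm[of d] by (intro mult_left_mono power_mono) auto
  finally show ?thesis
    by (simp add: red_grad_inner red_hess_inner matrix_vector_mult_scaleR power2_eq_square)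
qed

text \<open>The scaling makes the Rayleigh quotient of \<open>d\<close> at most \<open>- norm d\<close>. If the second term of the minimum
applies, then \<open>d\<close> is at least as long as its projection, which has length \<open>\<beta>\<close>.\<close>

lemma negative_curvature_direction:
  assumes curv: "v \<bullet> (red_hess_\<phi> x M *v v) \<le> - c * (norm v)\<^sup>2" and c: "0 < c" and v: "v \<noteq> 0"
    and d: "d = cg_direction x M v NC"
  shows "red_grad x M \<bullet> d \<le> 0" "d \<bullet> (red_hess_\<phi> x M *v d) \<le> - (norm d ^ 3)"
    "norm (Q M *v d) \<le> \<beta>" "min c \<beta> \<le> norm d"
proof -
  let ?k = "v \<bullet> (red_hess_\<phi> x M *v v)" and ?q = "norm (Q M *v v)" and ?n = "norm v"
  define s where "s = \<bar>?k\<bar> / ?n ^ 3"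
  define m where "m = min_ratio s \<beta> ?q"
  define \<sigma> where "\<sigma> = sign_pm (red_grad x M \<bullet> v)"
  have n: "0 < ?n" using v by simp
  then have cn: "0 < c * ?n\<^sup>2" using c by simp
  then have k: "?k < 0" "c * ?n\<^sup>2 \<le> \<bar>?k\<bar>" using curv by auto
  have s: "0 < s" unfolding s_def using k n by (intro divide_pos_pos) auto
  have sn: "s * ?n ^ 3 = - ?k" using n k by (simp add: s_def)
  have "c * ?n\<^sup>2 \<le> (s * ?n) * ?n\<^sup>2" using sn k by (simp add: power2_eq_square power3_eq_cube mult_ac)
  then have cs: "c \<le> s * ?n" using n by simp
  note m = min_ratio_cases[OF s s\<epsilon>(5) norm_ge_zero[of "Q M *v v"], folded m_def]
  have \<sigma>: "\<bar>\<sigma>\<bar> = 1" "\<sigma> * \<sigma> = 1" "0 \<le> \<sigma> * (red_grad x M \<bullet> v)" by (auto simp: \<sigma>_def sign_pm_def)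
  have deq: "d = (- \<sigma> * m) *\<^sub>R v" by (simp add: d cg_direction_def \<sigma>_def m_def s_def)
  have nd: "norm d = m * ?n" using m(1) by (simp add: deq abs_mult \<sigma>)
  have "red_grad x M \<bullet> d = - (m * (\<sigma> * (red_grad x M \<bullet> v)))" by (simp add: deq)
  then show "red_grad x M \<bullet> d \<le> 0" using m(1) \<sigma>(3) by simp
  have "d \<bullet> (red_hess_\<phi> x M *v d) = (- \<sigma> * m)\<^sup>2 * ?k"
    unfolding deq matrix_vector_mult_scaleR inner_scaleR_left inner_scaleR_right
    by (simp only: power2_eq_square mult.assoc)
  also have "(- \<sigma> * m)\<^sup>2 = (\<sigma> * \<sigma>) * m\<^sup>2" by (simp add: power2_eq_square)
  also have "(\<sigma> * \<sigma>) * m\<^sup>2 * ?k = m\<^sup>2 * - (s * ?n ^ 3)" using sn \<sigma>(2) by simp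
  also have "\<dots> = - (m\<^sup>2 * s * ?n ^ 3)" by simp
  also have "\<dots> \<le> - (m\<^sup>2 * m * ?n ^ 3)" using m(1,2) by (simp add: mult_left_mono mult_right_mono)
  also have "\<dots> = - (norm d ^ 3)" by (simp add: nd power2_eq_square power3_eq_cube)
  finally show "d \<bullet> (red_hess_\<phi> x M *v d) \<le> - (norm d ^ 3)" .
  have "norm (Q M *v d) = m * ?q" 
    unfolding deq matrix_vector_mult_scaleR norm_scaleR using m(1) by (simp add: abs_mult \<sigma>)
  then show "norm (Q M *v d) \<le> \<beta>" using m(3) by simp
  show "min c \<beta> \<le> norm d"
    using m(4)
  proof
    assume "0 < ?q \<and> m = \<beta> / ?q"
    then have q: "0 < ?q" and meq: "m = \<beta> / ?q" by auto
    have "\<beta> * ?q \<le> \<beta> * ?n" using s\<epsilon>(5) Q_norm[of v] by simp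
    then have "\<beta> \<le> norm d" unfolding nd meq using q by (simp add: field_simps)
    then show ?thesis by simp
  qed (use cs nd in simp)
qed

text \<open>Either the unit step is accepted or the last rejected step is long, since it violates the
  decrease condition although the cubic upper model predicts descent.\<close>

lemma line_search_NC:
  assumes dir: "red_grad x M \<bullet> d \<le> 0" "d \<bullet> (red_hess_\<phi> x M *v d) \<le> - (norm d ^ 3)" "norm (Q M *v d) \<le> \<beta>"
    and ls: "line_search x M NC d a"
  shows "\<phi> (x + a *\<^sub>R (P M *v d)) \<le> \<phi> x - cnc * norm d ^ 3" "0 < a" "a \<le> 1"
proof -
  obtain j where j: "sufficient_decrease x M NC d j" "\<forall>i<j. \<not> sufficient_decrease x M NC d i" "a = \<theta> ^ j"
    using ls by (auto simp: line_search_def)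
  show a: "0 < a" "a \<le> 1" using params j by (auto intro: power_le_one)
  have dec: "\<phi> (x + a *\<^sub>R (P M *v d)) < \<phi> x - \<eta> / 2 * a\<^sup>2 * norm d ^ 3"
    using j(1,3) by (simp add: sufficient_decrease_def power_mult[symmetric] mult.commute)
  have "min 1 ((3 * step)\<^sup>2) * norm d ^ 3 \<le> a\<^sup>2 * norm d ^ 3"
  proof (cases "d = 0 \<or> j = 0")
    case True
    then show ?thesis using j(3) mult_right_mono[of "min 1 ((3 * step)\<^sup>2)" 1 "norm d ^ 3"] by auto
  next
    case False
    then obtain i where i: "j = Suc i" and n: "0 < norm d" using not0_implies_Suc by auto
    define t where "t = \<theta> ^ i"
    have t: "0 < t" "t \<le> 1" "a = \<theta> * t" using params j(3) i by (auto simp: t_def intro: power_le_one)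
    have "\<not> sufficient_decrease x M NC d i" using j(2) i by simp
    then have "\<phi> x - \<eta> / 2 * t\<^sup>2 * norm d ^ 3 \<le> \<phi> (x + t *\<^sub>R (P M *v d))"
      by (simp add: sufficient_decrease_def t_def power_mult[symmetric] mult.commute)
    also have "\<dots> \<le> \<phi> x + t * (red_grad x M \<bullet> d) + t\<^sup>2 / 2 * (d \<bullet> (red_hess_\<phi> x M *v d))
        + L\<phi> / 6 * (t * norm d) ^ 3"
      using t by (intro ray_bound dir) auto
    also have "t * (red_grad x M \<bullet> d) \<le> 0" using t dir(1) by (simp add: mult_le_0_iff)
    also have "t\<^sup>2 / 2 * (d \<bullet> (red_hess_\<phi> x M *v d)) \<le> t\<^sup>2 / 2 * - (norm d ^ 3)"
      by (intro mult_left_mono dir(2)) simp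
    finally have "(1 - \<eta>) / 2 * (t\<^sup>2 * norm d ^ 3) \<le> L\<phi> / 6 * t * (t\<^sup>2 * norm d ^ 3)"
      by (simp add: power2_eq_square power3_eq_cube algebra_simps diff_divide_distrib)
    then have "(1 - \<eta>) / 2 \<le> L\<phi> / 6 * t" using t n by simp
    then have "3 * (1 - \<eta>) / L\<phi> \<le> t" using L\<phi>_pos by (simp add: field_simps)
    then have "3 * (1 - \<eta>) / L\<phi> * \<theta> \<le> t * \<theta>" using params by (intro mult_right_mono) auto
    then have "3 * step \<le> a" using t(3) by (simp add: step(2) mult_ac)
    then have "(3 * step)\<^sup>2 \<le> a\<^sup>2" using step(1) by (intro power_mono) auto
    then show ?thesis by (intro mult_right_mono) auto
  qed
  then have "\<eta> / 2 * (min 1 ((3 * step)\<^sup>2) * norm d ^ 3) \<le> \<eta> / 2 * (a\<^sup>2 * norm d ^ 3)"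
    using params by (intro mult_left_mono) auto
  then show "\<phi> (x + a *\<^sub>R (P M *v d)) \<le> \<phi> x - cnc * norm d ^ 3"
    unfolding cnc_eq using dec by (simp add: mult_ac)
qed

lemma NC_step:
  assumes curv: "v \<bullet> (red_hess_\<phi> x M *v v) \<le> - c * (norm v)\<^sup>2" and c: "0 < c" "c \<le> \<beta>" and v: "v \<noteq> 0"
    and d: "d = cg_direction x M v NC" and ls: "line_search x M NC d a"
  shows "\<phi> (x + a *\<^sub>R (P M *v d)) \<le> \<phi> x - cnc * c ^ 3" "local_norm B x (a *\<^sub>R (P M *v d)) \<le> \<beta>"
proof -
  note dir = negative_curvature_direction[OF curv c(1) v d]
  note ls' = line_search_NC[OF dir(1-3) ls]
  have "c ^ 3 \<le> norm d ^ 3" using dir(4) c by (intro power_mono) auto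
  then have "cnc * c ^ 3 \<le> cnc * norm d ^ 3" using cnc_pos by (intro mult_left_mono) auto
  then show "\<phi> (x + a *\<^sub>R (P M *v d)) \<le> \<phi> x - cnc * c ^ 3" using ls'(1) by linarith
  show "local_norm B x (a *\<^sub>R (P M *v d)) \<le> \<beta>"
    using ls' dir(3) mult_left_le_one_le[of "norm (Q M *v d)" a]
    by (simp add: local_norm_scaleR local_norm_P)
qed

abbreviation "Hshift \<equiv> shifted (red_hess_\<phi> x M) s\<epsilon>"

text \<open>Orthogonality of residual and solution makes \<open>- g \<bullet> d\<close> at least the shifted curvature \<open>k\<close> of \<open>d\<close>.
Along a rejected step the contributions of \<open>k\<close> to the cubic model have the right sign, so the shift
\<open>2 * s\<epsilon> * (norm d)\<^sup>2\<close> competes with the cubic term only, and the step must be long. A unit step whose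
direction was cut back is long as well, since the projection of \<open>d\<close> then has length \<open>\<beta> \<ge> s\<epsilon>\<close>.\<close>

lemma SOL_step:
  assumes curv: "s\<epsilon> * (norm v)\<^sup>2 \<le> v \<bullet> (Hshift *v v)" and orth: "v \<bullet> (Hshift *v v) = - (red_grad x M \<bullet> v)"
    and d: "d = cg_direction x M v SOL" and ls: "line_search x M SOL d a"
  shows "\<phi> (x + a *\<^sub>R (P M *v d)) \<le> \<phi> x - csol * s\<epsilon> ^ 3 \<or>
      (\<phi> (x + a *\<^sub>R (P M *v d)) \<le> \<phi> x \<and> a = 1 \<and> d = v \<and> norm d < cd * s\<epsilon>)" (is ?A)
    and "local_norm B x (a *\<^sub>R (P M *v d)) \<le> \<beta>" (is ?B)
proof -
  let ?q = "norm (Q M *v v)"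
  define m where "m = min_ratio 1 \<beta> ?q"
  note m = min_ratio_cases[OF zero_less_one s\<epsilon>(5) norm_ge_zero[of "Q M *v v"], folded m_def]
  have deq: "d = m *\<^sub>R v" by (simp add: d cg_direction_def m_def)
  have Qd: "norm (Q M *v d) \<le> \<beta>" using m by (simp add: deq matrix_vector_mult_scaleR)
  define k where "k = d \<bullet> (Hshift *v d)"
  have kv: "k = m\<^sup>2 * (v \<bullet> (Hshift *v v))"
    by (simp add: k_def deq matrix_vector_mult_scaleR power2_eq_square)
  have "m\<^sup>2 * (s\<epsilon> * (norm v)\<^sup>2) \<le> k" unfolding kv using curv by (intro mult_left_mono) auto
  then have k: "s\<epsilon> * (norm d)\<^sup>2 \<le> k" using m(1) by (simp add: deq power_mult_distrib mult_ac)
  have vv: "0 \<le> v \<bullet> (Hshift *v v)" using curv s\<epsilon>(1) by (meson mult_nonneg_nonneg zero_le_power2 less_imp_le order_trans)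
  have "m * m * (v \<bullet> (Hshift *v v)) \<le> m * (v \<bullet> (Hshift *v v))"
    using m vv by (intro mult_right_mono) (auto simp: mult_left_le)
  then have g: "red_grad x M \<bullet> d \<le> - k"
    unfolding kv using orth by (simp add: deq power2_eq_square)
  have hess: "d \<bullet> (red_hess_\<phi> x M *v d) = k - 2 * s\<epsilon> * (norm d)\<^sup>2" by (simp add: k_def shifted_form)
  obtain j where j: "sufficient_decrease x M SOL d j" "\<forall>i<j. \<not> sufficient_decrease x M SOL d i" "a = \<theta> ^ j"
    using ls by (auto simp: line_search_def)
  have a: "0 < a" "a \<le> 1" using params j by (auto intro: power_le_one)
  show ?B using a Qd mult_left_le_one_le[of "norm (Q M *v d)" a]
    by (simp add: local_norm_scaleR local_norm_P)
  have dec: "\<phi> (x + a *\<^sub>R (P M *v d)) < \<phi> x - \<eta> * s\<epsilon> * (a * norm d)\<^sup>2"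
    using j(1,3) by (simp add: sufficient_decrease_def power_mult[symmetric] power_mult_distrib mult.commute s\<epsilon>_def mult_ac)
  have enough: "\<phi> (x + a *\<^sub>R (P M *v d)) \<le> \<phi> x - csol * s\<epsilon> ^ 3"
    if "y * s\<epsilon> \<le> a * norm d" "0 \<le> y" "csol \<le> \<eta> * y\<^sup>2" for y
  proof -
    have "csol * s\<epsilon> ^ 3 \<le> \<eta> * y\<^sup>2 * s\<epsilon> ^ 3" using that s\<epsilon>(1) by (intro mult_right_mono) auto
    also have "\<dots> = \<eta> * s\<epsilon> * (y * s\<epsilon>)\<^sup>2" by (simp add: power2_eq_square power3_eq_cube)
    also have "\<dots> \<le> \<eta> * s\<epsilon> * (a * norm d)\<^sup>2"
      using that params s\<epsilon>(1) by (intro mult_left_mono power_mono) auto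
    finally show ?thesis using dec by linarith
  qed
  have csol: "csol \<le> \<eta> * cd\<^sup>2" "csol \<le> \<eta> * (6 * step)\<^sup>2"
    unfolding csol_eq using params by (auto intro!: mult_left_mono)
  show ?A
  proof (cases j)
    case 0
    then have a1: "a = 1" using j(3) by simp
    show ?thesis
    proof (cases "cd * s\<epsilon> \<le> norm d")
      case True
      then show ?thesis using enough[of cd] cd_bounds csol a1 by simp
    next
      case False
      have "m = 1"
      proof (rule ccontr)
        assume "m \<noteq> 1"
        then have q: "0 < ?q" and meq: "m = \<beta> / ?q" using m(4) by auto
        have "\<beta> * ?q \<le> \<beta> * norm v" using s\<epsilon>(5) Q_norm[of v] by simp
        then have "\<beta> \<le> norm d" using q m(1) by (simp add: deq meq field_simps)
        moreover have "cd * s\<epsilon> \<le> s\<epsilon>" using cd_bounds s\<epsilon>(1) by simp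
        ultimately show False using False s\<epsilon>(4) by linarith
      qed
      moreover have "0 \<le> \<eta> * s\<epsilon> * (a * norm d)\<^sup>2" using params s\<epsilon>(1) by simp
      ultimately show ?thesis using False a1 dec by (simp add: deq)
    qed
  next
    case (Suc i)
    define t where "t = \<theta> ^ i"
    have t: "0 < t" "t \<le> 1" "a = \<theta> * t" using params j(3) Suc by (auto simp: t_def intro: power_le_one)
    have n: "0 < norm d" using dec by (cases "d = 0") auto
    have "\<not> sufficient_decrease x M SOL d i" using j(2) Suc by simp
    then have "\<phi> x - \<eta> * s\<epsilon> * t\<^sup>2 * (norm d)\<^sup>2 \<le> \<phi> (x + t *\<^sub>R (P M *v d))"
      by (simp add: sufficient_decrease_def t_def power_mult[symmetric] mult.commute s\<epsilon>_def mult_ac)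
    also have "\<dots> \<le> \<phi> x + t * (red_grad x M \<bullet> d) + t\<^sup>2 / 2 * (d \<bullet> (red_hess_\<phi> x M *v d))
        + L\<phi> / 6 * (t * norm d) ^ 3"
      using t by (intro ray_bound Qd) auto
    finally have 1: "- (\<eta> * s\<epsilon> * t\<^sup>2 * (norm d)\<^sup>2) \<le> t * (red_grad x M \<bullet> d)
        + t\<^sup>2 / 2 * (k - 2 * s\<epsilon> * (norm d)\<^sup>2) + L\<phi> / 6 * (t * norm d) ^ 3" by (simp add: hess)
    have 2: "t * (red_grad x M \<bullet> d) \<le> t * - k" using t g by (intro mult_left_mono) auto
    have k0: "0 \<le> k" using k s\<epsilon>(1) by (meson mult_nonneg_nonneg zero_le_power2 less_imp_le order_trans)
    have "t\<^sup>2 / 2 * k \<le> t * k"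
      using t k0 mult_left_le[of t t] by (intro mult_right_mono) (auto simp: power2_eq_square)
    then have "(1 - \<eta>) * s\<epsilon> * (t\<^sup>2 * (norm d)\<^sup>2) \<le> L\<phi> / 6 * (t * norm d) * (t\<^sup>2 * (norm d)\<^sup>2)"
      using 1 2 by (simp add: power2_eq_square power3_eq_cube algebra_simps)
    then have "(1 - \<eta>) * s\<epsilon> \<le> L\<phi> / 6 * (t * norm d)" using t n by simp
    then have "6 * (1 - \<eta>) * s\<epsilon> / L\<phi> \<le> t * norm d" using L\<phi>_pos by (simp add: field_simps)
    then have "6 * (1 - \<eta>) * s\<epsilon> / L\<phi> * \<theta> \<le> t * norm d * \<theta>" using params by (intro mult_right_mono) auto
    then have "6 * step * s\<epsilon> \<le> a * norm d" using t(3) by (simp add: step(2) mult_ac)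
    then show ?thesis using enough[of "6 * step"] csol step(1) by simp
  qed
qed

text \<open>With the multiplier of the Newton system, the gradient at the new point splits into the error of
its linearization, quadratic in \<open>norm d\<close>, and the residual of the projected Newton system, which is
linear in \<open>norm d\<close> with a factor of order \<open>s\<epsilon>\<close>. For \<open>norm d < cd * s\<epsilon>\<close> both are of order \<open>\<epsilon>\<close>; the
constant \<open>cd\<close> is the one for which their bounds add up to exactly \<open>(1 - \<beta>)\<^sup>2 * \<mu>\<close>. The remaining factor
\<open>1 - \<beta>\<close> is lost when the dual norm moves to the new point.\<close>

lemma short_unit_step_stationary:
  assumes res: "norm (red_grad x M + Hshift *v d) \<le> \<zeta> * s\<epsilon> / 2 * norm d"
    and Qd: "norm (Q M *v d) \<le> \<beta>" and short: "norm d < cd * s\<epsilon>"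
    and succ: "barrier_point K B \<nu> (x + P M *v d) M'"
  shows "dual_norm B (x + P M *v d) (grad f (x + P M *v d)
      + transpose A *v (R M *v (hessian f x *v (P M *v d) + grad \<phi> x)) + \<mu> *\<^sub>R grad B x) \<le> (1 - \<beta>) * \<mu>"
proof -
  let ?h = "P M *v d" and ?n = "norm d"
  let ?w = "hessian f x *v ?h + grad \<phi> x"
  let ?e = "grad f (x + ?h) - grad f x - hessian f x *v ?h"
  have \<beta>: "0 < 1 - \<beta>" using params by simp
  have h: "local_norm B x ?h \<le> \<beta>" using Qd by (simp add: local_norm_P)
  have "grad f (x + ?h) + transpose A *v (R M *v ?w) + \<mu> *\<^sub>R grad B x = ?e + (?w + transpose A *v (R M *v ?w))"
    by (simp add: \<phi>_derivatives)
  then have "dual_norm B x (grad f (x + ?h) + transpose A *v (R M *v ?w) + \<mu> *\<^sub>R grad B x)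
      = dual_norm B x (?e + (?w + transpose A *v (R M *v ?w)))" by (rule arg_cong)
  also have "\<dots> \<le> dual_norm B x ?e + norm (transpose (P M) *v ?w)"
    unfolding multiplier_residual[symmetric] by (rule dual_norm_triangle)
  also have "dual_norm B x ?e \<le> L / 2 * ?n\<^sup>2"
  proof -
    have "dual_norm B x ?e \<le> L / 2 * (local_norm B x ?h)\<^sup>2"
      by (rule gradient_linearization_error[OF D(1,2) D(4)[OF level] lipschitz[OF level] less_imp_le[OF L] h])
    also have "\<dots> \<le> L / 2 * ?n\<^sup>2"
      using L Q_norm[of d] by (intro mult_left_mono power_mono) (auto simp: local_norm_P)
    finally show ?thesis .
  qed
  also have "norm (transpose (P M) *v ?w) \<le> (\<zeta> * s\<epsilon> / 2 + \<mu> + 2 * s\<epsilon>) * ?n"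
  proof -
    have "transpose (P M) *v ?w = (red_grad x M + Hshift *v d) - (\<mu> *\<^sub>R (Q M *v d) + (2 * s\<epsilon>) *\<^sub>R d)"
      using red_hess_split[of d]
      by (simp add: matrix_vector_right_distrib red_grad_def shifted_mult red_hess_f_def matrix_vector_mul_assoc matrix_mul_assoc)
    then have "norm (transpose (P M) *v ?w)
        \<le> norm (red_grad x M + Hshift *v d) + norm (\<mu> *\<^sub>R (Q M *v d) + (2 * s\<epsilon>) *\<^sub>R d)"
      by (simp add: norm_triangle_ineq4)
    also have "\<dots> \<le> \<zeta> * s\<epsilon> / 2 * ?n + (norm (\<mu> *\<^sub>R (Q M *v d)) + norm ((2 * s\<epsilon>) *\<^sub>R d))"
      by (intro add_mono res norm_triangle_ineq)
    also have "\<dots> \<le> \<zeta> * s\<epsilon> / 2 * ?n + (\<mu> * ?n + 2 * s\<epsilon> * ?n)"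
      using \<mu>_bounds(1) s\<epsilon>(1) Q_norm[of d] by simp
    finally show ?thesis by (simp add: algebra_simps)
  qed
  also have "L / 2 * ?n\<^sup>2 + (\<zeta> * s\<epsilon> / 2 + \<mu> + 2 * s\<epsilon>) * ?n \<le> (1 - \<beta>)\<^sup>2 * \<mu>"
  proof -
    define X where "X = (1 - \<beta>)\<^sup>2 + sqrt \<nu>"
    have "1 \<le> sqrt \<nu>" using \<nu>_ge_1 by simp
    then have X: "0 < X" using zero_le_power2[of "1 - \<beta>"] unfolding X_def by linarith
    have \<mu>X: "\<mu> = (1 - \<beta>) * s\<epsilon>\<^sup>2 / (2 * X)" using s\<epsilon>(3) by (simp add: \<mu>_def X_def)
    define W where "W = (L + \<zeta> + 4) * X + 1 - \<beta>"
    have "0 < (L + \<zeta> + 4) * X" using L params X by simp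
    then have W: "0 < W" unfolding W_def using \<beta> by linarith
    have cdW: "cd * W = (1 - \<beta>) ^ 3" using W by (simp add: c_d_def W_def X_def)
    have n: "?n \<le> cd * s\<epsilon>" "0 \<le> ?n" using short by auto
    have c0: "0 \<le> cd * s\<epsilon>" using cd_bounds s\<epsilon>(1) by simp
    have "cd * cd * s\<epsilon>\<^sup>2 \<le> cd * s\<epsilon>\<^sup>2"
      using cd_bounds by (intro mult_right_mono mult_left_le) auto
    then have "(cd * s\<epsilon>)\<^sup>2 \<le> cd * s\<epsilon>\<^sup>2" by (simp add: power2_eq_square mult_ac)
    then have n2: "?n\<^sup>2 \<le> cd * s\<epsilon>\<^sup>2" using power_mono[OF n, of 2] by linarith
    have \<mu>s: "\<mu> \<le> (1 - \<beta>) * s\<epsilon> / (2 * X)"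
    proof -
      have "s\<epsilon>\<^sup>2 \<le> s\<epsilon>" using s\<epsilon>(1,2) by (simp add: power2_eq_square mult_left_le)
      then show ?thesis unfolding \<mu>X using \<beta> X by (intro divide_right_mono mult_left_mono) auto
    qed
    have "L / 2 * ?n\<^sup>2 + (\<zeta> * s\<epsilon> / 2 + \<mu> + 2 * s\<epsilon>) * ?n
        \<le> L / 2 * (cd * s\<epsilon>\<^sup>2) + (\<zeta> * s\<epsilon> / 2 + (1 - \<beta>) * s\<epsilon> / (2 * X) + 2 * s\<epsilon>) * (cd * s\<epsilon>)"
      using L params s\<epsilon>(1) \<mu>s n n2 c0 \<mu>_bounds(1) \<beta> X
      by (intro add_mono mult_mono) auto
    also have "\<dots> = s\<epsilon>\<^sup>2 / (2 * X) * (cd * W)"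
      using X by (simp add: W_def field_simps power2_eq_square)
    also have "\<dots> = (1 - \<beta>)\<^sup>2 * \<mu>" unfolding cdW \<mu>X by (simp add: power2_eq_square power3_eq_cube)
    finally show ?thesis .
  qed
  finally have "dual_norm B x (grad f (x + ?h) + transpose A *v (R M *v ?w) + \<mu> *\<^sub>R grad B x) \<le> (1 - \<beta>)\<^sup>2 * \<mu>"
    by simp
  then have "dual_norm B x (grad f (x + ?h) + transpose A *v (R M *v ?w) + \<mu> *\<^sub>R grad B x) / (1 - \<beta>)
      \<le> (1 - \<beta>) * \<mu>" using \<beta> by (simp add: pos_divide_le_eq power2_eq_square mult_ac)
  moreover have "barrier_point K B \<nu> x M" by unfold_locales
  note dual_norm_comparison[OF this succ h params(6)]
  ultimately show ?thesis by (meson order_trans)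
qed

end

section \<open>Counting iterations and products\<close>

lemma card_decreases_le:
  fixes a :: "nat \<Rightarrow> real"
  assumes mono: "\<And>k. k < n \<Longrightarrow> a (Suc k) \<le> a k" and gap: "a 0 - a n \<le> \<Delta>"
    and A: "A \<subseteq> {..<n}" "\<And>k. k \<in> A \<Longrightarrow> a (Suc k) \<le> a k - m" and m: "0 < m"
  shows "card A \<le> nat \<lceil>\<Delta> / m\<rceil>"
proof -
  have "real (card A) * m = (\<Sum>k\<in>A. m)" by simp
  also have "\<dots> \<le> (\<Sum>k\<in>A. a k - a (Suc k))" using A(2) by (intro sum_mono) force
  also have "\<dots> \<le> (\<Sum>k<n. a k - a (Suc k))" using A(1) mono by (intro sum_mono2) auto
  also have "\<dots> = a 0 - a n" by (rule sum_lessThan_telescope')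
  finally have "real (card A) \<le> \<Delta> / m" using gap m by (simp add: pos_le_divide_eq)
  then show ?thesis by linarith
qed

text \<open>A call of kind \<open>c\<close> that fails to decrease the objective substantially is followed by a call of
  the other kind, and every completed call of the other kind does decrease it. Only the last call is
  incomplete, so one extra unit suffices in each bound, whichever kind that call has.\<close>

lemma count_calls:
  fixes a :: "nat \<Rightarrow> real" and c :: "nat \<Rightarrow> bool"
  assumes c1: "\<And>k. Suc k < N \<Longrightarrow> c k \<Longrightarrow> a (Suc k) \<le> a k - m1 \<or> (a (Suc k) \<le> a k \<and> \<not> c (Suc k))"
    and c2: "\<And>k. Suc k < N \<Longrightarrow> \<not> c k \<Longrightarrow> a (Suc k) \<le> a k - m2"
    and m: "0 < m1" "0 < m2" and gap: "\<And>k. k < N \<Longrightarrow> a 0 - a k \<le> \<Delta>"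
  shows "card {k. k < N \<and> \<not> c k} \<le> nat \<lceil>\<Delta> / m2\<rceil> + 1"
    and "card {k. k < N \<and> c k} \<le> nat \<lceil>\<Delta> / m1\<rceil> + nat \<lceil>\<Delta> / m2\<rceil> + 1"
proof -
  have "card {k. k < N \<and> \<not> c k} \<le> nat \<lceil>\<Delta> / m2\<rceil> + 1
      \<and> card {k. k < N \<and> c k} \<le> nat \<lceil>\<Delta> / m1\<rceil> + nat \<lceil>\<Delta> / m2\<rceil> + 1"
  proof (cases N)
    case (Suc n)
    have mono: "a (Suc k) \<le> a k" if "k < n" for k
      using c1[of k] c2[of k] m that Suc by (cases "c k") auto
    define G where "G = {k. k < n \<and> c k \<and> a (Suc k) \<le> a k - m1}"
    define E where "E = {k. k < n \<and> \<not> c k}"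
    have G: "card G \<le> nat \<lceil>\<Delta> / m1\<rceil>"
      by (rule card_decreases_le[of n a]) (use mono gap Suc m in \<open>auto simp: G_def\<close>)
    have E: "card E \<le> nat \<lceil>\<Delta> / m2\<rceil>"
      by (rule card_decreases_le[of n a]) (use mono gap Suc m c2 in \<open>auto simp: E_def\<close>)
    have fin: "finite G" "finite E" by (auto simp: G_def E_def)
    have noncalls: "{k. k < N \<and> \<not> c k} \<subseteq> insert n E" using Suc by (auto simp: E_def)
    have "card {k. k < N \<and> \<not> c k} \<le> card (insert n E)" using noncalls fin by (intro card_mono) auto
    also have "\<dots> \<le> Suc (card E)" by (rule card_insert_le_m1) auto
    finally have 1: "card {k. k < N \<and> \<not> c k} \<le> Suc (card E)" .
    define W where "W = {k. k < n \<and> \<not> c (Suc k)}"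
    have "card W = card (Suc ` W)" by (simp add: card_image)
    have calls: "{k. k < N \<and> c k} \<subseteq> G \<union> W \<union> {k. k = n \<and> c n}"
    proof
      fix k assume "k \<in> {k. k < N \<and> c k}"
      then have k: "k < N" "c k" by auto
      show "k \<in> G \<union> W \<union> {k. k = n \<and> c n}"
      proof (cases "k = n")
        case False
        then have "k < n" using k Suc by simp
        then show ?thesis using c1[of k] k Suc by (auto simp: G_def W_def)
      qed (use k in simp)
    qed
    have finW: "finite W" by (simp add: W_def)
    have W: "card W + card {k. k = n \<and> c n} \<le> Suc (card E)"
    proof (cases "c n")
      case True
      have "Suc ` W \<subseteq> E"
      proof
        fix k assume "k \<in> Suc ` W"
        then obtain i where i: "k = Suc i" "i < n" "\<not> c (Suc i)" by (auto simp: W_def)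
        then have "Suc i \<noteq> n" using True by auto
        then show "k \<in> E" using i by (simp add: E_def)
      qed
      then have "card W \<le> card E" using card_mono[OF fin(2)] \<open>card W = _\<close> by metis
      then show ?thesis using True by simp
    next
      case False
      have "Suc ` W \<subseteq> {k. k < N \<and> \<not> c k}" using Suc by (auto simp: W_def)
      then have "card W \<le> card {k. k < N \<and> \<not> c k}"
        using card_mono[of "{k. k < N \<and> \<not> c k}" "Suc ` W"] \<open>card W = _\<close> by simp
      then show ?thesis using 1 False by simp
    qed
    have "card {k. k < N \<and> c k} \<le> card (G \<union> W \<union> {k. k = n \<and> c n})"
      using calls fin finW by (intro card_mono) auto
    also have "\<dots> \<le> card G + card W + card {k. k = n \<and> c n}"
      using card_Un_le[of "G \<union> W" "{k. k = n \<and> c n}"] card_Un_le[of G W] by linarith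
    finally show ?thesis using 1 W G E by linarith
  qed simp
  then show "card {k. k < N \<and> \<not> c k} \<le> nat \<lceil>\<Delta> / m2\<rceil> + 1"
    and "card {k. k < N \<and> c k} \<le> nat \<lceil>\<Delta> / m1\<rceil> + nat \<lceil>\<Delta> / m2\<rceil> + 1" by auto
qed

context ncgb_analysis
begin

definition gap where "gap = f x0 + \<mu>bar * max (B x0) 0 - \<phi>low"

definition cg_max :: nat where
  "cg_max = min CARD('n) (nat \<lfloor>2 + 4 * sqrt (cg_kappa s\<epsilon> (U\<^sub>H + \<mu>))
     * (ln 24 + 7/2 * ln (cg_kappa s\<epsilon> (U\<^sub>H + \<mu>)) + ln (1 / \<zeta>))\<rfloor>)"

context
  fixes N :: nat and xs :: "nat \<Rightarrow> real^'n" and Ms :: "nat \<Rightarrow> real^'n^'n" and q :: "nat \<Rightarrow> real^'n"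
    and w :: "nat \<Rightarrow> nat" and t :: "nat \<Rightarrow> dir_type" and d :: "nat \<Rightarrow> real^'n" and \<alpha> :: "nat \<Rightarrow> real"
  assumes run: "execution N xs Ms q w t d \<alpha>"
begin

abbreviation "calls k \<equiv> calls_cg xs Ms t d \<alpha> k"

lemma factor_at: "k < N \<Longrightarrow> Ms k ** transpose (Ms k) = matrix_inv (hessian B (xs k))"
  using run by (simp add: execution_def)

lemma point: "k < N \<Longrightarrow> xs k \<in> level \<Longrightarrow>
    ncgb_point A f B \<nu> x0 \<epsilon> \<zeta> \<beta> \<theta> \<eta> \<delta> K b \<mu>bar \<phi>low L U\<^sub>H D (xs k) (Ms k)"
  by unfold_locales (auto simp: factor_at level_D)

text \<open>The stopping measure for the first multiplier equals the norm of the reduced gradient, which is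
therefore nonzero whenever capped conjugate gradients are called.\<close>

lemma inner_start:
  assumes k: "k < N" and x: "xs k \<in> level" and c: "calls k"
  shows "capped_cg (red_hess_\<phi> (xs k) (Ms k)) (red_grad (xs k) (Ms k)) s\<epsilon> \<zeta>"
proof -
  interpret p: ncgb_point A f B \<nu> x0 \<epsilon> \<zeta> \<beta> \<theta> \<eta> \<delta> K b \<mu>bar \<phi>low L U\<^sub>H D "xs k" "Ms k"
    by (rule point[OF k x])
  have "(1 - \<beta>) * \<mu> < dual_norm B (xs k) (grad f (xs k) + transpose A *v multiplier1 (xs k) (Ms k) + \<mu> *\<^sub>R grad B (xs k))"
    using c by (simp add: calls_cg_def)
  also have "grad f (xs k) + transpose A *v multiplier1 (xs k) (Ms k) + \<mu> *\<^sub>R grad B (xs k)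
      = grad \<phi> (xs k) + transpose A *v (R (Ms k) *v grad \<phi> (xs k))"
    by (simp add: multiplier1_def p.\<phi>_derivatives(1))
  finally have "(1 - \<beta>) * \<mu> < norm (red_grad (xs k) (Ms k))"
    by (simp add: p.multiplier_residual red_grad_def)
  moreover have "0 < (1 - \<beta>) * \<mu>" using params \<mu>_bounds(1) by simp
  ultimately have "red_grad (xs k) (Ms k) \<noteq> 0" by auto
  then show ?thesis
    by unfold_locales (use p.red_hess_sym s\<epsilon>(1) params in auto)
qed

lemma inner_iterations:
  assumes k: "k < N" and x: "xs k \<in> level"
  shows "calls k \<Longrightarrow> w k \<le> cg_max" "\<not> calls k \<Longrightarrow> w k \<le> lanczos_limit CARD('n) s\<epsilon> \<delta>"
proof -
  show "w k \<le> lanczos_limit CARD('n) s\<epsilon> \<delta>" if "\<not> calls k"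
    using run k that unfolding execution_def meo_reaches_def s\<epsilon>_def by simp
  assume c: "calls k"
  interpret p: ncgb_point A f B \<nu> x0 \<epsilon> \<zeta> \<beta> \<theta> \<eta> \<delta> K b \<mu>bar \<phi>low L U\<^sub>H D "xs k" "Ms k"
    by (rule point[OF k x])
  interpret cg: capped_cg "red_hess_\<phi> (xs k) (Ms k)" "red_grad (xs k) (Ms k)" s\<epsilon> \<zeta>
    by (rule inner_start[OF k x c])
  have "cg_reaches (red_hess_\<phi> (xs k) (Ms k)) (red_grad (xs k) (Ms k)) s\<epsilon> \<zeta> 0 (w k)"
    using run k c unfolding execution_def s\<epsilon>_def by simp
  moreover have "0 \<le> U\<^sub>H + \<mu>" using UH_nonneg \<mu>_bounds(1) by simp
  ultimately have "w k \<le> CARD('n)" "real (w k) \<le> 2 + 4 * sqrt (cg_kappa s\<epsilon> (U\<^sub>H + \<mu>))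
      * (ln 24 + 7/2 * ln (cg_kappa s\<epsilon> (U\<^sub>H + \<mu>)) + ln (1 / \<zeta>))"
    by (rule cg.cg_iterations[OF _ p.red_hess_bound])+
  then show "w k \<le> cg_max" unfolding cg_max_def by (intro min.boundedI le_nat_floor)
qed

text \<open>Feasibility of the next iterate is part of the statement because the comparison of dual norms behind
the second claim needs the next iterate in the interior of the cone.\<close>

lemma iteration_step:
  assumes k: "Suc k < N" and x: "xs k \<in> level"
  shows "xs (Suc k) \<in> \<Omega>"
    and "calls k \<Longrightarrow> \<phi> (xs (Suc k)) \<le> \<phi> (xs k) - min csol cnc * s\<epsilon> ^ 3
      \<or> (\<phi> (xs (Suc k)) \<le> \<phi> (xs k) \<and> \<not> calls (Suc k))"
    and "\<not> calls k \<Longrightarrow> \<phi> (xs (Suc k)) \<le> \<phi> (xs k) - cnc * s\<epsilon> ^ 3 / 64"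
proof -
  let ?x = "xs k" and ?M = "Ms k" and ?H = "red_hess_\<phi> (xs k) (Ms k)" and ?g = "red_grad (xs k) (Ms k)"
  have k': "k < N" using k by simp
  interpret p: ncgb_point A f B \<nu> x0 \<epsilon> \<zeta> \<beta> \<theta> \<eta> \<delta> K b \<mu>bar \<phi>low L U\<^sub>H D ?x ?M
    by (rule point[OF k' x])
  have xSuc: "xs (Suc k) = ?x + \<alpha> k *\<^sub>R (P ?M *v d k)" and ls: "line_search ?x ?M (t k) (d k) (\<alpha> k)"
    using run k unfolding execution_def by blast+
  note completed = run[unfolded execution_def, THEN conjunct2, THEN conjunct2, rule_format, OF k, THEN conjunct1]
  have feasible: "xs (Suc k) \<in> \<Omega>" if "local_norm B ?x (\<alpha> k *\<^sub>R (P ?M *v d k)) \<le> \<beta>"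
  proof -
    have "xs (Suc k) \<in> S" unfolding xSuc
      using that params by (intro Dikin_ellipsoid[OF p.in_S]) auto
    moreover have "A *v xs (Suc k) = b"
      using level_D(1)[OF x] p.A_P[of "d k"]
      by (simp add: xSuc matrix_vector_right_distrib matrix_vector_mult_scaleR strictly_feasible_def)
    ultimately show ?thesis by (simp add: strictly_feasible_def)
  qed
  have cgcase: "xs (Suc k) \<in> \<Omega> \<and> (\<phi> (xs (Suc k)) \<le> \<phi> (xs k) - min csol cnc * s\<epsilon> ^ 3
      \<or> (\<phi> (xs (Suc k)) \<le> \<phi> (xs k) \<and> \<not> calls (Suc k)))" if c: "calls k"
  proof -
    interpret cg: capped_cg ?H ?g s\<epsilon> \<zeta> by (rule inner_start[OF k' x c])
    obtain v where v: "cg_returns ?H ?g s\<epsilon> \<zeta> 0 (w k) v (t k)" "d k = cg_direction ?x ?M v (t k)"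
      using completed c unfolding s\<epsilon>_def by auto
    have s3: "0 \<le> s\<epsilon> ^ 3" using s\<epsilon>(1) by simp
    show ?thesis
    proof (cases "t k")
      case NC
      have "v \<bullet> (shifted ?H s\<epsilon> *v v) < s\<epsilon> * (norm v)\<^sup>2"
        using cg.returns_NC v(1) NC by (simp add: low_curvature_def)
      then have "v \<noteq> 0" "v \<bullet> (?H *v v) \<le> - s\<epsilon> * (norm v)\<^sup>2" by (auto simp: shifted_form)
      note step = p.NC_step[OF this(2) s\<epsilon>(1) s\<epsilon>(4) this(1), of "d k" "\<alpha> k"]
      have "\<phi> (xs (Suc k)) \<le> \<phi> ?x - cnc * s\<epsilon> ^ 3" "xs (Suc k) \<in> \<Omega>"
        using step v(2) ls feasible by (auto simp: NC xSuc)
      moreover have "min csol cnc * s\<epsilon> ^ 3 \<le> cnc * s\<epsilon> ^ 3" using s3 by (intro mult_right_mono) auto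
      ultimately show ?thesis by linarith
    next
      case SOL
      note sol = cg.returns_SOL[OF v(1)[unfolded SOL]]
      note step = p.SOL_step[OF sol(1,2) v(2)[unfolded SOL] ls[unfolded SOL]]
      have feas: "xs (Suc k) \<in> \<Omega>" using step(2) feasible by blast
      have "min csol cnc * s\<epsilon> ^ 3 \<le> csol * s\<epsilon> ^ 3" using s3 by (intro mult_right_mono) auto
      moreover have "\<not> calls (Suc k)"
        if u: "\<alpha> k = 1" "d k = v" "norm (d k) < cd * s\<epsilon>"
      proof -
        have "xs (Suc k) \<in> S" using feas by (simp add: strictly_feasible_def)
        then have "barrier_point K B \<nu> (?x + P ?M *v d k) (Ms (Suc k))"
          using factor_at[OF k] xSuc u(1) by (intro barrier_point.intro barrier_point_axioms.intro) (auto intro: barrier_axioms)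
        moreover have "norm (Q ?M *v d k) \<le> \<beta>" using step(2) u(1) by (simp add: p.local_norm_P)
        ultimately have "dual_norm B (xs (Suc k)) (grad f (xs (Suc k)) + transpose A *v multiplier2 xs Ms t d \<alpha> (Suc k)
            + \<mu> *\<^sub>R grad B (xs k)) \<le> (1 - \<beta>) * \<mu>"
          using p.short_unit_step_stationary[of "d k" "Ms (Suc k)"] sol(3) u SOL by (simp add: xSuc)
        then show ?thesis by (simp add: calls_cg_def min_less_iff_disj not_less)
      qed
      ultimately show ?thesis using step(1) feas by (auto simp: xSuc)
    qed
  qed
  have meocase: "xs (Suc k) \<in> \<Omega> \<and> \<phi> (xs (Suc k)) \<le> \<phi> (xs k) - cnc * s\<epsilon> ^ 3 / 64" if c: "\<not> calls k"
  proof -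
    obtain v where v: "meo_returns (red_hess_f ?x ?M) s\<epsilon> \<delta> (q k) (w k) v" "d k = meo_direction ?x ?M v" "t k = NC"
      using completed c unfolding s\<epsilon>_def by auto
    then have n: "norm v = 1" and curv: "v \<bullet> (red_hess_f ?x ?M *v v) \<le> - s\<epsilon> / 2"
      by (auto simp: meo_returns_def lanczos_finds_def)
    have "v \<bullet> (Q ?M *v v) \<le> 1"
      using norm_cauchy_schwarz[of v "Q ?M *v v"] p.Q_norm[of v] n by simp
    then have "\<mu> * (v \<bullet> (Q ?M *v v)) \<le> \<mu> * 1" using \<mu>_bounds(1) by (intro mult_left_mono) auto
    moreover have "\<epsilon> \<le> s\<epsilon>" using s\<epsilon>(1-3) by (metis less_imp_le mult_left_le power2_eq_square)
    ultimately have "v \<bullet> (?H *v v) \<le> - (s\<epsilon> / 4) * (norm v)\<^sup>2"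
      using curv \<mu>_bounds(2) by (simp add: p.red_hess_split inner_add_right n)
    moreover have "d k = cg_direction ?x ?M v NC"
      by (simp add: v(2) meo_direction_def cg_direction_def n inner_commute)
    moreover have "v \<noteq> 0" using n by auto
    moreover have "s\<epsilon> / 4 \<le> \<beta>" using s\<epsilon>(1,4) by simp
    ultimately have "\<phi> (xs (Suc k)) \<le> \<phi> ?x - cnc * (s\<epsilon> / 4) ^ 3" "xs (Suc k) \<in> \<Omega>"
      using p.NC_step[of v "s\<epsilon> / 4" "d k" "\<alpha> k"] ls s\<epsilon>(1) feasible by (auto simp: v(3) xSuc)
    then show ?thesis by (simp add: power_divide)
  qed
  show "xs (Suc k) \<in> \<Omega>" using cgcase meocase by blast
  show "calls k \<Longrightarrow> \<phi> (xs (Suc k)) \<le> \<phi> (xs k) - min csol cnc * s\<epsilon> ^ 3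
      \<or> (\<phi> (xs (Suc k)) \<le> \<phi> (xs k) \<and> \<not> calls (Suc k))" using cgcase by blast
  show "\<not> calls k \<Longrightarrow> \<phi> (xs (Suc k)) \<le> \<phi> (xs k) - cnc * s\<epsilon> ^ 3 / 64" using meocase by blast
qed

lemma decreases_pos: "0 < min csol cnc * s\<epsilon> ^ 3" "0 < cnc * s\<epsilon> ^ 3 / 64"
  using cnc_pos csol_pos s\<epsilon>(1) by auto

lemma iterates_in_level: "k < N \<Longrightarrow> xs k \<in> level \<and> \<phi> (xs k) \<le> \<phi> x0"
proof (induction k)
  case 0
  have "xs 0 = x0" using run by (simp add: execution_def)
  then show ?case using x0_level by simp
next
  case (Suc k)
  then have x: "xs k \<in> level" "\<phi> (xs k) \<le> \<phi> x0" by auto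
  have "\<phi> (xs (Suc k)) \<le> \<phi> (xs k)"
    using iteration_step(2,3)[OF Suc.prems x(1)] decreases_pos by linarith
  then have "\<phi> (xs (Suc k)) \<le> \<phi> x0" using x by linarith
  then show ?case using level_I[OF iteration_step(1)[OF Suc.prems x(1)]] by blast
qed

lemma call_counts:
  "card {k. k < N \<and> \<not> calls k} \<le> K2 \<epsilon> \<beta> \<theta> \<eta> L gap"
  "card {k. k < N \<and> calls k} \<le> K1 \<nu> \<epsilon> \<zeta> \<beta> \<theta> \<eta> L gap"
proof -
  have s3: "\<epsilon> powr (-3/2) = 1 / s\<epsilon> ^ 3"
  proof -
    have "s\<epsilon> ^ 3 = s\<epsilon> powr 3" using s\<epsilon>(1) by simp
    also have "\<dots> = \<epsilon> powr (3/2)" using params by (simp add: s\<epsilon>_def powr_half_sqrt[symmetric] powr_powr)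
    finally show ?thesis using powr_minus_divide[of \<epsilon> "3/2"] by simp
  qed
  have gap: "\<phi> (xs 0) - \<phi> (xs k) \<le> gap" if "k < N" for k
  proof -
    have "\<mu> * B x0 \<le> \<mu> * max (B x0) 0" using \<mu>_bounds(1) by (intro mult_left_mono) auto
    also have "\<dots> \<le> \<mu>bar * max (B x0) 0" using \<mu>bar by (intro mult_right_mono) auto
    finally have "\<phi> x0 \<le> f x0 + \<mu>bar * max (B x0) 0" by (simp add: barrier_obj_def)
    moreover have "xs 0 = x0" using run by (simp add: execution_def)
    moreover have "\<phi>low \<le> \<phi> (xs k)" using low level_D(1) iterates_in_level[OF that] by blast
    ultimately show ?thesis by (simp add: gap_def)
  qed
  note counts = count_calls[of N calls "\<lambda>k. \<phi> (xs k)", OF _ _ decreases_pos gap]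
  have in_level: "xs k \<in> level" if "Suc k < N" for k using iterates_in_level[of k] that by simp
  have "card {k. k < N \<and> \<not> calls k} \<le> nat \<lceil>gap / (cnc * s\<epsilon> ^ 3 / 64)\<rceil> + 1"
    by (rule counts(1)[OF iteration_step(2) iteration_step(3)]) (simp_all add: in_level)
  then show "card {k. k < N \<and> \<not> calls k} \<le> K2 \<epsilon> \<beta> \<theta> \<eta> L gap"
    unfolding K2_def s3 by (simp add: mult.commute)
  have "card {k. k < N \<and> calls k} \<le> nat \<lceil>gap / (min csol cnc * s\<epsilon> ^ 3)\<rceil> + nat \<lceil>gap / (cnc * s\<epsilon> ^ 3 / 64)\<rceil> + 1"
    by (rule counts(2)[OF iteration_step(2) iteration_step(3)]) (simp_all add: in_level)
  then show "card {k. k < N \<and> calls k} \<le> K1 \<nu> \<epsilon> \<zeta> \<beta> \<theta> \<eta> L gap"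
    unfolding K1_def s3 by (simp add: mult.commute)
qed

lemma total_products:
  "(\<Sum>k<N. iteration_products xs Ms w t d \<alpha> k)
    \<le> K1 \<nu> \<epsilon> \<zeta> \<beta> \<theta> \<eta> L gap * (cg_max + 2) + K2 \<epsilon> \<beta> \<theta> \<eta> L gap * (lanczos_limit CARD('n) s\<epsilon> \<delta> + 1)"
proof -
  let ?C = "{k. k < N \<and> calls k}" and ?E = "{k. k < N \<and> \<not> calls k}"
  have split: "{..<N} = ?C \<union> ?E" "?C \<inter> ?E = {}" "finite ?C" "finite ?E" by auto
  have "(\<Sum>k<N. iteration_products xs Ms w t d \<alpha> k)
      = (\<Sum>k\<in>?C. w k + 2) + (\<Sum>k\<in>?E. w k + 1)"
    unfolding split(1) by (subst sum.union_disjoint) (auto simp: iteration_products_def)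
  also have "\<dots> \<le> (\<Sum>k\<in>?C. cg_max + 2) + (\<Sum>k\<in>?E. lanczos_limit CARD('n) s\<epsilon> \<delta> + 1)"
    using inner_iterations iterates_in_level by (intro add_mono sum_mono) auto
  also have "\<dots> = card ?C * (cg_max + 2) + card ?E * (lanczos_limit CARD('n) s\<epsilon> \<delta> + 1)" by simp
  also have "\<dots> \<le> K1 \<nu> \<epsilon> \<zeta> \<beta> \<theta> \<eta> L gap * (cg_max + 2)
      + K2 \<epsilon> \<beta> \<theta> \<eta> L gap * (lanczos_limit CARD('n) s\<epsilon> \<delta> + 1)"
    by (intro add_mono mult_right_mono call_counts) auto
  finally show ?thesis .
qed

lemma total_iterations: "N \<le> K1 \<nu> \<epsilon> \<zeta> \<beta> \<theta> \<eta> L gap + K2 \<epsilon> \<beta> \<theta> \<eta> L gap"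
proof -
  have "{..<N} = {k. k < N \<and> calls k} \<union> {k. k < N \<and> \<not> calls k}" by auto
  then have "N \<le> card {k. k < N \<and> calls k} + card {k. k < N \<and> \<not> calls k}"
    using card_Un_le[of "{k. k < N \<and> calls k}" "{k. k < N \<and> \<not> calls k}"] by (metis card_lessThan)
  then show ?thesis using call_counts by linarith
qed

lemma count_total_ops:
  "count (total_ops N xs Ms w t d \<alpha>) c
    = (if c = Cholesky then N else 0) + (\<Sum>k<N. iteration_products xs Ms w t d \<alpha> k) * count (Hv_ops CARD('m)) c"
  by (auto simp: total_ops_def count_sum sum_Suc sum_distrib_right)

end

end

section \<open>The total cost\<close>

lemma count_Hv_ops:
  "count (Hv_ops m) Cholesky = 0" "count (Hv_ops m) Hess_vec = 1" "count (Hv_ops m) Gram_product = 2"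
  "count (Hv_ops m) Triangular_solve = 2 * m + 6"
  by (simp_all add: Hv_ops_def Q_vec_ops_def)

lemma soft_const_ge:
  assumes "0 \<le> U" "0 < \<zeta>" "\<zeta> < 1" "0 < \<epsilon>" "\<epsilon> < 1"
  shows "500 \<le> soft_const U \<zeta> * (1 + ln (1 / \<epsilon>))"
proof -
  have "0 \<le> ln (1 + U)" "0 \<le> ln (1 / \<zeta>)" "0 \<le> ln (1 / \<epsilon>)" using assms by auto
  then have "500 * 1 * 1 * 1 \<le> 500 * sqrt (1 + U) * (1 + ln (1 + U) + ln (1 / \<zeta>)) * (1 + ln (1 / \<epsilon>))"
    using assms by (intro mult_mono) auto
  then show ?thesis by (simp add: soft_const_def)
qed

lemma ln_24_le: "ln (24::real) \<le> 5"
proof -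
  have "(2::real) ^ 5 \<le> exp 1 ^ 5" using exp_ge_add_one_self[of "1::real"] by (intro power_mono) auto
  also have "\<dots> = exp 5" by (simp flip: exp_of_nat_mult)
  finally have "(24::real) \<le> exp 5" by simp
  then show ?thesis using ln_le_cancel_iff[of 24 "exp 5 :: real"] by simp
qed

text \<open>The condition number is at most \<open>(9/4) * (1 + U) / sqrt \<epsilon>\<close>; its logarithm is a sum, which is split into
the factors of the soft bound by \<open>1 + a + b \<le> (1 + a) * (1 + b)\<close> for nonnegative \<open>a\<close> and \<open>b\<close>.\<close>

lemma cg_bound_soft:
  assumes U: "0 \<le> U" and \<zeta>: "0 < \<zeta>" "\<zeta> < 1" and \<epsilon>: "0 < \<epsilon>" "\<epsilon> < 1" and m: "0 \<le> m" "m \<le> \<epsilon> / 4"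
    and \<kappa>: "\<kappa> = cg_kappa (sqrt \<epsilon>) (U + m)"
  shows "2 * (2 + 4 * sqrt \<kappa> * (ln 24 + 7/2 * ln \<kappa> + ln (1 / \<zeta>)) + 2)
    \<le> soft_const U \<zeta> * (1 + ln (1 / \<epsilon>)) * \<epsilon> powr (-1/4)"
proof -
  define s where "s = sqrt \<epsilon>"
  have s: "0 < s" "s < 1" "s\<^sup>2 = \<epsilon>" using \<epsilon> by (auto simp: s_def)
  have "\<epsilon> \<le> s" using s by (metis less_imp_le mult_left_le power2_eq_square)
  then have "U + m + 2 * s \<le> (9/4) * (1 + U)" using m s U by simp
  then have \<kappa>_le: "\<kappa> \<le> (9/4) * (1 + U) / s"
    unfolding \<kappa> cg_kappa_def s_def[symmetric] by (rule divide_right_mono) (use s in simp)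
  have \<kappa>_ge: "1 \<le> \<kappa>"
    unfolding \<kappa> cg_kappa_def s_def[symmetric] using s U m by (simp add: field_simps)
  have inv_s: "1 / s = (\<epsilon> powr (-1/4))\<^sup>2"
    using \<epsilon> by (simp add: s_def powr_half_sqrt[symmetric] powr_minus_divide[symmetric] powr_power)
  define E where "E = \<epsilon> powr (-1/4)"
  have E: "1 \<le> E" using \<epsilon> powr_mono'[of "-1/4" 0 \<epsilon>] by (simp add: E_def)
  have "sqrt \<kappa> \<le> sqrt ((3/2)\<^sup>2 * (1 + U) * E\<^sup>2)"
  proof (rule real_sqrt_le_mono)
    have "(9/4) * (1 + U) / s = (3/2)\<^sup>2 * (1 + U) * E\<^sup>2"
      unfolding E_def inv_s[symmetric] by (simp add: power2_eq_square)
    then show "\<kappa> \<le> (3/2)\<^sup>2 * (1 + U) * E\<^sup>2" using \<kappa>_le by (simp only:)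
  qed
  also have "\<dots> = 3/2 * sqrt (1 + U) * E" using E by (simp add: real_sqrt_mult)
  finally have sq: "sqrt \<kappa> \<le> 3/2 * sqrt (1 + U) * E" .
  have "ln \<kappa> \<le> ln ((9/4) * (1 + U) / s)" using \<kappa>_le \<kappa>_ge U s by (subst ln_le_cancel_iff) auto
  also have "\<dots> = ln (9/4) + ln (1 + U) + ln (1 / \<epsilon>) / 2"
  proof -
    have "ln ((9/4) * (1 + U) / s) = ln ((9/4) * (1 + U)) - ln s" by (rule ln_divide_pos) (use U s in auto)
    moreover have "ln ((9/4) * (1 + U)) = ln (9/4) + ln (1 + U)" by (rule ln_mult_pos) (use U in auto)
    moreover have "ln s = - (ln (1 / \<epsilon>) / 2)" using \<epsilon> by (simp add: s_def ln_sqrt ln_div)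
    ultimately show ?thesis by simp
  qed
  also have "ln (9/4) \<le> (9/4 - 1 :: real)" by (rule ln_le_minus_one) simp
  finally have ln\<kappa>: "ln \<kappa> \<le> 5/4 + ln (1 + U) + ln (1 / \<epsilon>) / 2" by simp
  have nn: "0 \<le> ln (1 + U)" "0 \<le> ln (1 / \<zeta>)" "0 \<le> ln (1 / \<epsilon>)" "0 \<le> ln \<kappa>" using U \<zeta> \<epsilon> \<kappa>_ge by auto
  define l where "l = 1 + ln (1 + U) + ln (1 / \<zeta>)"
  define e where "e = 1 + ln (1 / \<epsilon>)"
  have l: "1 \<le> l" and e: "1 \<le> e" using nn by (auto simp: l_def e_def)
  have "ln 24 + 7/2 * ln \<kappa> + ln (1 / \<zeta>) \<le> 10 * (ln (1 + U) + ln (1 / \<zeta>) + 1 + ln (1 / \<epsilon>))"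
    using ln\<kappa> ln_24_le nn by simp
  also have "\<dots> \<le> 10 * (l * e)"
    using mult_nonneg_nonneg[of "l - 1" "e - 1"] l e by (simp add: l_def e_def algebra_simps)
  finally have lg: "ln 24 + 7/2 * ln \<kappa> + ln (1 / \<zeta>) \<le> 10 * (l * e)" .
  have "4 * sqrt \<kappa> * (ln 24 + 7/2 * ln \<kappa> + ln (1 / \<zeta>)) \<le> 4 * (3/2 * sqrt (1 + U) * E) * (10 * (l * e))"
    using sq lg nn U E \<kappa>_ge by (intro mult_mono) auto
  then have 1: "4 * sqrt \<kappa> * (ln 24 + 7/2 * ln \<kappa> + ln (1 / \<zeta>)) \<le> 60 * (sqrt (1 + U) * l * e * E)"
    by (simp add: mult_ac)
  have 2: "1 * 1 * 1 * 1 \<le> sqrt (1 + U) * l * e * E" using U l e E by (intro mult_mono) auto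
  have "2 * (2 + y + 2) \<le> 500 * z" if "y \<le> 60 * z" "1 \<le> z" for y z :: real using that by simp
  from this[OF 1] 2
  have "2 * (2 + 4 * sqrt \<kappa> * (ln 24 + 7/2 * ln \<kappa> + ln (1 / \<zeta>)) + 2) \<le> 500 * (sqrt (1 + U) * l * e * E)"
    by (simp only: mult_1_left)
  then show ?thesis
    unfolding soft_const_def l_def[symmetric] e_def[symmetric] E_def[symmetric] by (simp only: mult.assoc)
qed

lemma lanczos_bound_soft:
  assumes \<delta>: "0 < \<delta>" "\<delta> < 1" and \<epsilon>: "0 < \<epsilon>" and n: "1 \<le> n"
  shows "real (2 * (lanczos_limit n (sqrt \<epsilon>) \<delta> + 1))
    \<le> 4 * min (real n) (1 + real_of_int \<lceil>\<epsilon> powr (-1/4) * ln (1 / \<delta>)\<rceil>)"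
proof -
  have "sqrt \<epsilon> powr (-1/2) = \<epsilon> powr (-1/4)" using \<epsilon> by (simp add: powr_half_sqrt[symmetric] powr_powr)
  moreover have "0 \<le> \<epsilon> powr (-1/4) * ln (1 / \<delta>)" using \<delta> by simp
  ultimately have eq: "real (lanczos_limit n (sqrt \<epsilon>) \<delta>)
      = min (real n) (1 + real_of_int \<lceil>\<epsilon> powr (-1/4) * ln (1 / \<delta>)\<rceil>)"
    by (simp add: lanczos_limit_def of_nat_min)
  have "1 \<le> lanczos_limit n (sqrt \<epsilon>) \<delta>" using n by (simp add: lanczos_limit_def)
  then have "real (2 * (lanczos_limit n (sqrt \<epsilon>) \<delta> + 1)) \<le> 4 * real (lanczos_limit n (sqrt \<epsilon>) \<delta>)" by simp
  then show ?thesis unfolding eq .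
qed

theorem theorem9:
  fixes A :: "real^'n^'m" and b :: "real^'m" and K :: "(real^'n) set"
    and f B :: "real^'n \<Rightarrow> real" and x0 :: "real^'n"
    and \<nu> \<epsilon> \<zeta> \<beta> \<theta> \<eta> \<delta> \<mu>bar \<phi>low L\<^sub>H U\<^sub>g U\<^sub>H :: real
  defines "\<Omega> \<equiv> strictly_feasible A b K"
    and "\<Delta> \<equiv> f x0 + \<mu>bar * max (B x0) 0 - \<phi>low"
  defines "k1 \<equiv> K1 \<nu> \<epsilon> \<zeta> \<beta> \<theta> \<eta> L\<^sub>H \<Delta>" and "k2 \<equiv> K2 \<epsilon> \<beta> \<theta> \<eta> L\<^sub>H \<Delta>"
  assumes "conic_problem A b K f B \<beta> (sublevel_union f B \<Omega> \<mu>bar x0)"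
    and "lhsc_barrier K \<nu> B"
    and "x0 \<in> \<Omega>"
    and "0 < \<epsilon>" "\<epsilon> < 1" "0 < \<zeta>" "\<zeta> < 1" "sqrt \<epsilon> \<le> \<beta>" "\<beta> < 1"
    and "0 < \<theta>" "\<theta> < 1" "0 < \<eta>" "\<eta> < 1" "0 < \<delta>" "\<delta> < 1"
    and "assumption_A f B \<Omega> x0 \<beta> (ncgb.\<mu> \<nu> \<epsilon> \<beta>) \<mu>bar \<phi>low L\<^sub>H U\<^sub>g U\<^sub>H"
  shows "\<exists>Nbar :: nat.
    real Nbar \<le> soft_O U\<^sub>H \<zeta> \<epsilon>
      (min (real CARD('n)) (\<epsilon> powr (-1/4)) * real k1
       + min (real CARD('n)) (1 + real_of_int \<lceil>\<epsilon> powr (-1/4) * ln (1 / \<delta>)\<rceil>) * real k2) \<and>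
    (\<forall>N x M q w t d \<alpha>. ncgb.execution A f B \<nu> x0 \<epsilon> \<zeta> \<beta> \<theta> \<eta> \<delta> N x M q w t d \<alpha> \<longrightarrow>
      (let ops = ncgb.total_ops A f B \<nu> \<epsilon> \<beta> N x M w t d \<alpha> in
       (K = nonneg_orthant \<and> (\<forall>y\<in>interior K. B y = log_barrier y) \<longrightarrow>
          filter_mset (\<lambda>c. c \<in> orthant_main_operations) ops \<subseteq>#
            replicate_mset Nbar Hess_vec + replicate_mset Nbar Gram_product) \<and>
       filter_mset (\<lambda>c. c \<in> general_main_operations) ops \<subseteq>#
         replicate_mset (k1 + k2) Cholesky + replicate_mset Nbar Hess_vec
         + replicate_mset ((2 * CARD('m) + 6) * Nbar) Triangular_solve))"
proof -
  obtain D where D: "open D" "strictly_feasible A b K \<subseteq> D" "Ck_on 2 f D"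
      "\<And>x y. x \<in> sublevel_union f B \<Omega> \<mu>bar x0 \<Longrightarrow> local_norm B x (y - x) \<le> \<beta> \<Longrightarrow> y \<in> D"
    and cone: "rank A = CARD('m)" "pointed_cone K"
    using assms(5) unfolding conic_problem_def by blast
  note A = assms(20)[unfolded assumption_A_def Let_def]
  have \<nu>: "1 \<le> \<nu>" using assms(6) by (simp add: lhsc_barrier_def)
  have "0 < (1 - \<beta>)\<^sup>2 + sqrt \<nu>" using \<nu> by (simp add: add_nonneg_pos)
  then have \<mu>: "0 < ncgb.\<mu> \<nu> \<epsilon> \<beta>" using assms by (simp add: ncgb.\<mu>_def)
  interpret ncgb_analysis A f B \<nu> x0 \<epsilon> \<zeta> \<beta> \<theta> \<eta> \<delta> K b \<mu>bar \<phi>low L\<^sub>H U\<^sub>H D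
  proof unfold_locales
    fix x assume x: "x \<in> sublevel_union f B (strictly_feasible A b K) \<mu>bar x0"
    show "dual_matrix_norm B x (hessian f x) \<le> U\<^sub>H"
      using A x unfolding \<Omega>_def by (auto intro: cSUP_upper)
    show "dual_matrix_norm B x (hessian f y - hessian f x) \<le> L\<^sub>H * local_norm B x (x - y)"
      if "local_norm B x (y - x) \<le> \<beta>" for y
      using A x that unfolding \<Omega>_def by blast
    show "y \<in> D" if "local_norm B x (y - x) \<le> \<beta>" for y using D(4) x that unfolding \<Omega>_def by blast
  next
    fix x assume "x \<in> strictly_feasible A b K"
    then show "\<phi>low \<le> barrier_obj f B (ncgb.\<mu> \<nu> \<epsilon> \<beta>) x" using A \<mu> unfolding \<Omega>_def by auto
  qed (use assms D cone A in auto)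
  have k1: "k1 = K1 \<nu> \<epsilon> \<zeta> \<beta> \<theta> \<eta> L\<^sub>H gap" and k2: "k2 = K2 \<epsilon> \<beta> \<theta> \<eta> L\<^sub>H gap"
    by (simp_all add: k1_def k2_def \<Delta>_def gap_def)
  define cgb where "cgb = cg_max + 2"
  define lb where "lb = lanczos_limit CARD('n) s\<epsilon> \<delta> + 1"
  \<comment> \<open>A product with the reduced Hessian applies \<open>Q\<close> twice and so forms two Gram products.\<close>
  define Nbar where "Nbar = 2 * (k1 * cgb + k2 * lb)"
  define Z where "Z = soft_const U\<^sub>H \<zeta> * (1 + ln (1 / \<epsilon>))"
  have Z: "500 \<le> Z" unfolding Z_def by (rule soft_const_ge[OF UH_nonneg]) (use params in auto)
  have n: "1 \<le> real CARD('n)" by simp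
  have cg: "real (2 * cgb) \<le> Z * min (real CARD('n)) (\<epsilon> powr (-1/4))"
  proof -
    let ?\<kappa> = "cg_kappa s\<epsilon> (U\<^sub>H + \<mu>)"
    let ?X = "2 + 4 * sqrt ?\<kappa> * (ln 24 + 7/2 * ln ?\<kappa> + ln (1 / \<zeta>))"
    have \<kappa>: "1 \<le> ?\<kappa>" using s\<epsilon>(1) UH_nonneg \<mu>_bounds(1) by (simp add: cg_kappa_def field_simps)
    then have X: "0 \<le> ?X" using params by (intro add_nonneg_nonneg mult_nonneg_nonneg) auto
    have "real (2 * cgb) \<le> 2 * (real CARD('n) + 2)" by (simp add: cgb_def cg_max_def)
    also have "\<dots> \<le> 500 * real CARD('n)" using n unfolding distrib_left by linarith
    also have "\<dots> \<le> Z * real CARD('n)" using Z by (intro mult_right_mono) auto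
    finally have 1: "real (2 * cgb) \<le> Z * real CARD('n)" .
    have "real (2 * cgb) \<le> 2 * (real (nat \<lfloor>?X\<rfloor>) + 2)" unfolding cgb_def cg_max_def by simp
    also have "\<dots> \<le> 2 * (?X + 2)" by (rule mult_left_mono[OF add_right_mono[OF of_nat_floor[OF X]]]) simp
    also have "\<dots> \<le> Z * \<epsilon> powr (-1/4)"
      unfolding Z_def by (rule cg_bound_soft[OF UH_nonneg, where m=\<mu>]) (use params \<mu>_bounds in \<open>auto simp: s\<epsilon>_def\<close>)
    finally show ?thesis using 1 by (simp add: min_def)
  qed
  have lz: "real (2 * lb) \<le> Z * min (real CARD('n)) (1 + real_of_int \<lceil>\<epsilon> powr (-1/4) * ln (1 / \<delta>)\<rceil>)"
  proof -
    have "0 \<le> \<epsilon> powr (-1/4) * ln (1 / \<delta>)" using params by simp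
    then have nn: "0 \<le> min (real CARD('n)) (1 + real_of_int \<lceil>\<epsilon> powr (-1/4) * ln (1 / \<delta>)\<rceil>)" by simp
    have "real (2 * lb) \<le> 4 * min (real CARD('n)) (1 + real_of_int \<lceil>\<epsilon> powr (-1/4) * ln (1 / \<delta>)\<rceil>)"
      unfolding lb_def s\<epsilon>_def by (rule lanczos_bound_soft) (use params in auto)
    also have "\<dots> \<le> Z * min (real CARD('n)) (1 + real_of_int \<lceil>\<epsilon> powr (-1/4) * ln (1 / \<delta>)\<rceil>)"
      using Z nn by (intro mult_right_mono) auto
    finally show ?thesis .
  qed
  show ?thesis
  proof (intro exI[of _ Nbar] conjI allI impI)
    have "real Nbar = real k1 * real (2 * cgb) + real k2 * real (2 * lb)"
      by (simp add: Nbar_def algebra_simps)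
    also have "\<dots> \<le> real k1 * (Z * min (real CARD('n)) (\<epsilon> powr (-1/4)))
        + real k2 * (Z * min (real CARD('n)) (1 + real_of_int \<lceil>\<epsilon> powr (-1/4) * ln (1 / \<delta>)\<rceil>))"
      by (intro add_mono mult_left_mono cg lz) auto
    finally show "real Nbar \<le> soft_O U\<^sub>H \<zeta> \<epsilon>
      (min (real CARD('n)) (\<epsilon> powr (-1/4)) * real k1
       + min (real CARD('n)) (1 + real_of_int \<lceil>\<epsilon> powr (-1/4) * ln (1 / \<delta>)\<rceil>) * real k2)"
      unfolding soft_O_def Z_def[symmetric] by (simp add: algebra_simps)
  next
    fix N x M q w t d \<alpha>
    assume run: "ncgb.execution A f B \<nu> x0 \<epsilon> \<zeta> \<beta> \<theta> \<eta> \<delta> N x M q w t d \<alpha>"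
    let ?ops = "total_ops N x M w t d \<alpha>" and ?p = "\<Sum>k<N. iteration_products x M w t d \<alpha> k"
    have p: "2 * ?p \<le> Nbar"
      using total_products[OF run] unfolding Nbar_def cgb_def lb_def k1 k2 by simp
    have N: "N \<le> k1 + k2" using total_iterations[OF run] unfolding k1 k2 .
    note cnt = count_total_ops[OF run] count_Hv_ops
    have tri: "(2 * CARD('m) + 6) * ?p \<le> (2 * CARD('m) + 6) * Nbar"
      using p by (intro mult_left_mono) auto
    show "let ops = ncgb.total_ops A f B \<nu> \<epsilon> \<beta> N x M w t d \<alpha> in
       (K = nonneg_orthant \<and> (\<forall>y\<in>interior K. B y = log_barrier y) \<longrightarrow>
          filter_mset (\<lambda>c. c \<in> orthant_main_operations) ops \<subseteq>#
            replicate_mset Nbar Hess_vec + replicate_mset Nbar Gram_product) \<and>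
       filter_mset (\<lambda>c. c \<in> general_main_operations) ops \<subseteq>#
         replicate_mset (k1 + k2) Cholesky + replicate_mset Nbar Hess_vec
         + replicate_mset ((2 * CARD('m) + 6) * Nbar) Triangular_solve"
      unfolding Let_def
    proof (intro conjI impI mset_subset_eqI)
      fix c
      show "count (filter_mset (\<lambda>c. c \<in> orthant_main_operations) ?ops) c
          \<le> count (replicate_mset Nbar Hess_vec + replicate_mset Nbar Gram_product) c"
        using p by (cases c) (simp_all add: cnt orthant_main_operations_def)
      show "count (filter_mset (\<lambda>c. c \<in> general_main_operations) ?ops) c
          \<le> count (replicate_mset (k1 + k2) Cholesky + replicate_mset Nbar Hess_vec
            + replicate_mset ((2 * CARD('m) + 6) * Nbar) Triangular_solve) c"
        using p N tri by (cases c) (simp_all add: cnt general_main_operations_def mult.commute)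
    qed
  qed
qed

end
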